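(* Let $D$ be a (possibly unbounded) self-adjoint operator on a Hilbert space $H$ and let $a$ be a bounded operator on $H$. The following properties are equivalent: (i) $a$ is strongly $D$-differentiable. (ii) $a$ is weakly $D$-differentiable. (iii) $a$ is $D$-Lipschitz continuous. (iv) The sesquilinear form $S(i[D,a])$ on $\mathrm{dom}(D)$ is bounded. (v) The infinite matrix $m(i[D,a])$ represents a bounded operator. (vi) The operator $Da-aD$ is bounded and its domain of definition is a core for $D$. (vii) The operator $Da-aD$ is bounded and its domain of definition is $\mathrm{dom}(D)$. Moreover, if $a$ is weakly $D$-differentiable with weak $D$-derivative $\delta_w^D(a)$, then $$\forall \xi,\eta\in H:\quad \lim_{t\to 0}\frac{\langle(\alpha_t(a)-a)\xi,\eta\rangle}{t}=\langle\delta_w^D(a)\xi,\eta\rangle,$$ $$a\,\mathrm{dom}(D)\subseteq\mathrm{dom}(D)\quad\text{and}\quad \delta_w^D(a)\big|_{\mathrm{dom}(D)}=i(Da-aD),$$ $$\forall t\in\mathbb{R}:\quad \|\alpha_t(a)-a\|\le\|\delta_w^D(a)\|\,|t|.$$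
   Context: $B(H)$ is the algebra of bounded operators on $H$, $\|\cdot\|$ is the operator norm, and inner products $\langle\cdot,\cdot\rangle$ are linear in the first variable. For $t\in\mathbb{R}$ let $u_t:=e^{itD}$ and, for $a\in B(H)$, $\alpha_t(a):=u_t a u_{-t}=e^{itD}ae^{-itD}$. Strong $D$-differentiability: there is a bounded operator $b$ on $H$ with $\lim_{t\to0}\|(\frac{\alpha_t(a)-a}{t}-b)\xi\|=0$ for all $\xi\in H$. Weak $D$-differentiability: there is a bounded operator $b$ on $H$ with $\lim_{t\to0}|\langle(\frac{\alpha_t(a)-a}{t}-b)\xi,\eta\rangle|=0$ for all $\xi,\eta\in H$; then $b$ is called the weak $D$-derivative of $a$ and denoted $\delta_w^D(a)$. $D$-Lipschitz continuity: $\liminf_{t\to0}\|\frac{\alpha_t(a)-a}{t}\|<\infty$. The sesquilinear form $S(i[D,a])$ on $\mathrm{dom}(D)$ is $S(i[D,a])(\xi,\eta):=i\langle a\xi,D\eta\rangle-i\langle aD\xi,\eta\rangle$ for $\xi,\eta\in\mathrm{dom}(D)$. It is bounded if there is a constant $k$ with $|S(i[D,a])(\xi,\eta)|\le k\|\xi\|\|\eta\|$ for all $\xi,\eta\in\mathrm{dom}(D)$. Matrices: for $n\in\mathbb{Z}$ let $e_n$ be the spectral projection of $D$ corresponding to the interval $]n-1,n]$, and let $d_n:=De_n$, a bounded self-adjoint operator in $e_nB(H)e_n$. The infinite matrix $m(i[D,a])=(m(i[D,a])_{rc})_{r,c\in\mathbb{Z}}$ has entries $m(i[D,a])_{rc}:=i(d_r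 a e_c-e_r a d_c)\in e_rB(H)e_c$. A matrix $(y_{rc})_{r,c\in\mathbb{Z}}$ with $y_{rc}\in e_rB(H)e_c$ represents a bounded operator if there is $b\in B(H)$ with $y_{rc}=e_rbe_c$ for all $r,c\in\mathbb{Z}$. The operator $Da-aD$ has domain of definition $\{\xi\in\mathrm{dom}(D): a\xi\in\mathrm{dom}(D)\}$; it is called bounded if it is bounded (in the norm of $H$) on this domain. A linear subspace $\mathcal{E}$ of $H$ is a core for a closed operator $T$ if $\mathcal{E}\subseteq\mathrm{dom}(T)$ and the closure of the restriction $T|_{\mathcal{E}}$ equals $T$. *)

theory Defs
  imports "HOL-Analysis.Analysis"
begin

section \<open>Complex Hilbert spaces\<close>

class complex_vector = real_vector +
  fixes scaleC :: "complex \<Rightarrow> 'a \<Rightarrow> 'a"  (infixr "*\<^sub>C" 75)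
  assumes scaleC_add_right: "c *\<^sub>C (x + y) = c *\<^sub>C x + c *\<^sub>C y"
    and scaleC_add_left: "(c + d) *\<^sub>C x = c *\<^sub>C x + d *\<^sub>C x"
    and scaleC_scaleC: "c *\<^sub>C (d *\<^sub>C x) = (c * d) *\<^sub>C x"
    and scaleC_one: "1 *\<^sub>C x = x"
    and scaleR_scaleC: "r *\<^sub>R x = complex_of_real r *\<^sub>C x"

text \<open>The inner product is linear in the first variable.\<close>

class complex_inner = complex_vector + real_normed_vector +
  fixes cinner :: "'a \<Rightarrow> 'a \<Rightarrow> complex"
  assumes cinner_commute: "cinner x y = cnj (cinner y x)"
    and cinner_add_left: "cinner (x + y) z = cinner x z + cinner y z"
    and cinner_scaleC_left: "cinner (c *\<^sub>C x) y = c * cinner x y"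
    and cinner_nonneg: "0 \<le> Re (cinner x x)"
    and norm_eq_sqrt_cinner: "norm x = sqrt (Re (cinner x x))"

class chilbert_space = complex_inner + complete_space

definition bounded_clinear :: "('a::complex_inner \<Rightarrow> 'a) \<Rightarrow> bool" where
  "bounded_clinear f \<longleftrightarrow> bounded_linear f \<and> (\<forall>c x. f (c *\<^sub>C x) = c *\<^sub>C f x)"

definition csubspace :: "'a::complex_vector set \<Rightarrow> bool" where
  "csubspace S \<longleftrightarrow> 0 \<in> S \<and> (\<forall>x\<in>S. \<forall>y\<in>S. x + y \<in> S) \<and> (\<forall>c. \<forall>x\<in>S. c *\<^sub>C x \<in> S)"


section \<open>Unbounded operators\<close>

text \<open>
  An operator on \<open>H\<close> with domain of definition \<open>dom T\<close> is a partial function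
  \<open>T :: 'h \<rightharpoonup> 'h\<close>; its value at \<open>\<xi> \<in> dom T\<close> is \<open>the (T \<xi>)\<close>. Equality of such maps is
  equality of operators, domains included, and restriction to a subspace is \<open>T |` S\<close>.
\<close>

definition linear_operator :: "('h::complex_vector \<rightharpoonup> 'h) \<Rightarrow> bool" where
  "linear_operator T \<longleftrightarrow> csubspace (dom T)
     \<and> (\<forall>\<xi>\<in>dom T. \<forall>\<eta>\<in>dom T. the (T (\<xi> + \<eta>)) = the (T \<xi>) + the (T \<eta>))
     \<and> (\<forall>c. \<forall>\<xi>\<in>dom T. the (T (c *\<^sub>C \<xi>)) = c *\<^sub>C the (T \<xi>))"

text \<open>Meaningful for densely defined \<open>T\<close>, where the vector \<open>\<zeta>\<close> below is unique.\<close>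

definition adjoint_operator :: "('h::complex_inner \<rightharpoonup> 'h) \<Rightarrow> ('h \<rightharpoonup> 'h)" where
  "adjoint_operator T = (\<lambda>\<eta>.
     if \<exists>\<zeta>. \<forall>\<xi>\<in>dom T. cinner (the (T \<xi>)) \<eta> = cinner \<xi> \<zeta>
     then Some (THE \<zeta>. \<forall>\<xi>\<in>dom T. cinner (the (T \<xi>)) \<eta> = cinner \<xi> \<zeta>)
     else None)"

definition self_adjoint :: "('h::complex_inner \<rightharpoonup> 'h) \<Rightarrow> bool" where
  "self_adjoint T \<longleftrightarrow> linear_operator T \<and> closure (dom T) = UNIV \<and> adjoint_operator T = T"

definition bounded_operator :: "('h::real_normed_vector \<rightharpoonup> 'h) \<Rightarrow> bool" where
  "bounded_operator T \<longleftrightarrow> (\<exists>k. \<forall>\<xi>\<in>dom T. norm (the (T \<xi>)) \<le> k * norm \<xi>)"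

definition is_core :: "'h::complex_inner set \<Rightarrow> ('h \<rightharpoonup> 'h) \<Rightarrow> bool" where
  "is_core S T \<longleftrightarrow> csubspace S \<and> S \<subseteq> dom T \<and> closure (Map.graph (T |` S)) = Map.graph T"


section \<open>Spectral measures and Borel functional calculus\<close>

definition orthogonal_projection :: "('h::complex_inner \<Rightarrow> 'h) \<Rightarrow> bool" where
  "orthogonal_projection P \<longleftrightarrow> bounded_clinear P \<and> P \<circ> P = P
     \<and> (\<forall>\<xi> \<eta>. cinner (P \<xi>) \<eta> = cinner \<xi> (P \<eta>))"

definition projection_valued_measure :: "(real set \<Rightarrow> 'h::complex_inner \<Rightarrow> 'h) \<Rightarrow> bool" where
  "projection_valued_measure E \<longleftrightarrow>
     (\<forall>B\<in>sets borel. orthogonal_projection (E B))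
     \<and> E UNIV = id
     \<and> (\<forall>A\<in>sets borel. \<forall>B\<in>sets borel. E (A \<inter> B) = E A \<circ> E B)
     \<and> (\<forall>B :: nat \<Rightarrow> real set. range B \<subseteq> sets borel \<longrightarrow> disjoint_family B \<longrightarrow>
          (\<forall>\<xi>. (\<lambda>n. E (B n) \<xi>) sums E (\<Union>n. B n) \<xi>))"

text \<open>The measure \<open>B \<mapsto> \<langle>E(B)\<xi>, \<xi>\<rangle> = \<parallel>E(B)\<xi>\<parallel>\<^sup>2\<close>.\<close>

definition scalar_spectral_measure ::
    "(real set \<Rightarrow> 'h::complex_inner \<Rightarrow> 'h) \<Rightarrow> 'h \<Rightarrow> real measure" where
  "scalar_spectral_measure E \<xi> =
     measure_of UNIV (sets borel) (\<lambda>B. ennreal (Re (cinner (E B \<xi>) \<xi>)))"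

text \<open>
  \<open>T = \<integral> f dE\<close>: the domain is \<open>{\<xi>. \<integral> |f|\<^sup>2 d\<langle>E\<xi>, \<xi>\<rangle> < \<infinity>}\<close>, and \<open>\<langle>T\<xi>, \<xi>\<rangle> = \<integral> f d\<langle>E\<xi>, \<xi>\<rangle>\<close> on
  it. By polarization and density of the domain this determines \<open>T\<close>.
\<close>

definition is_spectral_integral ::
    "(real set \<Rightarrow> 'h::complex_inner \<Rightarrow> 'h) \<Rightarrow> (real \<Rightarrow> complex) \<Rightarrow> ('h \<rightharpoonup> 'h) \<Rightarrow> bool" where
  "is_spectral_integral E f T \<longleftrightarrow> linear_operator T
     \<and> dom T = {\<xi>. integrable (scalar_spectral_measure E \<xi>) (\<lambda>x. (cmod (f x))\<^sup>2)}
     \<and> (\<forall>\<xi>\<in>dom T. cinner (the (T \<xi>)) \<xi> = (LINT x|scalar_spectral_measure E \<xi>. f x))"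

text \<open>
  By the spectral theorem every self-adjoint \<open>D\<close> has a spectral measure. It is unique on Borel
  sets, and it is only ever evaluated there; its values elsewhere are arbitrary.
\<close>

definition spectral_measure :: "('h::chilbert_space \<rightharpoonup> 'h) \<Rightarrow> real set \<Rightarrow> 'h \<Rightarrow> 'h" where
  "spectral_measure D =
     (SOME E. projection_valued_measure E \<and> is_spectral_integral E complex_of_real D)"

definition borel_calculus :: "('h::chilbert_space \<rightharpoonup> 'h) \<Rightarrow> (real \<Rightarrow> complex) \<Rightarrow> ('h \<rightharpoonup> 'h)" where
  "borel_calculus D f = (THE T. is_spectral_integral (spectral_measure D) f T)"


section \<open>Differentiability with respect to an unbounded self-adjoint operator\<close>

text \<open>The unitary \<open>e\<^sup>i\<^sup>t\<^sup>D\<close>, which is everywhere defined.\<close>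

definition exp_itD :: "('h::chilbert_space \<rightharpoonup> 'h) \<Rightarrow> real \<Rightarrow> 'h \<Rightarrow> 'h" where
  "exp_itD D t \<xi> = the (borel_calculus D (\<lambda>x. exp (\<i> * complex_of_real t * complex_of_real x)) \<xi>)"

definition alpha :: "('h::chilbert_space \<rightharpoonup> 'h) \<Rightarrow> real \<Rightarrow> ('h \<Rightarrow> 'h) \<Rightarrow> 'h \<Rightarrow> 'h" where
  "alpha D t a = exp_itD D t \<circ> a \<circ> exp_itD D (- t)"

definition diff_quotient :: "('h::chilbert_space \<rightharpoonup> 'h) \<Rightarrow> ('h \<Rightarrow> 'h) \<Rightarrow> real \<Rightarrow> 'h \<Rightarrow> 'h" where
  "diff_quotient D a t = (\<lambda>\<xi>. (alpha D t a \<xi> - a \<xi>) /\<^sub>R t)"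

definition strongly_D_differentiable :: "('h::chilbert_space \<rightharpoonup> 'h) \<Rightarrow> ('h \<Rightarrow> 'h) \<Rightarrow> bool" where
  "strongly_D_differentiable D a \<longleftrightarrow>
     (\<exists>b. bounded_clinear b \<and> (\<forall>\<xi>. ((\<lambda>t. norm (diff_quotient D a t \<xi> - b \<xi>)) \<longlongrightarrow> 0) (at 0)))"

definition has_weak_D_derivative ::
    "('h::chilbert_space \<rightharpoonup> 'h) \<Rightarrow> ('h \<Rightarrow> 'h) \<Rightarrow> ('h \<Rightarrow> 'h) \<Rightarrow> bool" where
  "has_weak_D_derivative D a b \<longleftrightarrow> bounded_clinear b
     \<and> (\<forall>\<xi> \<eta>. ((\<lambda>t. cmod (cinner (diff_quotient D a t \<xi> - b \<xi>) \<eta>)) \<longlongrightarrow> 0) (at 0))"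

definition weakly_D_differentiable :: "('h::chilbert_space \<rightharpoonup> 'h) \<Rightarrow> ('h \<Rightarrow> 'h) \<Rightarrow> bool" where
  "weakly_D_differentiable D a \<longleftrightarrow> (\<exists>b. has_weak_D_derivative D a b)"

definition weak_D_derivative :: "('h::chilbert_space \<rightharpoonup> 'h) \<Rightarrow> ('h \<Rightarrow> 'h) \<Rightarrow> 'h \<Rightarrow> 'h" where
  "weak_D_derivative D a = (THE b. has_weak_D_derivative D a b)"

definition D_Lipschitz :: "('h::chilbert_space \<rightharpoonup> 'h) \<Rightarrow> ('h \<Rightarrow> 'h) \<Rightarrow> bool" where
  "D_Lipschitz D a \<longleftrightarrow> Liminf (at 0) (\<lambda>t. ereal (onorm (diff_quotient D a t))) < \<infinity>"

definition commutator_form ::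
    "('h::complex_inner \<rightharpoonup> 'h) \<Rightarrow> ('h \<Rightarrow> 'h) \<Rightarrow> 'h \<Rightarrow> 'h \<Rightarrow> complex" where
  "commutator_form D a \<xi> \<eta> = \<i> * cinner (a \<xi>) (the (D \<eta>)) - \<i> * cinner (a (the (D \<xi>))) \<eta>"

definition bounded_form_on :: "'h::complex_inner set \<Rightarrow> ('h \<Rightarrow> 'h \<Rightarrow> complex) \<Rightarrow> bool" where
  "bounded_form_on V S \<longleftrightarrow> (\<exists>k. \<forall>\<xi>\<in>V. \<forall>\<eta>\<in>V. cmod (S \<xi> \<eta>) \<le> k * norm \<xi> * norm \<eta>)"

definition spec_proj :: "('h::chilbert_space \<rightharpoonup> 'h) \<Rightarrow> int \<Rightarrow> 'h \<Rightarrow> 'h" where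
  "spec_proj D n = spectral_measure D {real_of_int n - 1 <.. real_of_int n}"

definition spec_block :: "('h::chilbert_space \<rightharpoonup> 'h) \<Rightarrow> int \<Rightarrow> 'h \<Rightarrow> 'h" where
  "spec_block D n = (\<lambda>\<xi>. the (D (spec_proj D n \<xi>)))"

definition commutator_matrix ::
    "('h::chilbert_space \<rightharpoonup> 'h) \<Rightarrow> ('h \<Rightarrow> 'h) \<Rightarrow> int \<Rightarrow> int \<Rightarrow> 'h \<Rightarrow> 'h" where
  "commutator_matrix D a r c = (\<lambda>\<xi>.
     \<i> *\<^sub>C (spec_block D r (a (spec_proj D c \<xi>)) - spec_proj D r (a (spec_block D c \<xi>))))"

definition represents_bounded_operator ::
    "('h::chilbert_space \<rightharpoonup> 'h) \<Rightarrow> (int \<Rightarrow> int \<Rightarrow> 'h \<Rightarrow> 'h) \<Rightarrow> bool" where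
  "represents_bounded_operator D y \<longleftrightarrow>
     (\<exists>b. bounded_clinear b \<and> (\<forall>r c. y r c = spec_proj D r \<circ> b \<circ> spec_proj D c))"

text \<open>The operator \<open>Da - aD\<close> on its natural domain.\<close>

definition commutator_op :: "('h::complex_inner \<rightharpoonup> 'h) \<Rightarrow> ('h \<Rightarrow> 'h) \<Rightarrow> ('h \<rightharpoonup> 'h)" where
  "commutator_op D a = (\<lambda>\<xi>.
     if \<xi> \<in> dom D \<and> a \<xi> \<in> dom D then Some (the (D (a \<xi>)) - a (the (D \<xi>))) else None)"

end

theory Submission
  imports Defs
begin

text \<open>
  All conditions are compared with a single one: that the form \<open>S(x, y) = i\<langle>ax, Dy\<rangle> - i\<langle>aDx, y\<rangle>\<close> is
  represented on \<open>dom D\<close> by a bounded operator \<open>b\<close> (\<open>form_operator\<close>). The form is the derivative at 0 of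
  \<open>t \<mapsto> \<langle>\<alpha>\<^sub>t(a)x, y\<rangle>\<close> for \<open>x, y\<close> in \<open>dom D\<close> (\<open>quot_form\<close>). Hence a weak derivative represents it, and a
  bound on the difference quotients that recurs as \<open>t\<close> tends to 0 bounds it. Conversely, the unitaries
  \<open>e\<^sup>i\<^sup>t\<^sup>D\<close> preserve norms and \<open>dom D\<close>, so a bound on the form bounds the derivative at all times, and the
  mean value inequality gives \<open>\<parallel>\<alpha>\<^sub>t(a) - a\<parallel> \<le> k\<bar>t\<bar>\<close> (\<open>alpha_Lipschitz\<close>). Moreover, if \<open>S(x, -)\<close> is bounded then
  \<open>\<langle>ax, Dy\<rangle>\<close> is bounded in \<open>y\<close>, and self-adjointness of \<open>D\<close> puts \<open>ax\<close> into \<open>dom D\<close> (\<open>commutator_dom\<close>).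
  On \<open>dom D\<close> the difference quotients then converge in norm by the product rule; being uniformly
  bounded, they converge strongly everywhere. A bound for \<open>Da - aD\<close> on a core bounds the form on the
  core and, by approximation in the graph norm, on \<open>dom D\<close> (\<open>form_operator_if_core\<close>). Finally the entries of
  the commutator matrix are the values of the form on spectral blocks (\<open>commutator_matrix_form\<close>), and
  finitely many blocks approximate every vector of \<open>dom D\<close> in the graph norm.

  The group \<open>e\<^sup>i\<^sup>t\<^sup>D\<close> and the blocks refer to a spectral measure of \<open>D\<close>, so most of the text proves the
  spectral theorem. With \<open>R = (1 + D\<^sup>2)\<^sup>-\<^sup>1\<close>, the bounded operator \<open>R(D - s)R\<close> has the sign of \<open>D - s\<close>, and the
  projection onto the kernel of its positive part serves as the spectral projection of \<open>D\<close> for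
  \<open>]-\<infinity>, s]\<close>; positive parts are obtained from an iteration for the absolute value
  (\<open>negative_spectral_projection\<close>). These projections form a right-continuous family, the functions
  \<open>s \<mapsto> \<parallel>E(s)x\<parallel>\<^sup>2\<close> are distribution functions of measures, and a Dynkin argument produces a projection for
  every Borel set (\<open>represents_exists\<close>). On a bounded interval \<open>D\<close> is approximated by step functions
  (\<open>calculus_window\<close>), which identifies \<open>D\<close> with the integral of the identity (\<open>spectral_theorem\<close>). The
  bounded functional calculus, built from indicator functions by uniform limits, provides \<open>e\<^sup>i\<^sup>t\<^sup>D\<close>, and
  dominated convergence differentiates it on \<open>dom D\<close> (\<open>U_deriv\<close>).
\<close>

section \<open>Inner products and bounded operators\<close>

lemma cinner_add_right: "cinner x (y + z) = cinner x y + cinner x z"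
  for x :: "'a::complex_inner"
  using cinner_commute[of x "y + z"] cinner_commute[of x y] cinner_commute[of x z]
  by (simp add: cinner_add_left)

lemma cinner_scaleC_right: "cinner x (c *\<^sub>C y) = cnj c * cinner x y"
  for x :: "'a::complex_inner"
  using cinner_commute[of x "c *\<^sub>C y"] cinner_commute[of x y]
  by (simp add: cinner_scaleC_left)

lemma cinner_scaleR_left: "cinner (r *\<^sub>R x) y = of_real r * cinner x y"
  by (simp add: scaleR_scaleC cinner_scaleC_left)

lemma cinner_scaleR_right: "cinner x (r *\<^sub>R y) = of_real r * cinner x y"
  by (simp add: scaleR_scaleC cinner_scaleC_right)

lemma cinner_self: "cinner x x = complex_of_real ((norm x)\<^sup>2)"
proof -
  have "Im (cinner x x) = 0"
    using arg_cong[OF cinner_commute[of x x], of Im] by simp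
  moreover have "(norm x)\<^sup>2 = Re (cinner x x)"
    by (simp add: norm_eq_sqrt_cinner cinner_nonneg)
  ultimately show ?thesis by (simp add: complex_eq_iff)
qed

lemma cinner_zero_left [simp]: "cinner 0 y = 0"
  using cinner_scaleR_left[of 0 0 y] by simp

lemma cinner_zero_right [simp]: "cinner x 0 = 0"
  using cinner_scaleR_right[of x 0 0] by simp

lemma cinner_minus_left: "cinner (- x) y = - cinner x y"
  using cinner_scaleR_left[of "-1" x y] by simp

lemma cinner_minus_right: "cinner x (- y) = - cinner x y"
  using cinner_scaleR_right[of x "-1" y] by simp

lemma cinner_diff_left: "cinner (x - y) z = cinner x z - cinner y z"
  using cinner_add_left[of x "- y" z] by (simp add: cinner_minus_left)

lemma cinner_diff_right: "cinner x (y - z) = cinner x y - cinner x z"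
  using cinner_add_right[of x y "- z"] by (simp add: cinner_minus_right)

lemma norm_sq_cinner: "(norm x)\<^sup>2 = Re (cinner x x)"
  by (simp add: cinner_self)

lemma norm_sq_add: "(norm (x + y))\<^sup>2 = (norm x)\<^sup>2 + (norm y)\<^sup>2 + 2 * Re (cinner x y)"
  for x :: "'a::complex_inner"
  using arg_cong[OF cinner_commute[of y x], of Re]
  by (simp add: norm_sq_cinner cinner_add_left cinner_add_right)

lemma norm_sq_diff: "(norm (x - y))\<^sup>2 = (norm x)\<^sup>2 + (norm y)\<^sup>2 - 2 * Re (cinner x y)"
  for x :: "'a::complex_inner"
  using norm_sq_add[of x "- y"] by (simp add: cinner_minus_right)

lemma norm_sq_add_orthogonal:
  "cinner x y = 0 \<Longrightarrow> (norm (x + y))\<^sup>2 = (norm x)\<^sup>2 + (norm y)\<^sup>2" for x :: "'a::complex_inner"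
  by (simp add: norm_sq_add)

lemma norm_scaleC: "norm (c *\<^sub>C x) = cmod c * norm x" for x :: "'a::complex_inner"
proof -
  have "cinner (c *\<^sub>C x) (c *\<^sub>C x) = (c * cnj c) * cinner x x"
    by (simp add: cinner_scaleC_left cinner_scaleC_right)
  also have "\<dots> = complex_of_real ((cmod c * norm x)\<^sup>2)"
    by (simp add: cinner_self complex_norm_square[symmetric] power_mult_distrib del: of_real_power)
  finally have "(norm (c *\<^sub>C x))\<^sup>2 = (cmod c * norm x)\<^sup>2"
    by (simp add: norm_sq_cinner)
  then show ?thesis by (simp add: power2_eq_iff_nonneg)
qed

lemma norm_cinner_le: "cmod (cinner x y) \<le> norm x * norm y" for x :: "'a::complex_inner"
proof (cases "y = 0")
  case False
  let ?n = "(norm y)\<^sup>2" and ?c = "cinner x y"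
  have n: "?n > 0" using False by simp
  let ?z = "x - (?c / of_real ?n) *\<^sub>C y"
  have 1: "cinner x ((?c / of_real ?n) *\<^sub>C y) = of_real ((cmod ?c)\<^sup>2 / ?n)"
    by (simp add: cinner_scaleC_right complex_norm_square mult.commute del: of_real_power)
  have 2: "(norm ((?c / of_real ?n) *\<^sub>C y))\<^sup>2 = (cmod ?c)\<^sup>2 / ?n"
    using n by (simp add: norm_scaleC norm_divide power_mult_distrib power_divide power2_eq_square
        norm_mult)
  have "0 \<le> (norm ?z)\<^sup>2" by simp
  also have "\<dots> = (norm x)\<^sup>2 - (cmod ?c)\<^sup>2 / ?n"
    unfolding norm_sq_diff 1 2 by (simp del: of_real_power of_real_divide)
  finally have "(cmod ?c)\<^sup>2 \<le> (norm x * norm y)\<^sup>2"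
    using n by (simp add: field_simps power_mult_distrib)
  then show ?thesis by (rule power2_le_imp_le) simp
qed simp

lemma bounded_bilinear_cinner: "bounded_bilinear (cinner :: 'a::complex_inner \<Rightarrow> 'a \<Rightarrow> complex)"
proof
  show "\<exists>K. \<forall>a b :: 'a. cmod (cinner a b) \<le> norm a * norm b * K"
    using norm_cinner_le by (intro exI[of _ 1]) auto
qed (auto simp: cinner_add_left cinner_add_right cinner_scaleR_left cinner_scaleR_right scaleR_conv_of_real)

lemmas tendsto_cinner [tendsto_intros] = bounded_bilinear.tendsto[OF bounded_bilinear_cinner]
lemmas cinner_sum_left = bounded_bilinear.sum_left[OF bounded_bilinear_cinner]
lemmas cinner_sum_right = bounded_bilinear.sum_right[OF bounded_bilinear_cinner]

lemma scaleC_zero_left [simp]: "0 *\<^sub>C x = 0" for x :: "'a::complex_vector"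
  using scaleC_add_left[of 0 0 x] by simp

lemma scaleC_zero_right [simp]: "c *\<^sub>C 0 = 0" for c :: complex
  using scaleC_add_right[of c 0 0] by simp

lemma scaleC_minus1: "(-1) *\<^sub>C x = - x" for x :: "'a::complex_vector"
  using scaleR_scaleC[of "-1" x] by simp

lemma scaleC_minus_right: "c *\<^sub>C (- x) = - (c *\<^sub>C x)" for x :: "'a::complex_vector"
  by (simp add: scaleC_minus1[symmetric] scaleC_scaleC)

lemma scaleC_minus_left: "(- c) *\<^sub>C x = - (c *\<^sub>C x)" for x :: "'a::complex_vector"
  by (simp add: scaleC_minus1[symmetric] scaleC_scaleC)

lemma scaleC_diff_right: "c *\<^sub>C (x - y) = c *\<^sub>C x - c *\<^sub>C y" for x :: "'a::complex_vector"
  using scaleC_add_right[of c x "- y"] by (simp add: scaleC_minus_right)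

lemma scaleC_scaleR: "c *\<^sub>C (r *\<^sub>R x) = r *\<^sub>R (c *\<^sub>C x)" for x :: "'a::complex_vector"
  by (simp add: scaleR_scaleC scaleC_scaleC mult.commute)

lemma bounded_linear_scaleC: "bounded_linear (\<lambda>x :: 'a::complex_inner. c *\<^sub>C x)"
  by (rule bounded_linear_intro[of _ "cmod c"])
    (auto simp: scaleC_add_right scaleC_scaleR norm_scaleC mult.commute)

lemmas tendsto_scaleC [tendsto_intros] = bounded_linear.tendsto[OF bounded_linear_scaleC]

lemma norm_le_if_dense:
  fixes x :: "'a::complex_inner"
  assumes "closure V = UNIV" and "0 \<le> k" and "\<And>y. y \<in> V \<Longrightarrow> cmod (cinner x y) \<le> k * norm y"
  shows "norm x \<le> k"
proof -
  have "x \<in> closure V" using assms(1) by simp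
  then obtain s where s: "\<And>n. s n \<in> V" "s \<longlonglongrightarrow> x"
    unfolding closure_sequential by blast
  have "cmod (cinner x x) \<le> k * norm x"
    by (rule LIMSEQ_le[of "\<lambda>n. cmod (cinner x (s n))" _ "\<lambda>n. k * norm (s n)"])
      (auto intro!: tendsto_intros s assms(3))
  then have "norm x * norm x \<le> k * norm x"
    by (simp add: cinner_self power2_eq_square norm_mult)
  then show ?thesis using assms(2) by (cases "x = 0") auto
qed

lemma eq_if_dense:
  fixes x :: "'a::complex_inner"
  assumes "closure V = UNIV" and "\<And>y. y \<in> V \<Longrightarrow> cinner x y = cinner x' y"
  shows "x = x'"
proof -
  have "norm (x - x') \<le> 0"
    by (rule norm_le_if_dense[OF assms(1)]) (simp_all add: cinner_diff_left assms(2))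
  then show ?thesis by simp
qed

lemma eq_if_cinner_eq: "(\<And>y. cinner x y = cinner x' y) \<Longrightarrow> x = x'" for x :: "'a::complex_inner"
  by (rule eq_if_dense[of UNIV]) auto

lemma bounded_clinear_intro:
  assumes "\<And>x y. f (x + y) = f x + f y" "\<And>c x. f (c *\<^sub>C x) = c *\<^sub>C f x"
    and "\<And>x. norm (f x) \<le> k * norm x"
  shows "bounded_clinear f"
  unfolding bounded_clinear_def
  using assms by (auto intro!: bounded_linear_intro[of f k] simp: scaleR_scaleC mult.commute)

lemma bounded_clinear_linear: "bounded_clinear f \<Longrightarrow> bounded_linear f"
  by (simp add: bounded_clinear_def)

lemma bounded_clinear_add: "bounded_clinear f \<Longrightarrow> f (x + y) = f x + f y"
  by (simp add: bounded_clinear_def linear_add bounded_linear.linear)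

lemma bounded_clinear_diff: "bounded_clinear f \<Longrightarrow> f (x - y) = f x - f y"
  by (simp add: bounded_clinear_def linear_diff bounded_linear.linear)

lemma bounded_clinear_minus: "bounded_clinear f \<Longrightarrow> f (- x) = - f x"
  by (simp add: bounded_clinear_def linear_neg bounded_linear.linear)

lemma bounded_clinear_zero: "bounded_clinear f \<Longrightarrow> f 0 = 0"
  by (simp add: bounded_clinear_def linear_0 bounded_linear.linear)

lemma bounded_clinear_scaleC: "bounded_clinear f \<Longrightarrow> f (c *\<^sub>C x) = c *\<^sub>C f x"
  by (simp add: bounded_clinear_def)

lemma bounded_clinear_scaleR: "bounded_clinear f \<Longrightarrow> f (r *\<^sub>R x) = r *\<^sub>R f x"
  by (simp add: bounded_clinear_def linear_cmul bounded_linear.linear)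

lemma bounded_clinear_sum: "bounded_clinear f \<Longrightarrow> f (\<Sum>i\<in>I. g i) = (\<Sum>i\<in>I. f (g i))"
  by (simp add: bounded_clinear_def linear_sum bounded_linear.linear)

lemma bounded_clinear_tendsto: "bounded_clinear f \<Longrightarrow> (g \<longlongrightarrow> x) F \<Longrightarrow> ((\<lambda>n. f (g n)) \<longlongrightarrow> f x) F"
  by (simp add: bounded_clinear_def bounded_linear.tendsto)

lemma bounded_clinear_norm_le: "bounded_clinear f \<Longrightarrow> norm (f x) \<le> onorm f * norm x"
  by (simp add: bounded_clinear_def onorm)

lemma bounded_clinear_id: "bounded_clinear (\<lambda>x. x)"
  by (simp add: bounded_clinear_def bounded_linear_ident)

lemma bounded_clinear_0: "bounded_clinear (\<lambda>x. 0)"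
  by (simp add: bounded_clinear_def)

lemma bounded_clinear_comp:
  "bounded_clinear f \<Longrightarrow> bounded_clinear g \<Longrightarrow> bounded_clinear (\<lambda>x. f (g x))"
  by (simp add: bounded_clinear_def bounded_linear_compose)

lemma bounded_clinear_plus:
  "bounded_clinear f \<Longrightarrow> bounded_clinear g \<Longrightarrow> bounded_clinear (\<lambda>x. f x + g x)"
  by (simp add: bounded_clinear_def bounded_linear_add scaleC_add_right)

lemma bounded_clinear_subtract:
  "bounded_clinear f \<Longrightarrow> bounded_clinear g \<Longrightarrow> bounded_clinear (\<lambda>x. f x - g x)"
  by (simp add: bounded_clinear_def bounded_linear_sub scaleC_diff_right)

lemma bounded_clinear_mult:
  "bounded_clinear f \<Longrightarrow> bounded_clinear (\<lambda>x. c *\<^sub>C f x)"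
  by (simp add: bounded_clinear_def bounded_linear_compose[OF bounded_linear_scaleC]
      scaleC_scaleC mult.commute)

lemma bounded_clinear_multR:
  "bounded_clinear f \<Longrightarrow> bounded_clinear (\<lambda>x. r *\<^sub>R f x)"
  by (simp add: scaleR_scaleC bounded_clinear_mult)

lemma bounded_clinear_setsum:
  "(\<And>i. i \<in> I \<Longrightarrow> bounded_clinear (f i)) \<Longrightarrow> bounded_clinear (\<lambda>x. \<Sum>i\<in>I. f i x)"
  by (induction I rule: infinite_finite_induct)
    (auto intro: bounded_clinear_0 bounded_clinear_plus)

lemmas bounded_clinear_intros =
  bounded_clinear_id bounded_clinear_0 bounded_clinear_plus bounded_clinear_subtract
  bounded_clinear_mult bounded_clinear_multR bounded_clinear_setsum

lemma bounded_clinear_limit: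
  assumes T: "\<And>i. bounded_clinear (T i)" and F: "F \<noteq> bot"
    and lim: "\<And>x. ((\<lambda>i. T i x) \<longlongrightarrow> S x) F"
    and le: "\<And>x. \<forall>\<^sub>F i in F. norm (T i x) \<le> k * norm x"
  shows "bounded_clinear S"
proof (rule bounded_clinear_intro[where k = k])
  show "S (x + y) = S x + S y" for x y
    by (rule tendsto_unique[OF F lim]) (simp only: bounded_clinear_add[OF T], intro tendsto_add lim)
  show "S (c *\<^sub>C x) = c *\<^sub>C S x" for c x
    by (rule tendsto_unique[OF F lim]) (simp only: bounded_clinear_scaleC[OF T], intro tendsto_scaleC lim)
  show "norm (S x) \<le> k * norm x" for x
    by (rule tendsto_upperbound[OF tendsto_norm[OF lim] le F])
qed

lemma tendsto_if_norm_sq: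
  assumes "((\<lambda>i. (norm (f i - l))\<^sup>2) \<longlongrightarrow> 0) F"
  shows "(f \<longlongrightarrow> l) F"
proof -
  have "((\<lambda>i. sqrt ((norm (f i - l))\<^sup>2)) \<longlongrightarrow> sqrt 0) F" by (rule tendsto_real_sqrt[OF assms])
  then show ?thesis by (simp add: tendsto_norm_zero_iff LIM_zero_iff)
qed

lemma Cauchy_if_dist_le:
  fixes v :: "nat \<Rightarrow> 'a::metric_space" and w :: "nat \<Rightarrow> 'b::metric_space"
  assumes w: "Cauchy w" and le: "\<And>m n. m \<le> n \<Longrightarrow> dist (v m) (v n) \<le> k * dist (w m) (w n)"
  shows "Cauchy v"
  unfolding Cauchy_altdef
proof (intro allI impI)
  fix e :: real assume e: "e > 0"
  let ?k = "\<bar>k\<bar> + 1"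
  have "e / ?k > 0" using e by (simp add: add_nonneg_pos)
  then obtain M where M: "\<And>m n. m \<ge> M \<Longrightarrow> n \<ge> M \<Longrightarrow> dist (w m) (w n) < e / ?k"
    using w unfolding Cauchy_def by blast
  have "dist (v m) (v n) < e" if "m \<ge> M" "n > m" for m n
  proof -
    have "dist (v m) (v n) \<le> k * dist (w m) (w n)" using le that by simp
    also have "\<dots> \<le> ?k * dist (w m) (w n)" by (intro mult_right_mono) auto
    also have "\<dots> < e" using M[of m n] that by (simp add: pos_less_divide_eq add_nonneg_pos mult.commute)
    finally show ?thesis .
  qed
  then show "\<exists>M. \<forall>m\<ge>M. \<forall>n>m. dist (v m) (v n) < e" by blast
qed

text \<open>
  A complex sesquilinear form is controlled by its diagonal: by polarization \<open>4\<langle>Tx, y\<rangle>\<close> is the sum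
  of \<open>i\<^sup>k\<langle>T(x + i\<^sup>ky), x + i\<^sup>ky\<rangle>\<close> over \<open>k < 4\<close>. The operator may be unbounded, so only a domain
  \<open>V\<close> is considered.
\<close>

lemma polarization_bound:
  fixes T :: "'a::complex_inner \<Rightarrow> 'a"
  assumes V: "csubspace V"
    and add: "\<And>x y. x \<in> V \<Longrightarrow> y \<in> V \<Longrightarrow> T (x + y) = T x + T y"
    and scale: "\<And>c x. x \<in> V \<Longrightarrow> T (c *\<^sub>C x) = c *\<^sub>C T x"
    and le: "\<And>x. x \<in> V \<Longrightarrow> cmod (cinner (T x) x) \<le> k * (norm x)\<^sup>2"
    and x: "x \<in> V" and y: "y \<in> V"
  shows "cmod (cinner (T x) y) \<le> 2 * k * norm x * norm y"
proof -
  have mem: "c *\<^sub>C u \<in> V" "u + v \<in> V" if "u \<in> V" "v \<in> V" for c u v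
    using V that by (auto simp: csubspace_def)
  have unit: "cmod (cinner (T u) v) \<le> 2 * k"
    if u: "u \<in> V" "norm u = 1" and v: "v \<in> V" "norm v = 1" for u v
  proof -
    let ?q = "\<lambda>w. cinner (T w) w"
    have q: "?q (u + c *\<^sub>C v)
        = ?q u + c * cinner (T v) u + cnj c * cinner (T u) v + (c * cnj c) * ?q v" for c
      using u v mem by (simp add: add scale cinner_add_left cinner_add_right cinner_scaleC_left
          cinner_scaleC_right algebra_simps)
    have "4 * cinner (T u) v = ?q (u + 1 *\<^sub>C v) - ?q (u + (-1) *\<^sub>C v)
        + \<i> * ?q (u + \<i> *\<^sub>C v) - \<i> * ?q (u + (-\<i>) *\<^sub>C v)"
      unfolding q by (simp add: algebra_simps)
    then have "4 * cmod (cinner (T u) v) = cmod (?q (u + 1 *\<^sub>C v) - ?q (u + (-1) *\<^sub>C v)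
        + \<i> * ?q (u + \<i> *\<^sub>C v) - \<i> * ?q (u + (-\<i>) *\<^sub>C v))"
      by (metis norm_mult norm_numeral)
    also have "\<dots> \<le> cmod (?q (u + 1 *\<^sub>C v)) + cmod (?q (u + (-1) *\<^sub>C v))
        + cmod (?q (u + \<i> *\<^sub>C v)) + cmod (?q (u + (-\<i>) *\<^sub>C v))"
      by (intro order_trans[OF norm_triangle_ineq4] order_trans[OF norm_triangle_ineq] add_mono
          order_refl) (auto simp: norm_mult)
    also have "\<dots> \<le> k * (norm (u + 1 *\<^sub>C v))\<^sup>2 + k * (norm (u + (-1) *\<^sub>C v))\<^sup>2
        + k * (norm (u + \<i> *\<^sub>C v))\<^sup>2 + k * (norm (u + (-\<i>) *\<^sub>C v))\<^sup>2"
      using u v mem by (intro add_mono le) auto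
    also have "\<dots> = 8 * k"
      using u v by (simp add: norm_sq_add norm_scaleC cinner_scaleC_right algebra_simps)
    finally show ?thesis by simp
  qed
  have T0: "T 0 = 0" using scale[OF x, of 0] by simp
  show ?thesis
  proof (cases "x = 0 \<or> y = 0")
    case False
    let ?u = "complex_of_real (1 / norm x) *\<^sub>C x" and ?v = "complex_of_real (1 / norm y) *\<^sub>C y"
    have "cmod (cinner (T ?u) ?v) \<le> 2 * k"
      by (rule unit) (use x y mem False in \<open>auto simp: norm_scaleC norm_divide\<close>)
    then have "cmod (cinner (T x) y) / (norm x * norm y) \<le> 2 * k"
      using x y by (simp add: scale cinner_scaleC_left cinner_scaleC_right norm_mult norm_divide
          mult.commute)
    then show ?thesis using False by (simp add: field_simps)
  qed (auto simp: T0)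
qed

lemma bounded_clinear_eqI:
  fixes T :: "'a::complex_inner \<Rightarrow> 'a"
  assumes T: "bounded_clinear T" and T': "bounded_clinear T'"
    and eq: "\<And>x. cinner (T x) x = cinner (T' x) x"
  shows "T = T'"
proof
  fix x
  let ?A = "\<lambda>x. T x - T' x"
  have A: "bounded_clinear ?A" using T T' by (intro bounded_clinear_intros)
  have "cmod (cinner (?A x) (?A x)) \<le> 2 * 0 * norm x * norm (?A x)"
    by (rule polarization_bound[of UNIV])
      (auto simp: csubspace_def bounded_clinear_add[OF A] bounded_clinear_scaleC[OF A]
        cinner_diff_left eq)
  then have "?A x = 0" by (simp add: cinner_self norm_mult)
  then show "T x = T' x" by simp
qed

lemma csubspace_add: "csubspace V \<Longrightarrow> x \<in> V \<Longrightarrow> y \<in> V \<Longrightarrow> x + y \<in> V"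
  by (simp add: csubspace_def)

lemma csubspace_scaleC: "csubspace V \<Longrightarrow> x \<in> V \<Longrightarrow> c *\<^sub>C x \<in> V"
  by (simp add: csubspace_def)

lemma csubspace_zero: "csubspace V \<Longrightarrow> 0 \<in> V"
  by (simp add: csubspace_def)

lemma csubspace_diff: "csubspace V \<Longrightarrow> x \<in> V \<Longrightarrow> y \<in> V \<Longrightarrow> x - y \<in> V"
  using csubspace_add[of V x "- y"] csubspace_scaleC[of V y "-1"] by (simp add: scaleC_minus1)

text \<open>
  The Riesz representation theorem for a subspace \<open>V\<close> that need not be closed: the representing
  vector is the limit of a minimizing sequence of \<open>v \<mapsto> \<parallel>v\<parallel>\<^sup>2 - 2 Re \<phi> v\<close> on \<open>V\<close>, which is a Cauchy
  sequence by the parallelogram law. Applied to \<open>\<phi> = \<langle>-, x\<rangle>\<close> it yields orthogonal projections, and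
  applied to the range of an operator it yields solutions of linear equations.
\<close>

lemma Riesz_subspace:
  fixes \<phi> :: "'a::chilbert_space \<Rightarrow> complex"
  assumes V: "csubspace V"
    and add: "\<And>x y. x \<in> V \<Longrightarrow> y \<in> V \<Longrightarrow> \<phi> (x + y) = \<phi> x + \<phi> y"
    and scale: "\<And>c x. x \<in> V \<Longrightarrow> \<phi> (c *\<^sub>C x) = c * \<phi> x"
    and bound: "\<And>x. x \<in> V \<Longrightarrow> cmod (\<phi> x) \<le> k * norm x"
  shows "\<exists>z\<in>closure V. \<forall>x\<in>V. \<phi> x = cinner x z"
proof -
  define J where "J v = (norm v)\<^sup>2 - 2 * Re (\<phi> v)" for v
  have J_ge: "J v \<ge> - k\<^sup>2" if "v \<in> V" for v
  proof -
    have "Re (\<phi> v) \<le> k * norm v" using bound[OF that] abs_Re_le_cmod[of "\<phi> v"] by linarith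
    moreover have "0 \<le> (norm v - k)\<^sup>2" by simp
    ultimately show ?thesis unfolding J_def by (simp add: power2_diff mult.commute)
  qed
  define d where "d = Inf (J ` V)"
  have bdd: "bdd_below (J ` V)" using J_ge by (auto intro!: bdd_belowI[of _ "- k\<^sup>2"])
  have d_le: "d \<le> J v" if "v \<in> V" for v
    unfolding d_def by (rule cInf_lower) (use that bdd in auto)
  have "\<exists>v\<in>V. J v < d + 1 / real (Suc n)" for n
  proof -
    have "J ` V \<noteq> {}" using csubspace_zero[OF V] by auto
    then have "\<exists>y\<in>J ` V. y < d + 1 / real (Suc n)"
      by (rule cInf_lessD) (simp add: d_def)
    then show ?thesis by auto
  qed
  then obtain v where v: "\<And>n. v n \<in> V" "\<And>n. J (v n) < d + 1 / real (Suc n)"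
    by metis
  have par: "(norm (x - y))\<^sup>2 \<le> 2 * (J x - d) + 2 * (J y - d)" if "x \<in> V" "y \<in> V" for x y
  proof -
    let ?m = "complex_of_real (1/2) *\<^sub>C (x + y)"
    have m: "?m \<in> V" using V that by (intro csubspace_scaleC csubspace_add)
    have "J ?m = (norm (x + y))\<^sup>2 / 4 - Re (\<phi> x) - Re (\<phi> y)"
      unfolding J_def using that V csubspace_add[OF V that]
      by (simp add: scale add norm_scaleC norm_divide power_divide field_simps)
    then have "4 * d \<le> (norm (x + y))\<^sup>2 - 4 * Re (\<phi> x) - 4 * Re (\<phi> y)"
      using d_le[OF m] by simp
    then show ?thesis unfolding J_def norm_sq_add norm_sq_diff by simp
  qed
  have "Cauchy v"
  proof (rule CauchyI')
    fix e :: real assume e: "e > 0"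
    obtain N :: nat where N: "real N > 4 / e\<^sup>2" using reals_Archimedean2 by blast
    have "norm (v m - v n) < e" if mn: "m \<ge> N" "n > m" for m n
    proof -
      have small: "1 / real (Suc j) < e\<^sup>2 / 4" if "j \<ge> N" for j
      proof -
        have "4 / e\<^sup>2 < real (Suc j)" using N that by linarith
        then show ?thesis using e by (simp add: field_simps)
      qed
      have "(norm (v m - v n))\<^sup>2 \<le> 2 * (J (v m) - d) + 2 * (J (v n) - d)"
        using par v by blast
      also have "\<dots> < e\<^sup>2" using v(2)[of m] v(2)[of n] small[of m] small[of n] mn by simp
      finally show ?thesis using e by (simp add: power_less_imp_less_base)
    qed
    then show "\<exists>M. \<forall>m\<ge>M. \<forall>n>m. dist (v m) (v n) < e" by (auto simp: dist_norm)
  qed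
  then obtain z where z: "v \<longlonglongrightarrow> z"
    unfolding Cauchy_convergent_iff convergent_def by blast
  have "z \<in> closure V" using v z unfolding closure_sequential by blast
  moreover have "\<phi> x = cinner x z" if x: "x \<in> V" for x
  proof -
    define w where "w = cinner x z - \<phi> x"
    have var: "0 \<le> 2 * Re (c * w) + (cmod c)\<^sup>2 * (norm x)\<^sup>2" for c
    proof -
      have step: "- (1 / real (Suc n)) \<le>
          2 * Re (c * (cinner x (v n) - \<phi> x)) + (cmod c)\<^sup>2 * (norm x)\<^sup>2" for n
      proof -
        have "v n + c *\<^sub>C x \<in> V" using v x V by (intro csubspace_scaleC csubspace_add)
        then have "d \<le> J (v n + c *\<^sub>C x)" by (rule d_le)
        also have "\<dots> = J (v n) + 2 * Re (c * (cinner x (v n) - \<phi> x)) + (cmod c)\<^sup>2 * (norm x)\<^sup>2"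
          using v x V arg_cong[OF cinner_commute[of "v n" "c *\<^sub>C x"], of Re]
          by (simp add: J_def add scale csubspace_scaleC norm_sq_add norm_scaleC cinner_scaleC_left
              power_mult_distrib algebra_simps)
        finally show ?thesis using v(2)[of n] by simp
      qed
      have "(\<lambda>n. - (1 / real (Suc n))) \<longlonglongrightarrow> - 0"
        using LIMSEQ_inverse_real_of_nat by (intro tendsto_minus) (simp add: inverse_eq_divide)
      moreover have "(\<lambda>n. 2 * Re (c * (cinner x (v n) - \<phi> x)) + (cmod c)\<^sup>2 * (norm x)\<^sup>2)
          \<longlonglongrightarrow> 2 * Re (c * w) + (cmod c)\<^sup>2 * (norm x)\<^sup>2"
        unfolding w_def by (intro tendsto_intros z)
      ultimately show ?thesis using step LIMSEQ_le by fastforce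
    qed
    \<comment> \<open>In direction \<open>c = - s w\<^sup>*\<close> the linear term of \<open>var\<close> is negative, and for this \<open>s\<close> the quadratic
      term is too small to compensate it.\<close>
    define s where "s = 1 / ((norm x)\<^sup>2 + 1)"
    have s: "s > 0" "s * (norm x)\<^sup>2 < 1" unfolding s_def by (auto simp: field_simps add_pos_nonneg)
    have "0 \<le> 2 * Re ((- of_real s * cnj w) * w) + (cmod (- of_real s * cnj w))\<^sup>2 * (norm x)\<^sup>2"
      by (rule var)
    also have "(- of_real s * cnj w) * w = of_real (- s * (cmod w)\<^sup>2)"
      by (simp add: complex_norm_square mult.commute mult.left_commute del: of_real_power)
    also have "(cmod (- of_real s * cnj w))\<^sup>2 = s\<^sup>2 * (cmod w)\<^sup>2"
      by (simp add: norm_mult power_mult_distrib)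
    finally have "0 \<le> s * (cmod w)\<^sup>2 * (s * (norm x)\<^sup>2 - 2)"
      by (simp add: algebra_simps power2_eq_square)
    moreover have "s * (cmod w)\<^sup>2 * (s * (norm x)\<^sup>2 - 2) < 0" if "w \<noteq> 0"
      using s that by (intro mult_pos_neg mult_pos_pos) auto
    ultimately have "w = 0" by (cases "w = 0") simp_all
    then show ?thesis by (simp add: w_def)
  qed
  ultimately show ?thesis by blast
qed

section \<open>Orthogonal projections\<close>

lemma orthogonal_projection_clinear: "orthogonal_projection P \<Longrightarrow> bounded_clinear P"
  by (simp add: orthogonal_projection_def)

lemma orthogonal_projection_idem: "orthogonal_projection P \<Longrightarrow> P (P x) = P x"
  by (simp add: orthogonal_projection_def fun_eq_iff)

lemma orthogonal_projection_adj: "orthogonal_projection P \<Longrightarrow> cinner (P x) y = cinner x (P y)"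
  by (simp add: orthogonal_projection_def)

lemma orthogonal_projection_cinner:
  "orthogonal_projection P \<Longrightarrow> cinner (P x) x = of_real ((norm (P x))\<^sup>2)"
  by (metis cinner_self orthogonal_projection_adj orthogonal_projection_idem)

lemma orthogonal_projection_compl:
  assumes "orthogonal_projection P"
  shows "orthogonal_projection (\<lambda>x. x - P x)"
proof -
  note P = orthogonal_projection_clinear[OF assms]
  show ?thesis
    unfolding orthogonal_projection_def
    using P by (auto intro!: bounded_clinear_intros simp: fun_eq_iff bounded_clinear_diff
        orthogonal_projection_idem[OF assms] cinner_diff_left cinner_diff_right
        orthogonal_projection_adj[OF assms])
qed

lemma orthogonal_projection_pythagoras:
  assumes "orthogonal_projection P"
  shows "(norm x)\<^sup>2 = (norm (P x))\<^sup>2 + (norm (x - P x))\<^sup>2"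
  using orthogonal_projection_cinner[OF assms, of x] orthogonal_projection_adj[OF assms, of x x]
  by (simp add: norm_sq_diff)

lemma orthogonal_projection_norm_le: "orthogonal_projection P \<Longrightarrow> norm (P x) \<le> norm x"
  using orthogonal_projection_pythagoras[of P x]
  by (intro power2_le_imp_le[of "norm (P x)" "norm x"]) auto

text \<open>By \<open>\<parallel>Px\<parallel>\<^sup>2 = \<langle>Px, x\<rangle>\<close> this is the uniqueness of an operator with a given quadratic form.\<close>

lemma orthogonal_projection_eqI:
  assumes "orthogonal_projection P" "orthogonal_projection Q"
    and "\<And>x. norm (P x) = norm (Q x)"
  shows "P = Q"
  by (rule bounded_clinear_eqI[OF assms(1,2)[THEN orthogonal_projection_clinear]])
    (simp only: orthogonal_projection_cinner[OF assms(1)] orthogonal_projection_cinner[OF assms(2)]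
      assms(3))

lemma orthogonal_projection_comp:
  assumes P: "orthogonal_projection P" and Q: "orthogonal_projection Q"
    and comm: "\<And>x. P (Q x) = Q (P x)"
  shows "orthogonal_projection (\<lambda>x. P (Q x))"
  unfolding orthogonal_projection_def
proof (intro conjI allI)
  show "bounded_clinear (\<lambda>x. P (Q x))"
    by (rule bounded_clinear_comp[OF P[THEN orthogonal_projection_clinear]
          Q[THEN orthogonal_projection_clinear]])
  show "(\<lambda>x. P (Q x)) \<circ> (\<lambda>x. P (Q x)) = (\<lambda>x. P (Q x))"
    using P Q by (simp add: fun_eq_iff comm orthogonal_projection_idem)
  show "cinner (P (Q x)) y = cinner x (P (Q y))" for x y
    using P Q by (simp add: comm orthogonal_projection_adj)
qed

text \<open>
  The projection of \<open>x\<close> is the vector of \<open>V\<close> that represents the functional \<open>\<langle>-, x\<rangle>\<close> on \<open>V\<close>.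
\<close>

lemma orthogonal_projection_exists:
  fixes V :: "'a::chilbert_space set"
  assumes V: "csubspace V" and closed: "closed V"
  shows "\<exists>P. orthogonal_projection P \<and> (\<forall>x. P x = x \<longleftrightarrow> x \<in> V)"
proof -
  have "\<exists>z\<in>V. \<forall>y\<in>V. cinner y x = cinner y z" for x
    using Riesz_subspace[OF V, of "\<lambda>y. cinner y x" "norm x"] closed
    by (auto simp: cinner_add_left cinner_scaleC_left mult.commute norm_cinner_le
        intro!: order_trans[OF norm_cinner_le])
  then obtain P where PV: "\<And>x. P x \<in> V" and P: "\<And>x y. y \<in> V \<Longrightarrow> cinner y x = cinner y (P x)"
    by metis
  have uniq: "P x = z" if z: "z \<in> V" and eq: "\<And>y. y \<in> V \<Longrightarrow> cinner y x = cinner y z" for x z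
  proof -
    have "cinner (P x - z) (P x - z) = 0"
      using P[OF csubspace_diff[OF V PV z]] eq[OF csubspace_diff[OF V PV z]]
      by (metis cinner_diff_right eq_iff_diff_eq_0)
    then show ?thesis by (simp add: cinner_self)
  qed
  have adj: "cinner (P x) y = cinner x (P y)" for x y
    using P[OF PV, of y x] P[OF PV, of x y] by (metis cinner_commute)
  have fix_iff: "P x = x \<longleftrightarrow> x \<in> V" for x
    using PV[of x] uniq[of x x] by auto
  have le: "norm (P x) \<le> 1 * norm x" for x
  proof -
    have "complex_of_real ((norm (P x))\<^sup>2) = cinner (P x) x"
      using P[OF PV, of x x] by (simp add: cinner_self)
    then have "(norm (P x))\<^sup>2 = cmod (cinner (P x) x)"
      by (metis norm_of_real abs_power2)
    then have "norm (P x) * norm (P x) \<le> norm (P x) * norm x"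
      using norm_cinner_le[of "P x" x] by (simp add: power2_eq_square)
    then show ?thesis by (cases "P x = 0") auto
  qed
  have "bounded_clinear P"
  proof (rule bounded_clinear_intro[OF _ _ le])
    show "P (x + y) = P x + P y" for x y
      by (rule uniq) (auto intro!: csubspace_add V PV simp: cinner_add_right P[symmetric])
    show "P (c *\<^sub>C x) = c *\<^sub>C P x" for c x
      by (rule uniq) (auto intro!: csubspace_scaleC V PV simp: cinner_scaleC_right P[symmetric])
  qed
  then have "orthogonal_projection P"
    unfolding orthogonal_projection_def using adj fix_iff PV by (auto simp: fun_eq_iff)
  with fix_iff show ?thesis by blast
qed


section \<open>The negative spectral subspace of a bounded self-adjoint operator\<close>

definition bounded_selfadjoint :: "('a::complex_inner \<Rightarrow> 'a) \<Rightarrow> bool" where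
  "bounded_selfadjoint T \<longleftrightarrow> bounded_clinear T \<and> (\<forall>x y. cinner (T x) y = cinner x (T y))"

lemma bounded_selfadjoint_clinear: "bounded_selfadjoint T \<Longrightarrow> bounded_clinear T"
  by (simp add: bounded_selfadjoint_def)

lemma bounded_selfadjoint_adj: "bounded_selfadjoint T \<Longrightarrow> cinner (T x) y = cinner x (T y)"
  by (simp add: bounded_selfadjoint_def)

lemma orthogonal_projection_selfadjoint: "orthogonal_projection P \<Longrightarrow> bounded_selfadjoint P"
  by (simp add: bounded_selfadjoint_def orthogonal_projection_def)

lemma bounded_selfadjoint_subtract:
  "bounded_selfadjoint S \<Longrightarrow> bounded_selfadjoint T \<Longrightarrow> bounded_selfadjoint (\<lambda>x. S x - T x)"
  by (simp add: bounded_selfadjoint_def bounded_clinear_subtract cinner_diff_left cinner_diff_right)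

lemma bounded_selfadjoint_multR:
  "bounded_selfadjoint S \<Longrightarrow> bounded_selfadjoint (\<lambda>x. r *\<^sub>R S x)"
  by (simp add: bounded_selfadjoint_def bounded_clinear_multR cinner_scaleR_left cinner_scaleR_right)

text \<open>
  The absolute value of a self-adjoint contraction \<open>T\<close>. It is \<open>1 - Y\<close>, where \<open>Y\<close> solves
  \<open>Y = (1 - T\<^sup>2 + Y\<^sup>2) / 2\<close> and is the norm limit of the iteration \<open>Y\<^sub>n\<^sub>+\<^sub>1 = (1 - T\<^sup>2 + Y\<^sub>n\<^sup>2) / 2\<close>. The
  iteration converges because it is dominated by the scalar iteration \<open>s\<^sub>n\<^sub>+\<^sub>1 = (1 + s\<^sub>n\<^sup>2) / 2\<close>, which
  increases and stays below 1.
\<close>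

fun abs_iter :: "('a::complex_inner \<Rightarrow> 'a) \<Rightarrow> nat \<Rightarrow> 'a \<Rightarrow> 'a" where
  "abs_iter T 0 x = 0"
| "abs_iter T (Suc n) x = (1/2) *\<^sub>R (x - T (T x) + abs_iter T n (abs_iter T n x))"

fun abs_iter_bound :: "nat \<Rightarrow> real" where
  "abs_iter_bound 0 = 0"
| "abs_iter_bound (Suc n) = (1 + (abs_iter_bound n)\<^sup>2) / 2"

lemma abs_iter_bound_01: "0 \<le> abs_iter_bound n \<and> abs_iter_bound n \<le> 1"
  by (induction n) (auto simp: power_le_one)

lemma abs_iter_bound_mono: "abs_iter_bound n \<le> abs_iter_bound (Suc n)"
proof -
  have "0 \<le> (abs_iter_bound n - 1)\<^sup>2" by simp
  then show ?thesis by (simp add: power2_diff)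
qed

lemma abs_iter_selfadjoint:
  assumes "bounded_selfadjoint T"
  shows "bounded_selfadjoint (abs_iter T n)"
proof (induction n)
  case 0
  have "abs_iter T 0 = (\<lambda>x. 0)" by (rule ext) simp
  then show ?case by (simp add: bounded_selfadjoint_def bounded_clinear_0)
next
  case (Suc n)
  note T = assms[unfolded bounded_selfadjoint_def] and Y = Suc[unfolded bounded_selfadjoint_def]
  have eq: "abs_iter T (Suc n) = (\<lambda>x. (1/2) *\<^sub>R (x - T (T x) + abs_iter T n (abs_iter T n x)))"
    by (rule ext) simp
  have "bounded_clinear (\<lambda>x. (1/2) *\<^sub>R (x - T (T x) + abs_iter T n (abs_iter T n x)))"
    using T Y by (intro bounded_clinear_multR bounded_clinear_plus bounded_clinear_subtract
        bounded_clinear_id bounded_clinear_comp[of T T]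
        bounded_clinear_comp[of "abs_iter T n" "abs_iter T n"]) auto
  then show ?case
    unfolding eq using T Y
    by (simp add: bounded_selfadjoint_def cinner_scaleR_left cinner_scaleR_right
        cinner_add_left cinner_add_right cinner_diff_left cinner_diff_right)
qed

lemma abs_iter_commute:
  assumes "bounded_clinear C" and "\<And>x. C (T x) = T (C x)"
  shows "C (abs_iter T n x) = abs_iter T n (C x)"
  using assms
  by (induction n arbitrary: x)
    (auto simp: bounded_clinear_zero bounded_clinear_scaleR bounded_clinear_add bounded_clinear_diff)

lemma abs_iter_norm:
  assumes T: "bounded_selfadjoint T" and le: "\<And>x. norm (T x) \<le> norm x"
  shows "norm (abs_iter T n x) \<le> abs_iter_bound n * norm x"
proof (induction n arbitrary: x)
  case (Suc n)
  have "(norm (x - T (T x)))\<^sup>2 = (norm x)\<^sup>2 + (norm (T (T x)))\<^sup>2 - 2 * (norm (T x))\<^sup>2"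
    using bounded_selfadjoint_adj[OF T, of x "T x"] norm_sq_cinner[of "T x"] by (simp add: norm_sq_diff)
  also have "\<dots> \<le> (norm x)\<^sup>2"
    using power_mono[OF le[of "T x"] norm_ge_zero, of 2] zero_le_power2[of "norm (T x)"] by linarith
  finally have Z: "norm (x - T (T x)) \<le> norm x" by (rule power2_le_imp_le) simp
  have "norm (abs_iter T n (abs_iter T n x)) \<le> abs_iter_bound n * (abs_iter_bound n * norm x)"
    by (rule order_trans[OF Suc]) (intro mult_left_mono Suc, use abs_iter_bound_01 in auto)
  then have "norm (x - T (T x) + abs_iter T n (abs_iter T n x))
      \<le> norm x + abs_iter_bound n * (abs_iter_bound n * norm x)"
    using Z norm_triangle_ineq[of "x - T (T x)"] by (meson add_mono order_trans)
  moreover have "norm (abs_iter T (Suc n) x)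
      = norm (x - T (T x) + abs_iter T n (abs_iter T n x)) / 2"
    unfolding abs_iter.simps norm_scaleR by simp
  ultimately show ?case by (simp add: field_simps power2_eq_square del: abs_iter.simps)
qed simp

lemma abs_iter_step:
  assumes T: "bounded_selfadjoint T" and le: "\<And>x. norm (T x) \<le> norm x"
  shows "norm (abs_iter T (Suc n) x - abs_iter T n x)
    \<le> (abs_iter_bound (Suc n) - abs_iter_bound n) * norm x"
proof (induction n arbitrary: x)
  case 0
  then show ?case using abs_iter_norm[OF assms, of 1 x] by simp
next
  case (Suc n)
  let ?Y = "abs_iter T" and ?s = abs_iter_bound
  note Y = abs_iter_selfadjoint[OF T, THEN bounded_selfadjoint_clinear]
  have TY: "T (?Y n x) = ?Y n (T x)" for n x
    by (rule abs_iter_commute) (use T in \<open>auto simp: bounded_selfadjoint_def\<close>)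
  have comm: "?Y (Suc n) (?Y n x) = ?Y n (?Y (Suc n) x)" for x
    by (rule abs_iter_commute[OF Y]) (simp only: TY)
  define d where "d = ?Y (Suc n) x - ?Y n x"
  have "?Y (Suc (Suc n)) x - ?Y (Suc n) x
      = (1/2) *\<^sub>R (?Y (Suc n) (?Y (Suc n) x) - ?Y n (?Y n x))"
    unfolding abs_iter.simps(2)[of T "Suc n"] abs_iter.simps(2)[of T n x]
    by (simp add: algebra_simps del: abs_iter.simps flip: abs_iter.simps(2))
  also have "\<dots> = (1/2) *\<^sub>R (?Y (Suc n) d + ?Y n d)"
    unfolding d_def using comm[of x] by (simp add: bounded_clinear_diff[OF Y] del: abs_iter.simps)
  finally have eq: "?Y (Suc (Suc n)) x - ?Y (Suc n) x = (1/2) *\<^sub>R (?Y (Suc n) d + ?Y n d)" .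
  have "norm (?Y (Suc n) d + ?Y n d) \<le> ?s (Suc n) * norm d + ?s n * norm d"
    by (intro norm_triangle_le add_mono abs_iter_norm[OF assms])
  also have "\<dots> = (?s (Suc n) + ?s n) * norm d" by (simp add: algebra_simps)
  also have "\<dots> \<le> (?s (Suc n) + ?s n) * ((?s (Suc n) - ?s n) * norm x)"
    unfolding d_def using abs_iter_bound_01[of n] abs_iter_bound_01[of "Suc n"]
    by (intro mult_left_mono Suc) linarith
  finally have "norm (?Y (Suc n) d + ?Y n d) \<le> ((?s (Suc n))\<^sup>2 - (?s n)\<^sup>2) * norm x"
    by (simp add: power2_eq_square algebra_simps del: abs_iter_bound.simps)
  moreover have "((?s (Suc n))\<^sup>2 - (?s n)\<^sup>2) / 2 = ?s (Suc (Suc n)) - ?s (Suc n)"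
    unfolding abs_iter_bound.simps(2)[of "Suc n"] abs_iter_bound.simps(2)[of n]
    by (simp add: field_simps)
  ultimately have "norm (?Y (Suc n) d + ?Y n d) / 2 \<le> (?s (Suc (Suc n)) - ?s (Suc n)) * norm x"
    by (metis divide_right_mono times_divide_eq_left zero_le_numeral)
  then show ?case unfolding eq norm_scaleR by simp
qed

lemma absolute_value_exists:
  fixes T :: "'a::chilbert_space \<Rightarrow> 'a"
  assumes T: "bounded_selfadjoint T" and le: "\<And>x. norm (T x) \<le> norm x"
  shows "\<exists>A. bounded_selfadjoint A \<and> (\<forall>x. A (A x) = T (T x)) \<and> (\<forall>x. norm (x - A x) \<le> norm x)
    \<and> (\<forall>C. bounded_clinear C \<longrightarrow> (\<forall>x. C (T x) = T (C x)) \<longrightarrow> (\<forall>x. C (A x) = A (C x)))"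
proof -
  let ?Y = "abs_iter T" and ?s = abs_iter_bound
  note Yn = abs_iter_selfadjoint[OF T, THEN bounded_selfadjoint_clinear]
  have inc: "incseq ?s" by (rule incseq_SucI) (rule abs_iter_bound_mono)
  then obtain L where "?s \<longlonglongrightarrow> L"
    by (rule incseq_convergent[of _ 1]) (use abs_iter_bound_01 in auto)
  then have "Cauchy ?s" by (rule LIMSEQ_imp_Cauchy)
  have diff: "norm (?Y (n + k) x - ?Y n x) \<le> (?s (n + k) - ?s n) * norm x" for n k x
  proof (induction k)
    case (Suc k)
    have "norm (?Y (n + Suc k) x - ?Y n x)
        \<le> norm (?Y (Suc (n + k)) x - ?Y (n + k) x) + norm (?Y (n + k) x - ?Y n x)"
      using norm_triangle_ineq[of "?Y (Suc (n + k)) x - ?Y (n + k) x" "?Y (n + k) x - ?Y n x"]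
      by (simp del: abs_iter.simps)
    also have "\<dots> \<le> (?s (Suc (n + k)) - ?s (n + k)) * norm x + (?s (n + k) - ?s n) * norm x"
      by (intro add_mono abs_iter_step T le Suc)
    finally show ?case by (simp add: algebra_simps del: abs_iter.simps abs_iter_bound.simps)
  qed simp
  have conv: "convergent (\<lambda>n. ?Y n x)" for x
  proof -
    have "Cauchy (\<lambda>n. ?Y n x)"
    proof (rule Cauchy_if_dist_le[OF \<open>Cauchy ?s\<close>])
      show "dist (?Y m x) (?Y n x) \<le> norm x * dist (?s m) (?s n)" if "m \<le> n" for m n
        using diff[of m "n - m" x] incseqD[OF inc that] that
        by (simp add: dist_norm norm_minus_commute mult.commute)
    qed
    then show ?thesis by (rule Cauchy_convergent)
  qed
  define Y where "Y x = lim (\<lambda>n. ?Y n x)" for x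
  have lim: "(\<lambda>n. ?Y n x) \<longlonglongrightarrow> Y x" for x
    using conv[of x] by (simp add: Y_def convergent_LIMSEQ_iff)
  have contr: "norm (?Y n x) \<le> norm x" for n x
    using abs_iter_norm[OF T le, of n x] abs_iter_bound_01[of n] mult_right_mono[of "?s n" 1 "norm x"]
    by simp
  have Y_le: "norm (Y x) \<le> norm x" for x
    by (rule LIMSEQ_le_const2[OF tendsto_norm[OF lim]]) (use contr in auto)
  have Yc: "bounded_clinear Y"
    by (rule bounded_clinear_limit[OF Yn sequentially_bot lim, of 1]) (simp add: contr)
  have Y_adj: "cinner (Y x) y = cinner x (Y y)" for x y
  proof (rule LIMSEQ_unique)
    show "(\<lambda>n. cinner (?Y n x) y) \<longlonglongrightarrow> cinner (Y x) y" by (intro tendsto_intros lim)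
    show "(\<lambda>n. cinner (?Y n x) y) \<longlonglongrightarrow> cinner x (Y y)"
      by (simp only: bounded_selfadjoint_adj[OF abs_iter_selfadjoint[OF T]])
        (intro tendsto_intros lim)
  qed
  have Y_sq: "(\<lambda>n. ?Y n (?Y n x)) \<longlonglongrightarrow> Y (Y x)" for x
  proof -
    have "(\<lambda>n. ?Y n (?Y n x - Y x)) \<longlonglongrightarrow> 0"
    proof (rule Lim_null_comparison)
      show "\<forall>\<^sub>F n in sequentially. norm (?Y n (?Y n x - Y x)) \<le> norm (?Y n x - Y x)"
        using contr by simp
      show "(\<lambda>n. norm (?Y n x - Y x)) \<longlonglongrightarrow> 0"
        using lim[of x] by (simp add: LIM_zero_iff tendsto_norm_zero)
    qed
    from tendsto_add[OF this lim[of "Y x"]] show ?thesis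
      by (simp add: bounded_clinear_diff[OF Yn])
  qed
  have Y_eq: "Y x = (1/2) *\<^sub>R (x - T (T x) + Y (Y x))" for x
  proof (rule LIMSEQ_unique)
    show "(\<lambda>n. ?Y (Suc n) x) \<longlonglongrightarrow> Y x" using lim[of x] by (rule LIMSEQ_Suc)
    show "(\<lambda>n. ?Y (Suc n) x) \<longlonglongrightarrow> (1/2) *\<^sub>R (x - T (T x) + Y (Y x))"
      unfolding abs_iter.simps by (intro tendsto_intros Y_sq)
  qed
  let ?A = "\<lambda>x. x - Y x"
  have "bounded_selfadjoint ?A"
    using Yc Y_adj by (auto simp: bounded_selfadjoint_def cinner_diff_left cinner_diff_right
        intro!: bounded_clinear_intros)
  moreover have "?A (?A x) = T (T x)" for x
  proof -
    have "2 *\<^sub>R Y x = x - T (T x) + Y (Y x)"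
      by (subst Y_eq) simp
    then have "Y x + Y x = x - T (T x) + Y (Y x)" by (simp add: scaleR_2)
    then show ?thesis by (simp add: bounded_clinear_diff[OF Yc] algebra_simps)
  qed
  moreover have "norm (x - ?A x) \<le> norm x" for x using Y_le by simp
  moreover have "C (?A x) = ?A (C x)" if C: "bounded_clinear C" "\<And>x. C (T x) = T (C x)" for C x
  proof -
    have "C (Y x) = Y (C x)"
      by (rule LIMSEQ_unique[OF _ lim])
        (use bounded_clinear_tendsto[OF C(1) lim[of x]] in \<open>simp only: abs_iter_commute[of C T, OF C]\<close>)
    then show ?thesis by (simp add: bounded_clinear_diff[OF C(1)])
  qed
  ultimately show ?thesis by (intro exI[of _ ?A]) blast
qed

text \<open>
  The properties of the spectral projection of \<open>T\<close> for \<open>]-\<infinity>, 0]\<close>. The last one puts the kernel of \<open>T\<close> into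
  the range of \<open>P\<close>, so the interval is closed at 0; the right continuity of spectral families rests on it.
\<close>

definition negative_projection :: "('a::complex_inner \<Rightarrow> 'a) \<Rightarrow> ('a \<Rightarrow> 'a) \<Rightarrow> bool" where
  "negative_projection T P \<longleftrightarrow> orthogonal_projection P
    \<and> (\<forall>C. bounded_selfadjoint C \<longrightarrow> (\<forall>x. C (T x) = T (C x)) \<longrightarrow> (\<forall>x. C (P x) = P (C x)))
    \<and> (\<forall>x. P x = x \<longrightarrow> Re (cinner (T x) x) \<le> 0)
    \<and> (\<forall>x. P x = 0 \<longrightarrow> Re (cinner (T x) x) \<ge> 0)
    \<and> (\<forall>x. P x = 0 \<longrightarrow> Re (cinner (T x) x) = 0 \<longrightarrow> x = 0)"

lemma negative_projectionD:
  assumes "negative_projection T P"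
  shows "orthogonal_projection P"
    and "bounded_selfadjoint C \<Longrightarrow> (\<And>x. C (T x) = T (C x)) \<Longrightarrow> C (P x) = P (C x)"
    and "P x = x \<Longrightarrow> Re (cinner (T x) x) \<le> 0"
    and "P x = 0 \<Longrightarrow> Re (cinner (T x) x) \<ge> 0"
    and "P x = 0 \<Longrightarrow> Re (cinner (T x) x) = 0 \<Longrightarrow> x = 0"
  using assms unfolding negative_projection_def by simp_all

text \<open>
  The projection is the one onto the kernel of \<open>|T| + T\<close>, which is twice the positive part of \<open>T\<close>: on
  this kernel \<open>T = -|T|\<close>, and on its orthogonal complement \<open>T = |T|\<close> since \<open>(|T| + T)(|T| - T) = 0\<close>.
\<close>

lemma negative_spectral_projection_contraction:
  fixes T :: "'a::chilbert_space \<Rightarrow> 'a"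
  assumes T: "bounded_selfadjoint T" and le: "\<And>x. norm (T x) \<le> norm x"
  shows "\<exists>P. negative_projection T P"
proof -
  note Tc = bounded_selfadjoint_clinear[OF T]
  obtain A where A: "bounded_selfadjoint A" and A_sq: "\<And>x. A (A x) = T (T x)"
    and A_contr: "\<And>x. norm (x - A x) \<le> norm x"
    and A_comm: "\<And>C x. bounded_clinear C \<Longrightarrow> (\<And>x. C (T x) = T (C x)) \<Longrightarrow> C (A x) = A (C x)"
    using absolute_value_exists[OF T le] by metis
  note Ac = bounded_selfadjoint_clinear[OF A]
  have TA: "T (A x) = A (T x)" for x by (rule A_comm[OF Tc]) simp
  have A_form: "2 * Re (cinner (A x) x) \<ge> (norm (A x))\<^sup>2" for x
  proof -
    have "(norm (x - A x))\<^sup>2 \<le> (norm x)\<^sup>2" by (rule power_mono[OF A_contr norm_ge_zero])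
    then show ?thesis unfolding norm_sq_diff
      using arg_cong[OF cinner_commute[of x "A x"], of Re] by simp
  qed
  then have A_nonneg: "Re (cinner (A x) x) \<ge> 0" for x
    by (smt (verit) zero_le_power2)
  define V where "V = {x. A x + T x = 0}"
  have B: "bounded_clinear (\<lambda>x. A x + T x)" using Ac Tc by (rule bounded_clinear_plus)
  have "csubspace V"
    unfolding V_def csubspace_def
    using bounded_clinear_add[OF B] bounded_clinear_scaleC[OF B] bounded_clinear_zero[OF B]
    by (simp add: scaleC_add_right[symmetric] del: scaleC_add_right)
  moreover have "closed V"
    unfolding V_def
    by (intro closed_Collect_eq linear_continuous_on bounded_clinear_linear[OF B]) auto
  ultimately obtain P where P: "orthogonal_projection P" and PV: "\<And>x. P x = x \<longleftrightarrow> x \<in> V"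
    using orthogonal_projection_exists by blast
  have P_mem: "P x \<in> V" for x using PV orthogonal_projection_idem[OF P] by blast
  have comm: "C (P x) = P (C x)" if C: "bounded_selfadjoint C" "\<And>x. C (T x) = T (C x)" for C x
  proof -
    note Cc = bounded_selfadjoint_clinear[OF C(1)]
    have "C x \<in> V" if "x \<in> V" for x
      using that A_comm[OF Cc C(2), of x] C(2)[of x] bounded_clinear_add[OF Cc, of "A x" "T x"]
      by (simp add: V_def bounded_clinear_zero[OF Cc])
    then have PCP: "P (C (P x)) = C (P x)" for x using P_mem PV by blast
    show ?thesis
    proof (rule eq_if_cinner_eq)
      fix y
      have "cinner (P (C x)) y = cinner x (C (P y))"
        by (simp add: bounded_selfadjoint_adj[OF C(1)] orthogonal_projection_adj[OF P])
      also have "\<dots> = cinner x (P (C (P y)))" by (simp only: PCP)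
      also have "\<dots> = cinner (P (C (P x))) y"
        by (simp add: bounded_selfadjoint_adj[OF C(1)] orthogonal_projection_adj[OF P])
      finally show "cinner (C (P x)) y = cinner (P (C x)) y" by (simp only: PCP)
    qed
  qed
  have neg: "Re (cinner (T x) x) \<le> 0" if "P x = x" for x
  proof -
    have "T x = - A x" using that PV[of x] unfolding V_def by (simp add: add_eq_0_iff)
    then show ?thesis using A_nonneg[of x] by (simp add: cinner_minus_left)
  qed
  have pos: "T x = A x" if "P x = 0" for x
  proof -
    let ?w = "A x - T x"
    have "?w \<in> V"
      unfolding V_def
      by (simp add: bounded_clinear_diff[OF Ac] bounded_clinear_diff[OF Tc] A_sq TA)
    then have "?w = P ?w" using PV by metis
    also have "\<dots> = A (P x) - T (P x)"
      by (rule comm[of "\<lambda>x. A x - T x", symmetric])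
        (auto intro: bounded_selfadjoint_subtract A T simp: TA bounded_clinear_diff[OF Tc])
    also have "\<dots> = 0" by (simp add: that bounded_clinear_zero[OF Ac] bounded_clinear_zero[OF Tc])
    finally show ?thesis by simp
  qed
  have strict: "x = 0" if "P x = 0" "Re (cinner (T x) x) = 0" for x
  proof -
    have "A x = 0" using A_form[of x] that pos[of x] by simp
    then have "x \<in> V" using pos[of x] that by (simp add: V_def)
    then show ?thesis using PV[of x] that by simp
  qed
  show ?thesis
    unfolding negative_projection_def
  proof (intro exI[of _ P] conjI allI impI P)
    show "C (P x) = P (C x)" if "bounded_selfadjoint C" "\<forall>x. C (T x) = T (C x)" for C x
      using comm that by blast
    show "Re (cinner (T x) x) \<ge> 0" if "P x = 0" for x
      using A_nonneg[of x] pos[OF that] by simp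
  qed (use neg strict in blast)+
qed

lemma negative_spectral_projection:
  fixes T :: "'a::chilbert_space \<Rightarrow> 'a"
  assumes T: "bounded_selfadjoint T"
  shows "\<exists>P. negative_projection T P"
proof -
  obtain k where "\<forall>x. norm (T x) \<le> norm x * k" and k: "k > 0"
    using bounded_linear.pos_bounded[OF bounded_clinear_linear[OF bounded_selfadjoint_clinear[OF T]]]
    by auto
  then have kT: "norm (T x) \<le> norm x * k" for x by simp
  let ?T = "\<lambda>x. (1/k) *\<^sub>R T x"
  have le: "norm (?T x) \<le> norm x" for x using k kT[of x] by (simp add: field_simps)
  have form: "Re (cinner (?T x) x) = Re (cinner (T x) x) / k" for x
    by (simp add: cinner_scaleR_left)
  obtain P where P': "negative_projection ?T P"
    using negative_spectral_projection_contraction[OF bounded_selfadjoint_multR[OF T] le] by blast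
  note P = negative_projectionD[OF P']
  have "negative_projection T P"
    unfolding negative_projection_def
  proof (intro conjI allI impI P(1))
    show "C (P x) = P (C x)" if "bounded_selfadjoint C" "\<forall>x. C (T x) = T (C x)" for C x
      by (rule P(2)[OF that(1)])
        (simp add: that(2) bounded_clinear_scaleR[OF bounded_selfadjoint_clinear[OF that(1)]])
    show "Re (cinner (T x) x) \<le> 0" if "P x = x" for x
      using P(3)[OF that] k unfolding form by (simp add: divide_le_0_iff)
    show "Re (cinner (T x) x) \<ge> 0" if "P x = 0" for x
      using P(4)[OF that] k unfolding form by (simp add: zero_le_divide_iff)
    show "x = 0" if "P x = 0" "Re (cinner (T x) x) = 0" for x
      using P(5)[OF that(1)] that(2) unfolding form by simp
  qed
  then show ?thesis by blast
qed

section \<open>Self-adjoint operators and their resolvents\<close>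

\<comment> \<open>Membership in a domain is to be used through closure properties, not unfolded.\<close>
declare domIff [iff del]

locale self_adjoint_operator =
  fixes D :: "'h::chilbert_space \<rightharpoonup> 'h"
  assumes self_adjoint: "self_adjoint D"
begin

abbreviation app :: "'h \<Rightarrow> 'h" where "app x \<equiv> the (D x)"

lemma csubspace_dom: "csubspace (dom D)"
  and dense_dom: "closure (dom D) = UNIV"
  using self_adjoint by (auto simp: self_adjoint_def linear_operator_def)

lemma app_add: "x \<in> dom D \<Longrightarrow> y \<in> dom D \<Longrightarrow> app (x + y) = app x + app y"
  using self_adjoint by (simp add: self_adjoint_def linear_operator_def)

lemma app_scaleC: "x \<in> dom D \<Longrightarrow> app (c *\<^sub>C x) = c *\<^sub>C app x"
  using self_adjoint by (simp add: self_adjoint_def linear_operator_def)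

lemma dom_add: "x \<in> dom D \<Longrightarrow> y \<in> dom D \<Longrightarrow> x + y \<in> dom D"
  and dom_scaleC: "x \<in> dom D \<Longrightarrow> c *\<^sub>C x \<in> dom D"
  and dom_diff: "x \<in> dom D \<Longrightarrow> y \<in> dom D \<Longrightarrow> x - y \<in> dom D"
  and dom_zero: "0 \<in> dom D"
  using csubspace_dom by (auto intro: csubspace_add csubspace_scaleC csubspace_diff csubspace_zero)

lemma app_diff:
  assumes "x \<in> dom D" "y \<in> dom D"
  shows "app (x - y) = app x - app y"
proof -
  have "app (x + (-1) *\<^sub>C y) = app x + (-1) *\<^sub>C app y"
    using assms by (simp only: app_add app_scaleC dom_scaleC)
  then show ?thesis by (simp add: scaleC_minus1)
qed

lemma app_zero: "app 0 = 0"
  using app_scaleC[OF dom_zero, of 0] by simp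

lemma dom_adjoint:
  assumes "\<And>x. x \<in> dom D \<Longrightarrow> cinner (app x) y = cinner x z"
  shows "y \<in> dom D" and "app y = z"
proof -
  have "(THE z. \<forall>x\<in>dom D. cinner (app x) y = cinner x z) = z"
  proof (rule the_equality)
    show "\<forall>x\<in>dom D. cinner (app x) y = cinner x z" using assms by blast
    fix z' assume "\<forall>x\<in>dom D. cinner (app x) y = cinner x z'"
    then have "cinner z' x = cinner z x" if "x \<in> dom D" for x
      using that assms by (metis cinner_commute)
    then show "z' = z" by (rule eq_if_dense[OF dense_dom])
  qed
  moreover have "\<exists>z. \<forall>x\<in>dom D. cinner (app x) y = cinner x z" using assms by blast
  ultimately have "adjoint_operator D y = Some z" by (simp add: adjoint_operator_def)
  then have "D y = Some z" using self_adjoint by (simp add: self_adjoint_def)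
  then show "y \<in> dom D" and "app y = z" by (auto intro: domI)
qed

lemma app_adj:
  assumes x: "x \<in> dom D" and y: "y \<in> dom D"
  shows "cinner (app x) y = cinner x (app y)"
proof -
  have "adjoint_operator D y \<noteq> None" using y self_adjoint by (simp add: self_adjoint_def domIff)
  then obtain z where z: "\<And>x. x \<in> dom D \<Longrightarrow> cinner (app x) y = cinner x z"
    by (auto simp: adjoint_operator_def split: if_splits)
  then show ?thesis using dom_adjoint(2)[OF z] x by simp
qed

lemma closed_graph:
  assumes s: "\<And>n. s n \<in> dom D" and lim: "s \<longlonglongrightarrow> y" "(\<lambda>n. app (s n)) \<longlonglongrightarrow> z"
  shows "y \<in> dom D" and "app y = z"
proof -
  have *: "cinner (app x) y = cinner x z" if "x \<in> dom D" for x
  proof (rule LIMSEQ_unique)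
    show "(\<lambda>n. cinner (app x) (s n)) \<longlonglongrightarrow> cinner (app x) y" by (intro tendsto_intros lim)
    show "(\<lambda>n. cinner (app x) (s n)) \<longlonglongrightarrow> cinner x z"
      by (simp only: app_adj[OF that s]) (intro tendsto_intros lim)
  qed
  show "y \<in> dom D" "app y = z" using dom_adjoint[OF *] by blast+
qed

lemma Im_app: "x \<in> dom D \<Longrightarrow> Im (cinner (app x) x) = 0"
  using app_adj[of x x] arg_cong[OF cinner_commute[of "app x" x], of Im] by simp

text \<open>
  Surjectivity of \<open>D \<plusminus> i\<close>: since \<open>\<parallel>(D + c)u\<parallel> \<ge> \<parallel>u\<parallel>\<close> for \<open>c = \<plusminus>i\<close>, the map \<open>(D + c)u \<mapsto> \<langle>u, x\<rangle>\<close> is a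
  bounded functional on the range of \<open>D + c\<close>; a vector representing it solves the adjoint equation.
\<close>

lemma shifted_surj:
  assumes c: "c = \<i> \<or> c = - \<i>"
  shows "\<exists>z\<in>dom D. app z - c *\<^sub>C z = x"
proof -
  let ?f = "\<lambda>u. app u + c *\<^sub>C u"
  define V where "V = ?f ` dom D"
  have f_add: "?f (u + v) = ?f u + ?f v" if "u \<in> dom D" "v \<in> dom D" for u v
    using that by (simp add: app_add scaleC_add_right)
  have f_scale: "?f (d *\<^sub>C u) = d *\<^sub>C ?f u" if "u \<in> dom D" for d u
    using that by (simp add: app_scaleC scaleC_add_right scaleC_scaleC mult.commute)
  have le: "norm u \<le> norm (?f u)" if u: "u \<in> dom D" for u
  proof -
    have "Re (cinner (app u) (c *\<^sub>C u)) = 0"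
      using c Im_app[OF u] by (auto simp: cinner_scaleC_right)
    then have "(norm (?f u))\<^sup>2 = (norm (app u))\<^sup>2 + (norm u)\<^sup>2"
      using c by (auto simp: norm_sq_add norm_scaleC)
    then show ?thesis by (intro power2_le_imp_le[of "norm u"]) auto
  qed
  have inj: "u = v" if "u \<in> dom D" "v \<in> dom D" "?f u = ?f v" for u v
  proof -
    have "?f (u - v) = 0"
      using that f_add[of "u - v" v] dom_diff[of u v] by simp
    then show ?thesis using le[OF dom_diff[OF that(1,2)]] by simp
  qed
  define g where "g y = (THE u. u \<in> dom D \<and> ?f u = y)" for y
  have g: "g (?f u) = u" if "u \<in> dom D" for u
    unfolding g_def using that inj by (intro the_equality) auto
  have V_sub: "csubspace V"
    unfolding csubspace_def
  proof (intro conjI ballI allI)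
    show "0 \<in> V"
      unfolding V_def by (rule image_eqI[of _ _ 0]) (simp_all add: app_zero dom_zero)
    show "y + y' \<in> V" if y: "y \<in> V" "y' \<in> V" for y y'
    proof -
      obtain u u' where u: "u \<in> dom D" "y = ?f u" "u' \<in> dom D" "y' = ?f u'"
        using y unfolding V_def by blast
      show ?thesis
        unfolding V_def u f_add[OF u(1,3), symmetric] by (rule imageI dom_add u)+
    qed
    show "d *\<^sub>C y \<in> V" if y: "y \<in> V" for d y
    proof -
      obtain u where u: "u \<in> dom D" "y = ?f u"
        using y unfolding V_def by blast
      show ?thesis
        unfolding V_def u f_scale[OF u(1), symmetric] by (rule imageI dom_scaleC u)+
    qed
  qed
  have "\<exists>z\<in>closure V. \<forall>y\<in>V. cinner (g y) x = cinner y z"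
  proof (rule Riesz_subspace[OF V_sub])
    fix y y' assume "y \<in> V" "y' \<in> V"
    then obtain u u' where u: "u \<in> dom D" "y = ?f u" "u' \<in> dom D" "y' = ?f u'"
      unfolding V_def by blast
    have "g (y + y') = g y + g y'"
      unfolding u f_add[OF u(1,3), symmetric] by (simp only: g u dom_add)
    then show "cinner (g (y + y')) x = cinner (g y) x + cinner (g y') x"
      by (simp add: cinner_add_left)
  next
    fix d y assume "y \<in> V"
    then obtain u where u: "u \<in> dom D" "y = ?f u"
      unfolding V_def by blast
    have "g (d *\<^sub>C y) = d *\<^sub>C g y"
      unfolding u f_scale[OF u(1), symmetric] by (simp only: g u dom_scaleC)
    then show "cinner (g (d *\<^sub>C y)) x = d * cinner (g y) x" by (simp add: cinner_scaleC_left)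
  next
    fix y assume "y \<in> V"
    then obtain u where u: "u \<in> dom D" "y = ?f u"
      unfolding V_def by blast
    have "cmod (cinner u x) \<le> norm (?f u) * norm x"
      by (rule order_trans[OF norm_cinner_le]) (simp add: le[OF u(1)] mult_right_mono)
    then show "cmod (cinner (g y) x) \<le> norm x * norm y"
      by (simp only: u g[OF u(1)] mult.commute)
  qed
  then obtain z where z: "\<And>u. u \<in> dom D \<Longrightarrow> cinner u x = cinner (?f u) z"
    unfolding V_def using g by auto
  have "cinner (app u) z = cinner u (x + c *\<^sub>C z)" if "u \<in> dom D" for u
    using z[OF that] c by (auto simp: cinner_add_left cinner_add_right cinner_scaleC_left
        cinner_scaleC_right)
  from dom_adjoint[OF this] show ?thesis by (intro bexI[of _ z]) auto
qed

text \<open>By the factorization \<open>1 + D\<^sup>2 = (D - i)(D + i)\<close>.\<close>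

lemma resolvent_exists: "\<exists>u. u \<in> dom D \<and> app u \<in> dom D \<and> u + app (app u) = x"
proof -
  obtain v where v: "v \<in> dom D" "app v - \<i> *\<^sub>C v = x" using shifted_surj[of \<i> x] by blast
  obtain u where u: "u \<in> dom D" "app u - (- \<i>) *\<^sub>C u = v" using shifted_surj[of "- \<i>" v] by blast
  have Du: "app u = v - \<i> *\<^sub>C u"
    using u(2) by (metis add_diff_cancel_right' diff_minus_eq_add scaleC_minus_left)
  have "app (app u) = app v - \<i> *\<^sub>C app u"
    using u v by (simp add: Du app_diff app_scaleC dom_scaleC)
  also have "\<dots> = x - u"
    unfolding Du using v(2)
    by (simp add: scaleC_diff_right scaleC_scaleC scaleC_minus1 algebra_simps)
  finally show ?thesis
    using u v by (intro exI[of _ u]) (auto simp: Du intro!: dom_diff dom_scaleC)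
qed

lemma resolvent_unique:
  assumes "u \<in> dom D" "app u \<in> dom D" "u + app (app u) = x"
    and "v \<in> dom D" "app v \<in> dom D" "v + app (app v) = x"
  shows "u = v"
proof -
  let ?w = "u - v"
  have w: "?w \<in> dom D" "app ?w \<in> dom D" using assms by (simp_all add: dom_diff app_diff)
  have "app (app ?w) = app (app u) - app (app v)" using assms by (simp add: app_diff)
  also have "\<dots> = - ?w" using assms(3,6) by (simp add: algebra_simps)
  finally have "cinner (app ?w) (app ?w) = - cinner ?w ?w"
    using app_adj[OF w(1,2)] by (simp only: cinner_minus_right)
  then have "(norm (app ?w))\<^sup>2 + (norm ?w)\<^sup>2 = 0"
    by (simp add: norm_sq_cinner)
  then show ?thesis by (simp add: sum_power2_eq_zero_iff)
qed

text \<open>The operators \<open>(1 + D\<^sup>2)\<^sup>-\<^sup>1\<close> and \<open>D(1 + D\<^sup>2)\<^sup>-\<^sup>1\<close>, bounded and commuting, carry all of \<open>D\<close>.\<close>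

definition R :: "'h \<Rightarrow> 'h" where
  "R x = (SOME u. u \<in> dom D \<and> app u \<in> dom D \<and> u + app (app u) = x)"

definition S :: "'h \<Rightarrow> 'h" where
  "S x = app (R x)"

lemma R_dom: "R x \<in> dom D"
  and S_dom: "S x \<in> dom D"
  and R_eq: "R x + app (S x) = x"
  using someI_ex[OF resolvent_exists[of x]] unfolding S_def R_def by auto

lemma R_unique: "u \<in> dom D \<Longrightarrow> app u \<in> dom D \<Longrightarrow> R (u + app (app u)) = u"
  using resolvent_unique R_dom R_eq S_dom S_def by metis

lemma app_S: "app (S x) = x - R x"
  using R_eq[of x] by (simp add: algebra_simps)

lemma R_add: "R (x + y) = R x + R y"
proof -
  have "R ((R x + R y) + app (app (R x + R y))) = R x + R y"
    by (rule R_unique) (simp_all add: R_dom S_dom app_add dom_add flip: S_def)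
  moreover have "(R x + R y) + app (app (R x + R y)) = x + y"
    by (simp add: R_dom S_dom app_add app_S flip: S_def)
  ultimately show ?thesis by simp
qed

lemma R_scaleC: "R (c *\<^sub>C x) = c *\<^sub>C R x"
proof -
  have "R ((c *\<^sub>C R x) + app (app (c *\<^sub>C R x))) = c *\<^sub>C R x"
    by (rule R_unique) (simp_all add: R_dom S_dom app_scaleC dom_scaleC flip: S_def)
  moreover have "(c *\<^sub>C R x) + app (app (c *\<^sub>C R x)) = c *\<^sub>C x"
    by (simp add: R_dom S_dom app_scaleC app_S scaleC_diff_right flip: S_def)
  ultimately show ?thesis by simp
qed

lemma S_add: "S (x + y) = S x + S y"
  by (simp add: S_def R_add app_add R_dom)

lemma S_scaleC: "S (c *\<^sub>C x) = c *\<^sub>C S x"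
  by (simp add: S_def R_scaleC app_scaleC R_dom)

lemma cinner_R: "cinner (R x) y = cinner (R x) (R y) + cinner (S x) (S y)"
proof -
  have "cinner (R x) y = cinner (R x) (R y + app (S y))" by (simp add: R_eq)
  then show ?thesis by (simp add: cinner_add_right app_adj[OF R_dom S_dom, symmetric] flip: S_def)
qed

lemma R_adj: "cinner (R x) y = cinner x (R y)"
  using cinner_R[of x y] cinner_R[of y x] by (metis (no_types) cinner_commute complex_cnj_add)

lemma S_adj: "cinner (S x) y = cinner x (S y)"
proof -
  have eq: "cinner (S u) v = cinner (S u) (R v) + cinner (app (S u)) (S v)" for u v
  proof -
    have "cinner (S u) v = cinner (S u) (R v + app (S v))" by (simp add: R_eq)
    then show ?thesis by (simp add: cinner_add_right app_adj[OF S_dom S_dom])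
  qed
  have 1: "cinner (S u) (R v) = cinner (R u) (S v)" for u v
    using app_adj[OF R_dom[of u] R_dom[of v]] by (simp flip: S_def)
  have "cinner (S x) y = cinner (R x + app (S x)) (S y)"
    using eq[of x y] 1 by (simp add: cinner_add_left)
  then show ?thesis by (simp add: R_eq)
qed

lemma RS_norm: "(norm (R x))\<^sup>2 + (norm (S x))\<^sup>2 \<le> norm x * norm (R x)"
  using cinner_R[of x x] norm_cinner_le[of "R x" x] complex_Re_le_cmod[of "cinner (R x) x"]
  by (simp add: norm_sq_cinner mult.commute)

lemma R_norm: "norm (R x) \<le> norm x"
proof (cases "R x = 0")
  case False
  have "norm (R x) * norm (R x) \<le> norm x * norm (R x)"
    using RS_norm[of x] zero_le_power2[of "norm (S x)"] unfolding power2_eq_square by linarith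
  then show ?thesis using False by simp
qed simp

lemma S_norm: "norm (S x) \<le> norm x"
proof (rule power2_le_imp_le)
  have "norm x * norm (R x) \<le> norm x * norm x" by (simp add: R_norm mult_left_mono)
  then show "(norm (S x))\<^sup>2 \<le> (norm x)\<^sup>2"
    using RS_norm[of x] zero_le_power2[of "norm (R x)"] unfolding power2_eq_square by linarith
qed simp

lemma R_selfadjoint: "bounded_selfadjoint R"
  unfolding bounded_selfadjoint_def using R_adj R_norm
  by (auto intro!: bounded_clinear_intro[of R 1] simp: R_add R_scaleC)

lemma S_selfadjoint: "bounded_selfadjoint S"
  unfolding bounded_selfadjoint_def using S_adj S_norm
  by (auto intro!: bounded_clinear_intro[of S 1] simp: S_add S_scaleC)

lemma R_clinear: "bounded_clinear R" and S_clinear: "bounded_clinear S"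
  using R_selfadjoint S_selfadjoint by (auto intro: bounded_selfadjoint_clinear)

lemma R_inj: "R x = 0 \<Longrightarrow> x = 0"
  using R_eq[of x] by (simp add: S_def app_zero)

lemma R_app: "x \<in> dom D \<Longrightarrow> R (app x) = S x"
proof -
  assume x: "x \<in> dom D"
  have "R (S x + app (app (S x))) = S x"
    by (rule R_unique) (simp_all add: S_dom app_S x R_dom dom_diff)
  moreover have "S x + app (app (S x)) = app x"
    by (simp add: app_S app_diff x R_dom flip: S_def)
  ultimately show ?thesis by simp
qed

lemma RS_comm: "R (S x) = S (R x)"
  using R_app[OF R_dom, of x] by (simp add: S_def)

text \<open>This recovers \<open>dom D\<close> from \<open>R\<close> and \<open>S\<close>, so that commuting with both means commuting with \<open>D\<close>.\<close>

lemma dom_decomp: "x \<in> dom D \<Longrightarrow> x = R x + S (app x)"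
  using app_S[of x] R_app[of x] by (simp add: S_def[of "app x"])

lemma commute_app:
  assumes C: "bounded_clinear C" and CR: "\<And>x. C (R x) = R (C x)" and CS: "\<And>x. C (S x) = S (C x)"
    and x: "x \<in> dom D"
  shows "C x \<in> dom D" and "app (C x) = C (app x)"
proof -
  have eq: "C x = R (C x) + S (C (app x))"
    using arg_cong[OF dom_decomp[OF x], of C] by (simp add: bounded_clinear_add[OF C] CR CS)
  then show "C x \<in> dom D" by (metis R_dom S_dom dom_add)
  have "app (C x) = app (R (C x)) + app (S (C (app x)))"
    by (subst eq) (simp add: app_add R_dom S_dom)
  also have "\<dots> = S (C x) + (C (app x) - R (C (app x)))" by (simp add: app_S flip: S_def)
  also have "R (C (app x)) = S (C x)" by (metis CR CS R_app x)
  finally show "app (C x) = C (app x)" by simp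
qed

lemma R_range_dense: "closure (range R) = UNIV"
proof -
  have "csubspace (range R)"
    unfolding csubspace_def
    by (auto simp flip: R_add R_scaleC intro!: image_eqI[of 0 R 0] simp: bounded_clinear_zero[OF R_clinear])
  have "x \<in> closure (range R)" for x
  proof -
    obtain z where z: "z \<in> closure (range R)" "\<forall>y\<in>range R. cinner y x = cinner y z"
      using Riesz_subspace[OF \<open>csubspace (range R)\<close>, of "\<lambda>y. cinner y x" "norm x"]
      by (auto simp: cinner_add_left cinner_scaleC_left mult.commute norm_cinner_le
          intro!: order_trans[OF norm_cinner_le])
    have "cinner (R (x - z)) y = 0" for y
      using z(2) R_adj[of "x - z" y] cinner_commute[of "x - z" "R y"]
      by (simp add: cinner_diff_right)
    then have "R (x - z) = 0" by (intro eq_if_cinner_eq) simp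
    then have "x - z = 0" by (rule R_inj)
    then show ?thesis using z by simp
  qed
  then show ?thesis by blast
qed

end

section \<open>The spectral family of a self-adjoint operator\<close>

locale nested_projections =
  fixes E :: "real \<Rightarrow> 'h::chilbert_space \<Rightarrow> 'h"
  assumes proj: "orthogonal_projection (E s)"
    and nested: "s \<le> t \<Longrightarrow> E s (E t x) = E s x"
begin

lemma clinear: "bounded_clinear (E s)"
  by (rule orthogonal_projection_clinear[OF proj])

lemma nested': "s \<le> t \<Longrightarrow> E t (E s x) = E s x"
  by (rule eq_if_cinner_eq) (simp add: orthogonal_projection_adj[OF proj] nested)

lemma norm_diff_sq:
  assumes "s \<le> t"
  shows "(norm (E t x - E s x))\<^sup>2 = (norm (E t x))\<^sup>2 - (norm (E s x))\<^sup>2"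
  using orthogonal_projection_pythagoras[OF proj, of "E t x" s] by (simp add: nested[OF assms])

lemma mono: "s \<le> t \<Longrightarrow> (norm (E s x))\<^sup>2 \<le> (norm (E t x))\<^sup>2"
  using norm_diff_sq[of s t x] zero_le_power2[of "norm (E t x - E s x)"] by linarith

lemma interval_projection:
  assumes "s \<le> t"
  shows "orthogonal_projection (\<lambda>x. E t x - E s x)"
proof -
  have "orthogonal_projection (\<lambda>x. E t (x - E s x))"
    by (rule orthogonal_projection_comp[OF proj orthogonal_projection_compl[OF proj]])
      (simp add: bounded_clinear_diff[OF clinear] nested[OF assms] nested'[OF assms])
  then show ?thesis by (simp add: bounded_clinear_diff[OF clinear] nested'[OF assms])
qed

end

text \<open>
  A projection-valued distribution function. Continuity is only required of the scalar functions
  \<open>\<parallel>E(t)x\<parallel>\<^sup>2\<close>, which are the distribution functions of the scalar spectral measures.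
\<close>

locale resolution_of_identity = nested_projections E
  for E :: "real \<Rightarrow> 'h::chilbert_space \<Rightarrow> 'h" +
  assumes right_cont: "((\<lambda>t. (norm (E t x))\<^sup>2) \<longlongrightarrow> (norm (E s x))\<^sup>2) (at_right s)"
    and at_bot: "(\<lambda>n. (norm (E (- real n) x))\<^sup>2) \<longlonglongrightarrow> 0"
    and at_top: "(\<lambda>n. (norm (E (real n) x))\<^sup>2) \<longlonglongrightarrow> (norm x)\<^sup>2"

lemma Cauchy_if_norm_sq_diff:
  fixes v :: "nat \<Rightarrow> 'a::real_normed_vector"
  assumes "convergent f" and "\<And>m n. m \<le> n \<Longrightarrow> (norm (v n - v m))\<^sup>2 \<le> \<bar>f n - f m\<bar>"
  shows "Cauchy v"
proof (rule CauchyI')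
  fix e :: real assume e: "e > 0"
  then obtain M where M: "\<And>m n. m \<ge> M \<Longrightarrow> n \<ge> M \<Longrightarrow> dist (f m) (f n) < e\<^sup>2"
    using convergent_Cauchy[OF assms(1)] unfolding Cauchy_def by (meson zero_less_power)
  have "dist (v m) (v n) < e" if "m \<ge> M" "n > m" for m n
  proof -
    have "(norm (v n - v m))\<^sup>2 < e\<^sup>2"
      using assms(2)[of m n] M[of n m] that by (simp add: dist_real_def)
    then show ?thesis
      using e by (simp add: dist_norm norm_minus_commute power_less_imp_less_base)
  qed
  then show "\<exists>M. \<forall>m\<ge>M. \<forall>n>m. dist (v m) (v n) < e" by blast
qed

lemma mono_tendsto_at_right:
  fixes F :: "real \<Rightarrow> real"
  assumes mono: "\<And>s t. s \<le> t \<Longrightarrow> F s \<le> F t"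
    and lim: "(\<lambda>n. F (a + 1 / real (Suc n))) \<longlonglongrightarrow> F a"
  shows "(F \<longlongrightarrow> F a) (at_right a)"
proof (rule order_tendstoI)
  fix y assume "y < F a"
  then have "y < F t" if "a < t" for t using mono[of a t] that by simp
  then show "\<forall>\<^sub>F t in at_right a. y < F t"
    unfolding eventually_at_right_field by (intro exI[of _ "a + 1"]) auto
next
  fix y assume "F a < y"
  from order_tendstoD(2)[OF lim this] obtain n where n: "F (a + 1 / real (Suc n)) < y"
    by (auto simp: eventually_sequentially)
  then have "F t < y" if "t < a + 1 / real (Suc n)" for t
    using mono[of t "a + 1 / real (Suc n)"] that by simp
  then show "\<forall>\<^sub>F t in at_right a. F t < y"
    unfolding eventually_at_right_field by (intro exI[of _ "a + 1 / real (Suc n)"]) auto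
qed

context self_adjoint_operator
begin

text \<open>
  The bounded self-adjoint operator \<open>(D - s)(1 + D\<^sup>2)\<^sup>-\<^sup>2\<close> has the same sign as \<open>D - s\<close>, so its
  spectral projection for \<open>]-\<infinity>, 0]\<close> is the spectral projection of \<open>D\<close> for \<open>]-\<infinity>, s]\<close>. Sandwiching
  \<open>D - s\<close> between two factors \<open>R\<close> makes its quadratic form at \<open>x\<close> that of \<open>D - s\<close> at \<open>Rx\<close>.
\<close>

definition shifted :: "real \<Rightarrow> 'h \<Rightarrow> 'h" where
  "shifted s x = R (S x) - s *\<^sub>R R (R x)"

definition E :: "real \<Rightarrow> 'h \<Rightarrow> 'h" where
  "E s = (SOME P. negative_projection (shifted s) P)"

lemma shifted_selfadjoint: "bounded_selfadjoint (shifted s)"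
  unfolding bounded_selfadjoint_def
proof (intro conjI allI)
  have "bounded_clinear (\<lambda>x. R (S x) - s *\<^sub>R R (R x))"
    by (intro bounded_clinear_intros bounded_clinear_comp[OF R_clinear S_clinear]
        bounded_clinear_comp[OF R_clinear R_clinear])
  then show "bounded_clinear (shifted s)" by (simp only: shifted_def[abs_def])
  show "cinner (shifted s x) y = cinner x (shifted s y)" for x y
    by (simp add: shifted_def cinner_diff_left cinner_diff_right cinner_scaleR_left
        cinner_scaleR_right R_adj S_adj RS_comm)
qed

lemma shifted_form: "Re (cinner (shifted s x) x) = Re (cinner (S x) (R x)) - s * (norm (R x))\<^sup>2"
  by (simp add: shifted_def cinner_diff_left cinner_scaleR_left R_adj norm_sq_cinner)

lemma E_negative: "negative_projection (shifted s) (E s)"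
  unfolding E_def
  using someI_ex[OF negative_spectral_projection[OF shifted_selfadjoint]] .

lemma E_proj: "orthogonal_projection (E s)"
  by (rule negative_projectionD(1)[OF E_negative])

lemma E_clinear: "bounded_clinear (E s)"
  by (rule orthogonal_projection_clinear[OF E_proj])

lemma E_commute:
  assumes C: "bounded_selfadjoint C" and R: "\<And>x. C (R x) = R (C x)" and S: "\<And>x. C (S x) = S (C x)"
  shows "C (E s x) = E s (C x)"
proof (rule negative_projectionD(2)[OF E_negative C])
  note Cc = bounded_selfadjoint_clinear[OF C]
  show "C (shifted s x) = shifted s (C x)" for x
    by (simp add: shifted_def bounded_clinear_diff[OF Cc] bounded_clinear_scaleR[OF Cc] R S)
qed

lemma E_R: "E s (R x) = R (E s x)"
  by (rule E_commute[OF R_selfadjoint, symmetric]) (simp_all add: RS_comm)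

lemma E_S: "E s (S x) = S (E s x)"
  by (rule E_commute[OF S_selfadjoint, symmetric]) (simp_all add: RS_comm)

lemma E_E: "E s (E t x) = E t (E s x)"
  by (rule E_commute[OF orthogonal_projection_selfadjoint[OF E_proj]]) (simp_all add: E_R E_S)

lemma E_le: "E s x = x \<Longrightarrow> Re (cinner (S x) (R x)) \<le> s * (norm (R x))\<^sup>2"
  using negative_projectionD(3)[OF E_negative, of s x] by (simp add: shifted_form)

lemma E_ge: "E s x = 0 \<Longrightarrow> Re (cinner (S x) (R x)) \<ge> s * (norm (R x))\<^sup>2"
  using negative_projectionD(4)[OF E_negative, of s x] by (simp add: shifted_form)

lemma E_strict: "E s x = 0 \<Longrightarrow> Re (cinner (S x) (R x)) = s * (norm (R x))\<^sup>2 \<Longrightarrow> x = 0"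
  using negative_projectionD(5)[OF E_negative, of s x] by (simp add: shifted_form)

lemma E_nested:
  assumes "s \<le> t"
  shows "E s (E t x) = E s x"
proof (cases "s = t")
  case True
  then show ?thesis by (simp add: orthogonal_projection_idem[OF E_proj])
next
  case False
  \<comment> \<open>At \<open>Ry\<close> the form of \<open>D\<close> is at most \<open>s\<close> and at least \<open>t\<close>, which leaves only \<open>y = 0\<close>.\<close>
  define y where "y = E s (x - E t x)"
  have "E s y = y" by (simp add: y_def orthogonal_projection_idem[OF E_proj])
  moreover have "E t y = 0"
    by (simp add: y_def E_E[of t s] bounded_clinear_diff[OF E_clinear]
        orthogonal_projection_idem[OF E_proj] bounded_clinear_zero[OF E_clinear])
  ultimately have "t * (norm (R y))\<^sup>2 \<le> s * (norm (R y))\<^sup>2"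
    using E_le[of s y] E_ge[of t y] by linarith
  then have "R y = 0" using assms False by (simp add: mult_le_cancel_right)
  then have "y = 0" by (rule R_inj)
  then show ?thesis by (simp add: y_def bounded_clinear_diff[OF E_clinear])
qed

sublocale nested: nested_projections E
  by unfold_locales (fact E_proj E_nested)+

lemma E_bounded: "(norm (E s x))\<^sup>2 \<le> (norm x)\<^sup>2"
  by (rule power_mono[OF orthogonal_projection_norm_le[OF E_proj] norm_ge_zero])

lemma E_monoseq_convergent:
  assumes "monoseq r"
  shows "convergent (\<lambda>n. E (r n) x)"
proof -
  have "monoseq (\<lambda>n. (norm (E (r n) x))\<^sup>2)"
    using assms nested.mono unfolding monoseq_def by blast
  moreover have "Bseq (\<lambda>n. (norm (E (r n) x))\<^sup>2)"
    using E_bounded[of _ x] by (intro BseqI'[of _ "(norm x)\<^sup>2"]) simp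
  ultimately have conv: "convergent (\<lambda>n. (norm (E (r n) x))\<^sup>2)"
    by (rule Bseq_monoseq_convergent[rotated])
  have "(norm (E t x - E s x))\<^sup>2 = \<bar>(norm (E t x))\<^sup>2 - (norm (E s x))\<^sup>2\<bar>" for s t
  proof (cases "s \<le> t")
    case True
    then show ?thesis using nested.mono[of s t x] by (simp add: nested.norm_diff_sq)
  next
    case False
    then show ?thesis using nested.mono[of t s x] nested.norm_diff_sq[of t s x] by (simp add: norm_minus_commute)
  qed
  then have "Cauchy (\<lambda>n. E (r n) x)"
    by (intro Cauchy_if_norm_sq_diff[OF conv]) simp
  then show ?thesis by (rule Cauchy_convergent)
qed

text \<open>
  The jump \<open>y\<close> of \<open>E(t)x\<close> at \<open>s\<close> lies in the range of \<open>E(t)\<close> for all \<open>t > s\<close> and is orthogonal to the range of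
  \<open>E(s)\<close>. The form of \<open>D - s\<close> therefore vanishes at \<open>Ry\<close>, and \<open>E_strict\<close> excludes this unless \<open>y = 0\<close>.
\<close>

lemma E_right_cont: "((\<lambda>t. (norm (E t x))\<^sup>2) \<longlongrightarrow> (norm (E s x))\<^sup>2) (at_right s)"
proof (rule mono_tendsto_at_right[OF nested.mono])
  define r where "r n = s + 1 / real (Suc n)" for n
  have dec: "decseq r" unfolding r_def decseq_def by (auto simp: field_simps)
  then obtain z where z: "(\<lambda>n. E (r n) x) \<longlonglongrightarrow> z"
    using E_monoseq_convergent[of r x] by (auto simp: convergent_def decseq_imp_monoseq)
  define y where "y = z - E s x"
  have yt: "E t y = y" if "s < t" for t
  proof -
    have "r \<longlonglongrightarrow> s + 0"
      unfolding r_def using LIMSEQ_inverse_real_of_nat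
      by (intro tendsto_add tendsto_const) (simp add: inverse_eq_divide)
    then have "\<forall>\<^sub>F n in sequentially. r n < t" using that by (intro order_tendstoD(2)) auto
    then have ev: "\<forall>\<^sub>F n in sequentially. E t (E (r n) x) = E (r n) x"
      by eventually_elim (simp add: nested.nested')
    have "E t z = z"
      by (rule LIMSEQ_unique[OF bounded_clinear_tendsto[OF E_clinear z]])
        (use ev z in \<open>simp add: tendsto_cong\<close>)
    then show ?thesis
      using that by (simp add: y_def bounded_clinear_diff[OF E_clinear] nested.nested')
  qed
  have ys: "E s y = 0"
  proof -
    have "E s (E (r n) x) = E s x" for n by (rule E_nested) (simp add: r_def)
    then have "E s z = E s x"
      using LIMSEQ_unique[OF bounded_clinear_tendsto[OF E_clinear z], of s "E s x"] by simp
    then show ?thesis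
      by (simp add: y_def bounded_clinear_diff[OF E_clinear] orthogonal_projection_idem[OF E_proj])
  qed
  have "Re (cinner (S y) (R y)) \<le> s * (norm (R y))\<^sup>2"
  proof (rule tendsto_lowerbound)
    show "((\<lambda>t. t * (norm (R y))\<^sup>2) \<longlongrightarrow> s * (norm (R y))\<^sup>2) (at_right s)"
      by (intro tendsto_intros)
    show "\<forall>\<^sub>F t in at_right s. Re (cinner (S y) (R y)) \<le> t * (norm (R y))\<^sup>2"
      using yt E_le by (intro eventually_at_rightI[of s "s + 1"]) auto
  qed simp
  with E_ge[OF ys] have "y = 0" by (intro E_strict[OF ys]) simp
  then show "(\<lambda>n. (norm (E (s + 1 / real (Suc n)) x))\<^sup>2) \<longlonglongrightarrow> (norm (E s x))\<^sup>2"
    using z unfolding r_def y_def by (intro tendsto_intros) simp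
qed

text \<open>
  A limit \<open>z\<close> of \<open>E(t)x\<close> at \<open>-\<infinity>\<close> lies in the range of every \<open>E(t)\<close>, so the form of \<open>D\<close> at \<open>Rz\<close> is below every
  multiple of \<open>\<parallel>Rz\<parallel>\<^sup>2\<close>. The behaviour at \<open>\<infinity>\<close> is dual.
\<close>

lemma E_at_bot: "(\<lambda>n. (norm (E (- real n) x))\<^sup>2) \<longlonglongrightarrow> 0"
proof -
  define r where "r n = - real n" for n
  have dec: "decseq r" unfolding r_def decseq_def by auto
  then obtain z where z: "(\<lambda>n. E (r n) x) \<longlonglongrightarrow> z"
    using E_monoseq_convergent[of r x] by (auto simp: convergent_def decseq_imp_monoseq)
  have zt: "E t z = z" for t
  proof -
    obtain N where "real N \<ge> - t" using real_arch_simple by blast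
    then have "\<forall>\<^sub>F n in sequentially. r n \<le> t"
      unfolding r_def eventually_sequentially by (intro exI[of _ N]) auto
    then have ev: "\<forall>\<^sub>F n in sequentially. E t (E (r n) x) = E (r n) x"
      by eventually_elim (simp add: nested.nested')
    show ?thesis
      by (rule LIMSEQ_unique[OF bounded_clinear_tendsto[OF E_clinear z]])
        (use ev z in \<open>simp add: tendsto_cong\<close>)
  qed
  have "R z = 0"
  proof (rule ccontr)
    assume "R z \<noteq> 0"
    then have n: "(norm (R z))\<^sup>2 > 0" by simp
    define t where "t = Re (cinner (S z) (R z)) / (norm (R z))\<^sup>2 - 1"
    have "Re (cinner (S z) (R z)) \<le> t * (norm (R z))\<^sup>2" by (rule E_le[OF zt])
    then show False using n by (simp add: t_def field_simps)
  qed
  then have "z = 0" by (rule R_inj)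
  then show ?thesis using tendsto_power[OF tendsto_norm[OF z], of 2] by (simp add: r_def)
qed

lemma E_at_top: "(\<lambda>n. (norm (E (real n) x))\<^sup>2) \<longlonglongrightarrow> (norm x)\<^sup>2"
proof -
  have inc: "incseq real" unfolding incseq_def by auto
  then obtain z where z: "(\<lambda>n. E (real n) x) \<longlonglongrightarrow> z"
    using E_monoseq_convergent[of real x] by (auto simp: convergent_def incseq_imp_monoseq)
  define y where "y = x - z"
  have yt: "E t y = 0" for t
  proof -
    obtain N where "real N \<ge> t" using real_arch_simple by blast
    then have "\<forall>\<^sub>F n in sequentially. t \<le> real n"
      unfolding eventually_sequentially by (intro exI[of _ N]) auto
    then have ev: "\<forall>\<^sub>F n in sequentially. E t (E (real n) x) = E t x"
      by eventually_elim (simp add: E_nested)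
    have "E t z = E t x"
      by (rule LIMSEQ_unique[OF bounded_clinear_tendsto[OF E_clinear z]])
        (use ev in \<open>simp add: tendsto_cong\<close>)
    then show ?thesis by (simp add: y_def bounded_clinear_diff[OF E_clinear])
  qed
  have "R y = 0"
  proof (rule ccontr)
    assume "R y \<noteq> 0"
    then have n: "(norm (R y))\<^sup>2 > 0" by simp
    define t where "t = Re (cinner (S y) (R y)) / (norm (R y))\<^sup>2 + 1"
    have "Re (cinner (S y) (R y)) \<ge> t * (norm (R y))\<^sup>2" by (rule E_ge[OF yt])
    then show False using n by (simp add: t_def field_simps)
  qed
  then have "y = 0" by (rule R_inj)
  then show ?thesis using tendsto_power[OF tendsto_norm[OF z], of 2] by (simp add: y_def)
qed

sublocale resolution: resolution_of_identity E
  by unfold_locales (fact E_right_cont E_at_bot E_at_top)+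

text \<open>
  On the range of a spectral projection for an interval around \<open>m\<close>, the operator \<open>D\<close> is everywhere
  defined and close to \<open>m\<close>. The estimate is read off from \<open>E_le\<close> and \<open>E_ge\<close> on the vectors in the range
  of \<open>R\<close>, which are dense there, and carried over by closedness.
\<close>

lemma interval_app:
  assumes st: "s \<le> t"
  defines "P \<equiv> \<lambda>x. E t x - E s x"
  assumes x: "P x = x"
  shows "x \<in> dom D" and "norm (app x - ((s + t) / 2) *\<^sub>R x) \<le> (t - s) * norm x"
proof -
  let ?m = "(s + t) / 2"
  let ?T = "\<lambda>x. app x - ?m *\<^sub>R x"
  have P: "orthogonal_projection P" unfolding P_def by (rule nested.interval_projection[OF st])
  note Pc = orthogonal_projection_clinear[OF P]
  have PR: "P (R y) = R (P y)" and PS: "P (S y) = S (P y)" for y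
    by (simp_all add: P_def E_R E_S bounded_clinear_diff[OF R_clinear] bounded_clinear_diff[OF S_clinear])
  define K where "K = {R y |y. P y = y}"
  have K_dom: "u \<in> dom D" if "u \<in> K" for u using that by (auto simp: K_def R_dom)
  have K_sub: "csubspace K"
    unfolding csubspace_def K_def
    using bounded_clinear_zero[OF Pc] bounded_clinear_add[OF Pc] bounded_clinear_scaleC[OF Pc]
    by (auto simp flip: R_add R_scaleC) (metis bounded_clinear_zero[OF R_clinear])
  have form: "cmod (cinner (?T u) u) \<le> (t - s) / 2 * (norm u)\<^sup>2" if "u \<in> K" for u
  proof -
    from that obtain y where y: "P y = y" and u: "u = R y" unfolding K_def by blast
    have "E t y = y"
      using y st unfolding P_def
      by (metis nested.nested' bounded_clinear_diff[OF E_clinear] order_refl)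
    moreover have "E s y = 0" using y calculation unfolding P_def by (simp add: algebra_simps)
    ultimately have "Re (cinner (S y) (R y)) \<le> t * (norm u)\<^sup>2" "Re (cinner (S y) (R y)) \<ge> s * (norm u)\<^sup>2"
      using E_le[of t y] E_ge[of s y] u by auto
    then have "\<bar>Re (cinner (app u) u) - ?m * (norm u)\<^sup>2\<bar> \<le> (t - s) / 2 * (norm u)\<^sup>2"
      unfolding u by (simp add: abs_le_iff field_simps flip: S_def)
    moreover have "cinner (?T u) u = of_real (Re (cinner (app u) u) - ?m * (norm u)\<^sup>2)"
      using Im_app[OF K_dom[OF that]]
      by (simp add: complex_eq_iff cinner_diff_left cinner_scaleR_left cinner_self)
    ultimately show ?thesis by (simp del: of_real_diff of_real_mult)
  qed
  have TK: "norm (?T u) \<le> (t - s) * norm u" if u: "u \<in> K" for u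
  proof -
    have Tu: "P (?T u) = ?T u"
    proof -
      from u obtain y where y: "P y = y" and u': "u = R y" unfolding K_def by blast
      show ?thesis
        using PR[of y] PS[of y]
        by (simp add: u' y bounded_clinear_diff[OF Pc] bounded_clinear_scaleR[OF Pc] flip: S_def)
    qed
    show ?thesis
    proof (rule norm_le_if_dense[OF R_range_dense])
      show "0 \<le> (t - s) * norm u" using st by simp
      fix w assume "w \<in> range R"
      then obtain y where w: "w = R y" by blast
      have Pw: "P w \<in> K"
        unfolding K_def w using orthogonal_projection_idem[OF P] PR by (intro CollectI exI[of _ "P y"]) auto
      have "cmod (cinner (?T u) w) = cmod (cinner (?T u) (P w))"
        by (metis Tu orthogonal_projection_adj[OF P])
      also have "\<dots> \<le> 2 * ((t - s) / 2) * norm u * norm (P w)"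
        by (rule polarization_bound[OF K_sub _ _ form u Pw])
          (auto simp: app_add app_scaleC K_dom scaleR_right_distrib scaleC_diff_right scaleC_scaleR)
      also have "\<dots> = (t - s) * norm u * norm (P w)" by (simp add: field_simps)
      also have "\<dots> \<le> (t - s) * norm u * norm w"
        by (rule mult_left_mono[OF orthogonal_projection_norm_le[OF P]]) (use st in simp)
      finally show "cmod (cinner (?T u) w) \<le> (t - s) * norm u * norm w" .
    qed
  qed
  have "x \<in> closure (range R)" using R_range_dense by simp
  then obtain v where v: "\<And>n. v n \<in> range R" "v \<longlonglongrightarrow> x" unfolding closure_sequential by blast
  define w where "w n = P (v n)" for n
  have wK: "w n \<in> K" for n
    using v(1)[of n] orthogonal_projection_idem[OF P] PR unfolding K_def w_def by auto
  have w: "w \<longlonglongrightarrow> x"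
    using bounded_clinear_tendsto[OF Pc v(2)] x by (simp add: w_def[abs_def])
  have "Cauchy (\<lambda>n. ?T (w n))"
  proof (rule Cauchy_if_dist_le[OF LIMSEQ_imp_Cauchy[OF w]])
    fix m n
    have "?T (w m) - ?T (w n) = ?T (w m - w n)"
      by (simp add: app_diff K_dom wK scaleR_right_diff_distrib)
    then show "dist (?T (w m)) (?T (w n)) \<le> (t - s) * dist (w m) (w n)"
      using TK[OF csubspace_diff[OF K_sub wK wK], of m n] by (simp add: dist_norm)
  qed
  then obtain z where z: "(\<lambda>n. ?T (w n)) \<longlonglongrightarrow> z"
    unfolding Cauchy_convergent_iff convergent_def by blast
  have "(\<lambda>n. app (w n)) \<longlonglongrightarrow> z + ?m *\<^sub>R x"
    using tendsto_add[OF z tendsto_scaleR[OF tendsto_const[of ?m] w]] by simp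
  from closed_graph[OF K_dom[OF wK] w this]
  show "x \<in> dom D" and "norm (?T x) \<le> (t - s) * norm x"
    using LIMSEQ_le[OF tendsto_norm[OF z] tendsto_mult[OF tendsto_const[of "t - s"] tendsto_norm[OF w]]]
      TK[OF wK] by auto
qed

lemma E_dom: "x \<in> dom D \<Longrightarrow> E s x \<in> dom D"
  and app_E: "x \<in> dom D \<Longrightarrow> app (E s x) = E s (app x)"
  by (simp_all only: commute_app[of "E s", OF E_clinear E_R E_S])

end

section \<open>From a spectral family to a projection-valued measure\<close>

lemma norm_sq_sum_orthogonal:
  fixes v :: "'i \<Rightarrow> 'a::complex_inner"
  assumes "finite I" and "\<And>i j. i \<in> I \<Longrightarrow> j \<in> I \<Longrightarrow> i \<noteq> j \<Longrightarrow> cinner (v i) (v j) = 0"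
  shows "(norm (\<Sum>i\<in>I. v i))\<^sup>2 = (\<Sum>i\<in>I. (norm (v i))\<^sup>2)"
  using assms
proof (induction I rule: finite_induct)
  case (insert i I)
  have "cinner (v i) (\<Sum>j\<in>I. v j) = (\<Sum>j\<in>I. 0)"
    unfolding cinner_sum_right by (rule sum.cong) (use insert in auto)
  then show ?case using insert by (simp add: norm_sq_add_orthogonal)
qed simp

text \<open>The series converge by Bessel's inequality, which is \<open>bound\<close> below.\<close>

lemma orthogonal_projection_sums:
  fixes P :: "nat \<Rightarrow> 'h::chilbert_space \<Rightarrow> 'h"
  assumes P: "\<And>n. orthogonal_projection (P n)"
    and orth: "\<And>m n x. m \<noteq> n \<Longrightarrow> P m (P n x) = 0"
  obtains Q where "orthogonal_projection Q" "\<And>x. (\<lambda>n. P n x) sums Q x"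
    "\<And>x. (\<lambda>n. (norm (P n x))\<^sup>2) sums (norm (Q x))\<^sup>2"
proof -
  note Pc = orthogonal_projection_clinear[OF P]
  have orth': "cinner (P m x) (P n y) = 0" if "m \<noteq> n" for m n x y
    using orth[OF that, of y] by (simp add: orthogonal_projection_adj[OF P])
  have norm_sum: "(norm (\<Sum>n\<in>I. P n x))\<^sup>2 = (\<Sum>n\<in>I. (norm (P n x))\<^sup>2)" if "finite I" for I x
    using that orth' by (intro norm_sq_sum_orthogonal) auto
  have bound: "(\<Sum>n<N. (norm (P n x))\<^sup>2) \<le> (norm x)\<^sup>2" for N x
  proof -
    let ?y = "\<Sum>n<N. P n x"
    have "(\<Sum>n<N. (norm (P n x))\<^sup>2) = Re (cinner ?y x)"
      by (simp add: cinner_sum_left orthogonal_projection_cinner[OF P] del: of_real_power)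
    also have "\<dots> \<le> norm ?y * norm x"
      using norm_cinner_le complex_Re_le_cmod order_trans by blast
    finally have "norm ?y * norm ?y \<le> norm ?y * norm x"
      unfolding norm_sum[OF finite_lessThan, symmetric] unfolding power2_eq_square .
    then have "norm ?y \<le> norm x" by (cases "?y = 0") auto
    then show ?thesis unfolding norm_sum[OF finite_lessThan, symmetric] by (rule power_mono) simp
  qed
  have sq: "summable (\<lambda>n. (norm (P n x))\<^sup>2)" for x
    by (rule summableI_nonneg_bounded[of _ "(norm x)\<^sup>2"]) (use bound in auto)
  have "summable (\<lambda>n. P n x)" for x
  proof -
    have "Cauchy (\<lambda>N. \<Sum>n<N. P n x)"
    proof (rule Cauchy_if_norm_sq_diff)
      show "convergent (\<lambda>N. \<Sum>n<N. (norm (P n x))\<^sup>2)"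
        using sq[of x] by (simp add: summable_iff_convergent)
      fix M N :: nat assume "M \<le> N"
      then show "(norm ((\<Sum>n<N. P n x) - (\<Sum>n<M. P n x)))\<^sup>2
          \<le> \<bar>(\<Sum>n<N. (norm (P n x))\<^sup>2) - (\<Sum>n<M. (norm (P n x))\<^sup>2)\<bar>"
        using norm_sum[of "{..<N} - {..<M}" x] by (simp add: sum_diff[symmetric])
    qed
    then show ?thesis by (simp add: summable_iff_convergent Cauchy_convergent)
  qed
  define Q where "Q x = (\<Sum>n. P n x)" for x
  have Q: "(\<lambda>n. P n x) sums Q x" for x
    unfolding Q_def by (rule summable_sums) fact
  have Q_norm: "(\<lambda>n. (norm (P n x))\<^sup>2) sums (norm (Q x))\<^sup>2" for x
    using tendsto_power[OF tendsto_norm[OF Q[of x, unfolded sums_def]], of 2]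
    unfolding sums_def by (simp add: norm_sum)
  have partial: "norm (\<Sum>n<N. P n x) \<le> 1 * norm x" for N x
    using bound[of x N] by (simp add: norm_sum[symmetric] power2_le_iff_abs_le)
  have "bounded_clinear Q"
    by (rule bounded_clinear_limit[OF bounded_clinear_setsum[OF Pc] sequentially_bot
          Q[unfolded sums_def] always_eventually[OF allI[OF partial]]])
  moreover have "Q (Q x) = Q x" for x
  proof -
    have "P m (Q x) = P m x" for m
    proof (rule sums_unique2)
      show "(\<lambda>n. P m (P n x)) sums P m (Q x)"
        by (rule bounded_linear.sums[OF bounded_clinear_linear[OF Pc] Q])
      have "(\<lambda>n. P m (P n x)) = (\<lambda>n. if n = m then P m x else 0)"
        by (auto simp: orth orthogonal_projection_idem[OF P])
      then show "(\<lambda>n. P m (P n x)) sums P m x" using sums_single[of m "\<lambda>_. P m x"] by simp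
    qed
    then show ?thesis by (simp add: Q_def)
  qed
  moreover have "cinner (Q x) y = cinner x (Q y)" for x y
  proof (rule sums_unique2)
    show "(\<lambda>n. cinner (P n x) y) sums cinner (Q x) y"
      by (rule bounded_linear.sums[OF bounded_bilinear.bounded_linear_left[OF bounded_bilinear_cinner] Q])
    show "(\<lambda>n. cinner (P n x) y) sums cinner x (Q y)"
      by (simp only: orthogonal_projection_adj[OF P])
        (rule bounded_linear.sums[OF bounded_bilinear.bounded_linear_right[OF bounded_bilinear_cinner] Q])
  qed
  ultimately have "orthogonal_projection Q"
    by (simp add: orthogonal_projection_def fun_eq_iff)
  then show thesis using Q Q_norm by (rule that)
qed

context resolution_of_identity
begin

definition scalar_measure :: "'h \<Rightarrow> real measure" where
  "scalar_measure x = interval_measure (\<lambda>t. (norm (E t x))\<^sup>2)"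

lemma sets_scalar_measure [simp]: "sets (scalar_measure x) = sets borel"
  and space_scalar_measure [simp]: "space (scalar_measure x) = UNIV"
  by (simp_all add: scalar_measure_def)

lemma emeasure_scalar_Ioc:
  assumes "s \<le> t"
  shows "emeasure (scalar_measure x) {s<..t} = ennreal ((norm (E t x - E s x))\<^sup>2)"
  unfolding scalar_measure_def norm_diff_sq[OF assms]
  by (rule emeasure_interval_measure_Ioc[OF assms mono])
    (auto simp: continuous_within right_cont)

lemma emeasure_scalar_UNIV: "emeasure (scalar_measure x) UNIV = ennreal ((norm x)\<^sup>2)"
proof (rule LIMSEQ_unique)
  let ?I = "\<lambda>n::nat. {- real n <.. real n}"
  have "(\<lambda>n. emeasure (scalar_measure x) (?I n)) \<longlonglongrightarrow> emeasure (scalar_measure x) (\<Union>n. ?I n)"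
    by (rule Lim_emeasure_incseq) (auto simp: incseq_def)
  moreover have "(\<Union>n. ?I n) = UNIV"
  proof -
    have "\<exists>n. y \<in> ?I n" for y
    proof -
      obtain n :: nat where "real n > \<bar>y\<bar>" using reals_Archimedean2 by blast
      then show ?thesis by (intro exI[of _ n]) auto
    qed
    then show ?thesis by blast
  qed
  ultimately show "(\<lambda>n. emeasure (scalar_measure x) (?I n)) \<longlonglongrightarrow> emeasure (scalar_measure x) UNIV"
    by simp
  have "(\<lambda>n. (norm (E (real n) x))\<^sup>2 - (norm (E (- real n) x))\<^sup>2) \<longlonglongrightarrow> (norm x)\<^sup>2 - 0"
    by (intro tendsto_diff at_top at_bot)
  then show "(\<lambda>n. emeasure (scalar_measure x) (?I n)) \<longlonglongrightarrow> ennreal ((norm x)\<^sup>2)"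
    by (simp add: emeasure_scalar_Ioc norm_diff_sq)
qed

lemma finite_scalar_measure: "finite_measure (scalar_measure x)"
  by (rule finite_measureI) (simp add: emeasure_scalar_UNIV)

lemma measure_scalar_UNIV: "measure (scalar_measure x) UNIV = (norm x)\<^sup>2"
  by (simp add: measure_def emeasure_scalar_UNIV)

definition represents :: "real set \<Rightarrow> ('h \<Rightarrow> 'h) \<Rightarrow> bool" where
  "represents B P \<longleftrightarrow> orthogonal_projection P \<and> (\<forall>x. measure (scalar_measure x) B = (norm (P x))\<^sup>2)"

lemma represents_unique:
  assumes "represents B P" "represents B Q"
  shows "P = Q"
proof (rule orthogonal_projection_eqI)
  show "norm (P x) = norm (Q x)" for x
    using assms unfolding represents_def by (metis norm_ge_zero power2_eq_imp_eq)
qed (use assms in \<open>auto simp: represents_def\<close>)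

text \<open>
  If projections represent disjoint sets, their quadratic forms add up to at most the identity, which
  forces orthogonality.
\<close>

lemma represents_disjoint:
  assumes B: "represents B P" "B \<in> sets borel" and C: "represents C Q" "C \<in> sets borel"
    and disj: "B \<inter> C = {}"
  shows "P (Q x) = 0"
proof -
  interpret finite_measure "scalar_measure y" for y by (rule finite_scalar_measure)
  have Q: "Q (Q x) = Q x" using C(1) by (simp add: represents_def orthogonal_projection_idem)
  have "(norm (P (Q x)))\<^sup>2 + (norm (Q (Q x)))\<^sup>2 = measure (scalar_measure (Q x)) (B \<union> C)"
    using B C disj by (subst finite_measure_Union) (auto simp: represents_def)
  also have "\<dots> \<le> (norm (Q x))\<^sup>2"
    using bounded_measure[of "Q x" "B \<union> C"] by (simp add: measure_scalar_UNIV)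
  finally show ?thesis by (simp add: Q)
qed

lemma represents_Union:
  assumes B: "\<And>n. B n \<in> sets borel" "disjoint_family B" and P: "\<And>n::nat. represents (B n) (P n)"
  shows "\<exists>Q. represents (\<Union>n. B n) Q \<and> (\<forall>x. (\<lambda>n. P n x) sums Q x)"
proof -
  have "P m (P n x) = 0" if "m \<noteq> n" for m n x
    using represents_disjoint[OF P B(1) P B(1)] disjoint_family_onD[OF B(2) _ _ that] by simp
  then obtain Q where Q: "orthogonal_projection Q" "\<And>x. (\<lambda>n. P n x) sums Q x"
    "\<And>x. (\<lambda>n. (norm (P n x))\<^sup>2) sums (norm (Q x))\<^sup>2"
    using orthogonal_projection_sums[of P] P unfolding represents_def by metis
  have "measure (scalar_measure x) (\<Union>n. B n) = (norm (Q x))\<^sup>2" for x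
  proof (rule sums_unique2[OF _ Q(3)])
    interpret finite_measure "scalar_measure x" by (rule finite_scalar_measure)
    have "(\<lambda>n. measure (scalar_measure x) (B n)) sums measure (scalar_measure x) (\<Union>n. B n)"
      by (rule finite_measure_UNION) (use B in auto)
    then show "(\<lambda>n. (norm (P n x))\<^sup>2) sums measure (scalar_measure x) (\<Union>n. B n)"
      using P by (simp add: represents_def)
  qed
  with Q(1,2) show ?thesis unfolding represents_def by blast
qed

text \<open>
  The sets represented by projections form a Dynkin system containing the half-open intervals, hence
  they are all the Borel sets.
\<close>

lemma represents_exists:
  assumes "B \<in> sets borel"
  shows "\<exists>P. represents B P"
proof -
  let ?G = "range (\<lambda>(a, b). {a<..b::real})"
  have borel: "sets borel = sigma_sets UNIV ?G"
    by (subst borel_sigma_sets_Ioc) (rule sets_measure_of, simp)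
  have int: "Int_stable ?G"
    unfolding Int_stable_def
  proof (intro ballI)
    fix A B assume "A \<in> ?G" "B \<in> ?G"
    then obtain a b c d where "A = {a<..b}" "B = {c<..d}" by auto
    then have "A \<inter> B = {max a c<..min b d}" by auto
    then show "A \<inter> B \<in> ?G" by (intro image_eqI[of _ _ "(max a c, min b d)"]) auto
  qed
  have zero: "represents {} (\<lambda>x. 0)"
    by (auto simp: represents_def orthogonal_projection_def bounded_clinear_0)
  have "?G \<subseteq> Pow UNIV" and "B \<in> sigma_sets UNIV ?G" using assms borel by simp_all
  with int show ?thesis
  proof (induction rule: sigma_sets_induct_disjoint)
    case (basic A)
    then obtain a b where A: "A = {a<..b}" by auto
    show ?case
    proof (cases "a \<le> b")
      case True
      then show ?thesis
        using interval_projection[OF True]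
        by (auto simp: A represents_def measure_def emeasure_scalar_Ioc)
    next
      case False
      then show ?thesis using zero by (auto simp: A)
    qed
  next
    case empty
    show ?case using zero by blast
  next
    case (compl A)
    then obtain P where P: "represents A P" by blast
    have A: "A \<in> sets borel" using compl(1) borel by simp
    have "measure (scalar_measure x) (UNIV - A) = (norm (x - P x))\<^sup>2" for x
    proof -
      interpret finite_measure "scalar_measure x" by (rule finite_scalar_measure)
      show ?thesis
        using finite_measure_compl[of A] A P orthogonal_projection_pythagoras[of P x]
        by (simp add: represents_def measure_scalar_UNIV)
    qed
    then show ?case using P unfolding represents_def by (auto intro: orthogonal_projection_compl)
  next
    case (union A)
    have A: "A n \<in> sets borel" for n using union(2) borel by auto
    obtain P where "\<And>n. represents (A n) (P n)" using union(3) by metis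
    from represents_Union[OF A union(1) this] show ?case by blast
  qed
qed

definition spectral_projection :: "real set \<Rightarrow> 'h \<Rightarrow> 'h" where
  "spectral_projection B = (SOME P. represents B P)"

lemma spectral_projection: "B \<in> sets borel \<Longrightarrow> represents B (spectral_projection B)"
  unfolding spectral_projection_def by (rule someI_ex[OF represents_exists])

lemma spectral_projection_eqI: "B \<in> sets borel \<Longrightarrow> represents B P \<Longrightarrow> spectral_projection B = P"
  by (rule represents_unique[OF spectral_projection])

lemma spectral_projection_Ioc:
  "s \<le> t \<Longrightarrow> spectral_projection {s<..t} = (\<lambda>x. E t x - E s x)"
  by (rule spectral_projection_eqI)
    (auto simp: represents_def measure_def emeasure_scalar_Ioc interval_projection)

lemma spectral_projection_Un:
  assumes B: "B \<in> sets borel" and C: "C \<in> sets borel" and disj: "B \<inter> C = {}"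
  shows "spectral_projection (B \<union> C) x = spectral_projection B x + spectral_projection C x"
proof -
  note BC = sets.Un[OF B C]
  note P = spectral_projection[OF B, unfolded represents_def]
    and Q = spectral_projection[OF C, unfolded represents_def]
    and PQ = spectral_projection[OF BC, unfolded represents_def]
  have "spectral_projection (B \<union> C) = (\<lambda>x. spectral_projection B x + spectral_projection C x)"
  proof (rule bounded_clinear_eqI)
    show "bounded_clinear (spectral_projection (B \<union> C))"
      using PQ orthogonal_projection_clinear by blast
    show "bounded_clinear (\<lambda>x. spectral_projection B x + spectral_projection C x)"
      using P Q orthogonal_projection_clinear by (intro bounded_clinear_plus) blast+
    fix x
    interpret finite_measure "scalar_measure x" by (rule finite_scalar_measure)
    have "measure (scalar_measure x) (B \<union> C)
        = measure (scalar_measure x) B + measure (scalar_measure x) C"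
      by (rule finite_measure_Union) (use B C disj in auto)
    then show "cinner (spectral_projection (B \<union> C) x) x
        = cinner (spectral_projection B x + spectral_projection C x) x"
      using P Q PQ by (simp add: cinner_add_left orthogonal_projection_cinner flip: of_real_add of_real_power)
  qed
  then show ?thesis by simp
qed

lemma projection_valued_measure_spectral_projection:
  "projection_valued_measure spectral_projection"
  unfolding projection_valued_measure_def
proof (intro conjI ballI allI impI)
  show proj: "orthogonal_projection (spectral_projection B)" if "B \<in> sets borel" for B
    using spectral_projection[OF that] by (simp add: represents_def)
  show "spectral_projection UNIV = id"
    by (rule spectral_projection_eqI)
      (auto simp: represents_def measure_scalar_UNIV orthogonal_projection_def bounded_clinear_id
        id_def fun_eq_iff)
  \<comment> \<open>By additivity, multiplicativity reduces to the orthogonality for disjoint sets.\<close>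
  show "spectral_projection (A \<inter> B) = spectral_projection A \<circ> spectral_projection B"
    if A: "A \<in> sets borel" and B: "B \<in> sets borel" for A B
  proof
    fix x
    let ?P = spectral_projection
    note zero = represents_disjoint[OF spectral_projection _ spectral_projection]
    have "?P A y = ?P (A \<inter> B) y + ?P (A - B) y" for y
      using spectral_projection_Un[of "A \<inter> B" "A - B" y] A B by (simp add: Int_Diff_Un Int_Diff_disjoint)
    moreover have "?P B x = ?P (A \<inter> B) x + ?P (B - A) x"
    proof -
      have "(A \<inter> B) \<union> (B - A) = B" "(A \<inter> B) \<inter> (B - A) = {}" by blast+
      then show ?thesis using spectral_projection_Un[of "A \<inter> B" "B - A" x] A B by simp
    qed
    moreover have "?P (A - B) (?P B x) = 0" by (rule zero) (use A B in auto)
    moreover have "?P (A \<inter> B) (?P (B - A) x) = 0" by (rule zero) (use A B in auto)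
    moreover have "?P (A \<inter> B) (?P (A \<inter> B) x) = ?P (A \<inter> B) x"
      by (rule orthogonal_projection_idem[OF proj]) (use A B in auto)
    moreover have "?P (A \<inter> B) (u + v) = ?P (A \<inter> B) u + ?P (A \<inter> B) v" for u v
      by (rule bounded_clinear_add[OF orthogonal_projection_clinear[OF proj]]) (use A B in auto)
    ultimately show "?P (A \<inter> B) x = (?P A \<circ> ?P B) x" by simp
  qed
  show "(\<lambda>n. spectral_projection (B n) x) sums spectral_projection (\<Union>n. B n) x"
    if B: "range B \<subseteq> sets borel" "disjoint_family B" for B x
  proof -
    have Bn: "B n \<in> sets borel" for n using B(1) by auto
    obtain Q where "represents (\<Union>n. B n) Q" "\<And>x. (\<lambda>n. spectral_projection (B n) x) sums Q x"
      using represents_Union[OF Bn B(2) spectral_projection[OF Bn]] by blast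
    then show ?thesis using spectral_projection_eqI[of "\<Union>n. B n" Q] Bn by auto
  qed
qed

end

section \<open>Bounded Borel functional calculus of a projection-valued measure\<close>

definition bounded_borel :: "(real \<Rightarrow> complex) \<Rightarrow> bool" where
  "bounded_borel f \<longleftrightarrow> f \<in> borel_measurable borel \<and> bounded (range f)"

lemma bounded_borelI: "f \<in> borel_measurable borel \<Longrightarrow> (\<And>t. cmod (f t) \<le> k) \<Longrightarrow> bounded_borel f"
  unfolding bounded_borel_def bounded_iff by auto

lemma bounded_borel_bound:
  assumes "bounded_borel f"
  obtains k where "k > 0" "\<And>t. cmod (f t) \<le> k"
  using assms unfolding bounded_borel_def bounded_pos by auto

lemma bounded_borel_add: "bounded_borel f \<Longrightarrow> bounded_borel g \<Longrightarrow> bounded_borel (\<lambda>t. f t + g t)"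
  unfolding bounded_borel_def by (auto intro: bounded_plus_comp)

lemma bounded_borel_mult:
  assumes f: "bounded_borel f" and g: "bounded_borel g"
  shows "bounded_borel (\<lambda>t. f t * g t)"
proof -
  obtain k where k: "k > 0" "\<And>t. cmod (f t) \<le> k" using bounded_borel_bound[OF f] by blast
  obtain l where l: "l > 0" "\<And>t. cmod (g t) \<le> l" using bounded_borel_bound[OF g] by blast
  have "cmod (f t * g t) \<le> k * l" for t
    using k l unfolding norm_mult by (intro mult_mono) (auto intro: less_imp_le)
  then show ?thesis using f g by (intro bounded_borelI) (auto simp: bounded_borel_def)
qed

lemma bounded_borel_const: "bounded_borel (\<lambda>t. c)"
  by (rule bounded_borelI[of _ "cmod c"]) auto

lemma bounded_borel_cnj:
  assumes "bounded_borel f"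
  shows "bounded_borel (\<lambda>t. cnj (f t))"
proof -
  obtain k where k: "k > 0" "\<And>t. cmod (f t) \<le> k" using bounded_borel_bound[OF assms] by blast
  have "(\<lambda>t. cnj (f t)) \<in> borel_measurable borel"
    using assms by (intro borel_measurable_continuous_on[OF continuous_on_cnj[OF continuous_on_id]])
      (simp add: bounded_borel_def)
  then show ?thesis using k by (intro bounded_borelI) auto
qed

lemma bounded_borel_indicator: "B \<in> sets borel \<Longrightarrow> bounded_borel (\<lambda>t. complex_of_real (indicator B t))"
  by (rule bounded_borelI[of _ 1]) (auto simp: indicator_def)

text \<open>
  Every bounded Borel function is a uniform limit of finite combinations of indicator functions,
  obtained by rounding its real and imaginary parts to multiples of \<open>1/(n+1)\<close>.
\<close>

lemma bounded_borel_induct [consumes 1, case_names indicator add scale limit]: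
  assumes f: "bounded_borel f"
    and ind: "\<And>B. B \<in> sets borel \<Longrightarrow> P (\<lambda>t. complex_of_real (indicator B t))"
    and add: "\<And>f g. P f \<Longrightarrow> P g \<Longrightarrow> P (\<lambda>t. f t + g t)"
    and scale: "\<And>c f. P f \<Longrightarrow> P (\<lambda>t. c * f t)"
    and limit: "\<And>f g. (\<And>n. P (f n)) \<Longrightarrow> bounded_borel g
      \<Longrightarrow> (\<And>n t. cmod (f n t - g t) \<le> 1 / real (Suc n)) \<Longrightarrow> P g"
  shows "P f"
proof -
  have sum: "P (\<lambda>t. \<Sum>k\<in>I. h k t)" if "finite I" "\<And>k. k \<in> I \<Longrightarrow> P (h k)" for I :: "int set" and h
    using that
  proof (induction I rule: finite_induct)
    case empty
    show ?case using ind[of "{}"] by simp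
  qed (simp add: add)
  have real: "P (\<lambda>t. complex_of_real (g t))"
    if g: "g \<in> borel_measurable borel" and M: "\<And>t. \<bar>g t\<bar> \<le> M" for g :: "real \<Rightarrow> real" and M
  proof (rule limit)
    fix n :: nat
    let ?d = "real (Suc n)"
    define level where "level k = {t. \<lfloor>?d * g t\<rfloor> = k}" for k
    define K where "K = \<lceil>?d * M\<rceil> + 1"
    let ?s = "\<lambda>t. \<Sum>k\<in>{-K..K}. complex_of_real (of_int k / ?d) * of_real (indicator (level k) t)"
    have level: "level k \<in> sets borel" for k
    proof -
      have "level k = (\<lambda>t. ?d * g t) -` {of_int k ..< of_int k + 1} \<inter> space borel"
        by (auto simp: level_def floor_eq_iff)
      also have "\<dots> \<in> sets borel"
        by (rule measurable_sets[of _ _ borel]) (use g in auto)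
      finally show ?thesis .
    qed
    show "P ?s" by (intro sum scale ind level) auto
    show "cmod (?s t - complex_of_real (g t)) \<le> 1 / ?d" for t
    proof -
      let ?k = "\<lfloor>?d * g t\<rfloor>"
      have "\<bar>?d * g t\<bar> \<le> ?d * M" unfolding abs_mult by (simp add: M mult_left_mono)
      then have "?d * g t \<le> of_int \<lceil>?d * M\<rceil>" "- of_int \<lceil>?d * M\<rceil> \<le> ?d * g t"
        using le_of_int_ceiling[of "?d * M"] by linarith+
      then have "?k \<in> {-K..K}" unfolding K_def by (auto simp: floor_le_iff le_floor_iff)
      then have "?s t = complex_of_real (of_int ?k / ?d)"
        by (subst sum.remove[of _ ?k]) (auto simp: level_def indicator_def intro!: sum.neutral)
      then have "cmod (?s t - complex_of_real (g t)) = \<bar>of_int ?k / ?d - g t\<bar>"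
        by (metis norm_of_real of_real_diff)
      also have "\<dots> = \<bar>of_int ?k - ?d * g t\<bar> / ?d"
        by (simp add: field_simps abs_divide flip: abs_mult)
      also have "\<dots> \<le> 1 / ?d"
        by (intro divide_right_mono) (auto simp: abs_le_iff, linarith+)
      finally show ?thesis .
    qed
  next
    show "bounded_borel (\<lambda>t. complex_of_real (g t))"
      using g M by (intro bounded_borelI[of _ M]) auto
  qed
  obtain k where k: "k > 0" "\<And>t. cmod (f t) \<le> k" using bounded_borel_bound[OF f] by blast
  have "P (\<lambda>t. complex_of_real (Re (f t)) + \<i> * complex_of_real (Im (f t)))"
    by (intro add scale real[of _ k])
      (use f in \<open>auto simp: bounded_borel_def intro: order_trans[OF abs_Re_le_cmod k(2)]
        order_trans[OF abs_Im_le_cmod k(2)]\<close>)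
  then show ?thesis by (simp flip: complex_eq)
qed

locale spectral_resolution =
  fixes E :: "real set \<Rightarrow> 'h::chilbert_space \<Rightarrow> 'h"
  assumes pvm: "projection_valued_measure E"
begin

lemma E_proj: "B \<in> sets borel \<Longrightarrow> orthogonal_projection (E B)"
  using pvm by (simp add: projection_valued_measure_def)

lemma E_clinear: "B \<in> sets borel \<Longrightarrow> bounded_clinear (E B)"
  by (rule orthogonal_projection_clinear[OF E_proj])

lemma E_UNIV: "E UNIV x = x"
  using pvm by (simp add: projection_valued_measure_def)

lemma E_Int: "A \<in> sets borel \<Longrightarrow> B \<in> sets borel \<Longrightarrow> E A (E B x) = E (A \<inter> B) x"
  using pvm by (simp add: projection_valued_measure_def)

lemma E_sums:
  "range B \<subseteq> sets borel \<Longrightarrow> disjoint_family B \<Longrightarrow> (\<lambda>n::nat. E (B n) x) sums E (\<Union>n. B n) x"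
  using pvm by (simp add: projection_valued_measure_def)

lemma E_form: "B \<in> sets borel \<Longrightarrow> Re (cinner (E B x) x) = (norm (E B x))\<^sup>2"
  by (simp add: orthogonal_projection_cinner[OF E_proj])

abbreviation \<mu> :: "'h \<Rightarrow> real measure" where "\<mu> \<equiv> scalar_spectral_measure E"

lemma sets_\<mu> [simp, measurable_cong]: "sets (\<mu> x) = sets borel"
  and space_\<mu> [simp]: "space (\<mu> x) = UNIV"
  using sets.sigma_sets_eq[of borel]
  by (simp_all add: scalar_spectral_measure_def sets_measure_of_conv space_measure_of_conv)

lemma E_empty: "E {} x = 0"
proof -
  have "(\<lambda>n::nat. E {} x) sums E {} x"
    using E_sums[of "\<lambda>_. {}" x] by (simp add: disjoint_family_on_def)
  then have "(\<lambda>n::nat. E {} x) \<longlonglongrightarrow> 0" by (intro summable_LIMSEQ_zero sums_summable)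
  then show ?thesis by (simp add: LIMSEQ_const_iff)
qed

lemma emeasure_\<mu>:
  assumes "B \<in> sets borel"
  shows "emeasure (\<mu> x) B = ennreal ((norm (E B x))\<^sup>2)"
proof -
  let ?f = "\<lambda>B. ennreal (Re (cinner (E B x) x))"
  have "emeasure (\<mu> x) B = ?f B"
  proof (rule emeasure_measure_of[OF scalar_spectral_measure_def])
    show "positive (sets (\<mu> x)) ?f" by (simp add: positive_def E_empty)
    show "countably_additive (sets (\<mu> x)) ?f"
    proof (rule countably_additiveI)
      fix A :: "nat \<Rightarrow> real set"
      assume A: "range A \<subseteq> sets (\<mu> x)" "disjoint_family A"
      have "(\<lambda>n. Re (cinner (E (A n) x) x)) sums Re (cinner (E (\<Union>n. A n) x) x)"
        using A by (intro sums_Re bounded_linear.sums[OF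
              bounded_bilinear.bounded_linear_left[OF bounded_bilinear_cinner] E_sums]) auto
      moreover have "0 \<le> Re (cinner (E (A n) x) x)" for n
        using A by (subst E_form) auto
      ultimately show "(\<Sum>n. ?f (A n)) = ?f (\<Union>n. A n)" by (intro suminf_ennreal_eq)
    qed
  qed (use assms sets.space_closed[of borel] in auto)
  then show ?thesis using assms by (simp add: E_form)
qed

lemma finite_\<mu>: "finite_measure (\<mu> x)"
  by (rule finite_measureI) (simp add: emeasure_\<mu>)

lemma measure_\<mu>: "B \<in> sets borel \<Longrightarrow> measure (\<mu> x) B = (norm (E B x))\<^sup>2"
  by (simp add: measure_def emeasure_\<mu>)

lemma \<mu>_restrict:
  assumes B: "B \<in> sets borel"
  shows "\<mu> (E B x) = density (\<mu> x) (\<lambda>t. ennreal (indicator B t))"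
proof (rule measure_eqI)
  fix A assume "A \<in> sets (\<mu> (E B x))"
  then have A: "A \<in> sets borel" by simp
  have "emeasure (density (\<mu> x) (\<lambda>t. ennreal (indicator B t))) A
      = (\<integral>\<^sup>+t. indicator (B \<inter> A) t \<partial>\<mu> x)"
    using A B by (subst emeasure_density)
      (auto intro!: nn_integral_cong simp: indicator_def simp del: nn_integral_indicator)
  also have "\<dots> = ennreal ((norm (E (A \<inter> B) x))\<^sup>2)"
    using A B by (simp add: emeasure_\<mu> Int_commute)
  finally show "emeasure (\<mu> (E B x)) A = emeasure (density (\<mu> x) (\<lambda>t. ennreal (indicator B t))) A"
    using A B by (simp add: emeasure_\<mu> E_Int)
qed simp

lemma integrable_restrict:
  fixes f :: "real \<Rightarrow> 'b::{banach, second_countable_topology}"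
  assumes "B \<in> sets borel" "f \<in> borel_measurable borel"
  shows "integrable (\<mu> (E B x)) f \<longleftrightarrow> integrable (\<mu> x) (\<lambda>t. indicator B t *\<^sub>R f t)"
  unfolding \<mu>_restrict[OF assms(1)] using assms by (intro integrable_density) auto

lemma integral_restrict:
  fixes f :: "real \<Rightarrow> 'b::{banach, second_countable_topology}"
  assumes "B \<in> sets borel" "f \<in> borel_measurable borel"
  shows "(LINT t|\<mu> (E B x). f t) = (LINT t|\<mu> x. indicator B t *\<^sub>R f t)"
  unfolding \<mu>_restrict[OF assms(1)] using assms by (intro integral_density) auto

lemma bounded_borel_integrable:
  assumes "bounded_borel f"
  shows "integrable (\<mu> x) f"
proof -
  interpret finite_measure "\<mu> x" by (rule finite_\<mu>)
  obtain k where "\<And>t. cmod (f t) \<le> k" using bounded_borel_bound[OF assms] by blast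
  then show ?thesis
    using assms by (intro integrable_const_bound[of _ k]) (auto simp: bounded_borel_def)
qed

text \<open>
  The operator \<open>T = \<integral> f dE\<close> of a bounded Borel function is characterized by its quadratic form. This
  form is additive in \<open>f\<close> by definition; multiplicativity and the behaviour of adjoints are inherited
  from the projections \<open>E(B)\<close> through linear combinations and uniform limits.
\<close>

definition calculus :: "(real \<Rightarrow> complex) \<Rightarrow> ('h \<Rightarrow> 'h) \<Rightarrow> bool" where
  "calculus f T \<longleftrightarrow> bounded_borel f \<and> bounded_clinear T
     \<and> (\<forall>x. cinner (T x) x = (LINT t|\<mu> x. f t))"

lemma calculus_borel: "calculus f T \<Longrightarrow> bounded_borel f"
  and calculus_clinear: "calculus f T \<Longrightarrow> bounded_clinear T"
  and calculus_form: "calculus f T \<Longrightarrow> cinner (T x) x = (LINT t|\<mu> x. f t)"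
  by (simp_all add: calculus_def)

lemma calculus_unique: "calculus f T \<Longrightarrow> calculus f T' \<Longrightarrow> T = T'"
  by (rule bounded_clinear_eqI) (simp_all add: calculus_def)

lemma calculus_indicator:
  assumes B: "B \<in> sets borel"
  shows "calculus (\<lambda>t. of_real (indicator B t)) (E B)"
proof -
  have "(LINT t|\<mu> x. complex_of_real (indicator B t)) = of_real ((norm (E B x))\<^sup>2)" for x
    using B by (simp add: measure_\<mu> del: of_real_power)
  then show ?thesis
    using B by (simp add: calculus_def bounded_borel_indicator E_clinear
        orthogonal_projection_cinner[OF E_proj])
qed

lemma calculus_add:
  "calculus f T \<Longrightarrow> calculus g S \<Longrightarrow> calculus (\<lambda>t. f t + g t) (\<lambda>x. T x + S x)"
  by (simp add: calculus_def bounded_borel_add bounded_clinear_plus cinner_add_left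
      Bochner_Integration.integral_add bounded_borel_integrable)

lemma calculus_scale: "calculus f T \<Longrightarrow> calculus (\<lambda>t. c * f t) (\<lambda>x. c *\<^sub>C T x)"
  by (simp add: calculus_def bounded_borel_mult bounded_borel_const bounded_clinear_mult
      cinner_scaleC_left)

lemma calculus_sum:
  assumes "finite I" "\<And>i. i \<in> I \<Longrightarrow> calculus (f i) (T i)"
  shows "calculus (\<lambda>t. \<Sum>i\<in>I. f i t) (\<lambda>x. \<Sum>i\<in>I. T i x)"
  using assms
proof (induction I rule: finite_induct)
  case empty
  show ?case
    by (simp add: calculus_def bounded_borel_const bounded_clinear_0)
qed (simp add: calculus_add)

text \<open>The factor 2 stems from polarization; it is harmless in the limit arguments.\<close>

lemma calculus_norm_le:
  assumes T: "calculus f T" and k: "\<And>t. cmod (f t) \<le> k"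
  shows "norm (T x) \<le> 2 * k * norm x"
proof -
  note Tc = calculus_clinear[OF T]
  have form: "cmod (cinner (T y) y) \<le> k * (norm y)\<^sup>2" for y
  proof -
    interpret finite_measure "\<mu> y" by (rule finite_\<mu>)
    have "cmod (LINT t|\<mu> y. f t) \<le> (LINT t|\<mu> y. cmod (f t))"
      by (rule integral_norm_bound)
    also have "\<dots> \<le> (LINT t|\<mu> y. k)"
      by (rule integral_mono) (auto intro: k integrable_norm bounded_borel_integrable calculus_borel[OF T])
    also have "\<dots> = k * (norm y)\<^sup>2" by (simp add: measure_\<mu> E_UNIV)
    finally show ?thesis by (simp add: calculus_form[OF T])
  qed
  have "cmod (cinner (T x) (T x)) \<le> 2 * k * norm x * norm (T x)"
    by (rule polarization_bound[of UNIV _ k])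
      (auto simp: csubspace_def bounded_clinear_add[OF Tc] bounded_clinear_scaleC[OF Tc] form)
  then have "norm (T x) * norm (T x) \<le> (2 * k * norm x) * norm (T x)"
    by (simp add: cinner_self norm_mult power2_eq_square)
  moreover have "0 \<le> k" using k[of 0] norm_ge_zero order_trans by blast
  ultimately show ?thesis by (cases "T x = 0") auto
qed

lemma calculus_diff:
  assumes "calculus f T" "calculus g S"
  shows "calculus (\<lambda>t. f t - g t) (\<lambda>x. T x - S x)"
  using calculus_add[OF assms(1) calculus_scale[OF assms(2), of "-1"]] by (simp add: scaleC_minus1)

lemma calculus_limit:
  assumes f: "\<And>n. calculus (f n) (T n)" and g: "bounded_borel g"
    and le: "\<And>n t. cmod (f n t - g t) \<le> e n" and e: "e \<longlonglongrightarrow> 0"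
    and T: "bounded_clinear S" "\<And>x. (\<lambda>n. T n x) \<longlonglongrightarrow> S x"
  shows "calculus g S"
  unfolding calculus_def
proof (intro conjI allI g T(1))
  fix x
  interpret finite_measure "\<mu> x" by (rule finite_\<mu>)
  show "cinner (S x) x = (LINT t|\<mu> x. g t)"
  proof (rule LIMSEQ_unique)
    show "(\<lambda>n. cinner (T n x) x) \<longlonglongrightarrow> cinner (S x) x" by (intro tendsto_intros T)
    note int = bounded_borel_integrable[OF calculus_borel[OF f]] bounded_borel_integrable[OF g]
    have d: "cmod ((LINT t|\<mu> x. f n t) - (LINT t|\<mu> x. g t)) \<le> e n * (norm x)\<^sup>2" for n
    proof -
      have "(LINT t|\<mu> x. f n t) - (LINT t|\<mu> x. g t) = (LINT t|\<mu> x. f n t - g t)"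
        using int by simp
      then have "cmod ((LINT t|\<mu> x. f n t) - (LINT t|\<mu> x. g t)) \<le> (LINT t|\<mu> x. cmod (f n t - g t))"
        by (simp add: integral_norm_bound)
      also have "\<dots> \<le> (LINT t|\<mu> x. e n)"
        by (rule integral_mono) (auto intro!: le integrable_norm Bochner_Integration.integrable_diff int)
      finally show ?thesis by (simp add: measure_\<mu> E_UNIV mult.commute)
    qed
    have "(\<lambda>n. (LINT t|\<mu> x. f n t) - (LINT t|\<mu> x. g t)) \<longlonglongrightarrow> 0"
      by (rule Lim_null_comparison[OF always_eventually[OF allI[OF d]] tendsto_mult_left_zero[OF e]])
    then show "(\<lambda>n. cinner (T n x) x) \<longlonglongrightarrow> (LINT t|\<mu> x. g t)"
      by (simp add: LIM_zero_iff calculus_form[OF f])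
  qed
qed

lemma calculus_uniform_limit:
  assumes f: "\<And>n. calculus (f n) (T n)" and g: "bounded_borel g"
    and le: "\<And>n t. cmod (f n t - g t) \<le> 1 / real (Suc n)"
  obtains S where "calculus g S" "\<And>x. (\<lambda>n. T n x) \<longlonglongrightarrow> S x"
proof -
  note Tc = calculus_clinear[OF f]
  have e: "(\<lambda>n. 1 / real (Suc n)) \<longlonglongrightarrow> 0"
    using LIMSEQ_inverse_real_of_nat by (simp add: inverse_eq_divide)
  have diff: "norm (T n x - T m x) \<le> 2 * (1 / real (Suc n) + 1 / real (Suc m)) * norm x" for m n x
  proof (rule calculus_norm_le[OF calculus_diff[OF f f]])
    show "cmod (f n t - f m t) \<le> 1 / real (Suc n) + 1 / real (Suc m)" for t
      using norm_triangle_ineq4[of "f n t - g t" "f m t - g t"] le[of n t] le[of m t] by simp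
  qed
  have conv: "convergent (\<lambda>n. T n x)" for x
  proof -
    have "Cauchy (\<lambda>n. T n x)"
    proof (rule CauchyI')
      fix d :: real assume d: "d > 0"
      have "(\<lambda>n. (4 * norm x) * (1 / real (Suc n))) \<longlonglongrightarrow> 0" by (rule tendsto_mult_right_zero[OF e])
      from order_tendstoD(2)[OF this d] obtain M where
        M: "\<And>n. n \<ge> M \<Longrightarrow> (4 * norm x) * (1 / real (Suc n)) < d"
        unfolding eventually_sequentially by blast
      have "dist (T m x) (T n x) < d" if "m \<ge> M" "n > m" for m n
      proof -
        have "2 * (2 * (p + q) * c) = (4 * c) * p + (4 * c) * q" for p q c :: real
          by (simp add: algebra_simps)
        then have "2 * norm (T m x - T n x)
            \<le> (4 * norm x) * (1 / real (Suc m)) + (4 * norm x) * (1 / real (Suc n))"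
          using diff[of m x n] by (metis mult_le_cancel_left_pos zero_less_numeral)
        moreover have "m \<ge> M" "n \<ge> M" using that by simp_all
        ultimately have "2 * norm (T m x - T n x) < 2 * d" using M[of m] M[of n] by linarith
        then show ?thesis by (simp add: dist_norm)
      qed
      then show "\<exists>M. \<forall>m\<ge>M. \<forall>n>m. dist (T m x) (T n x) < d" by blast
    qed
    then show ?thesis by (rule Cauchy_convergent)
  qed
  define S where "S x = lim (\<lambda>n. T n x)" for x
  have lim: "(\<lambda>n. T n x) \<longlonglongrightarrow> S x" for x
    using conv[of x] by (simp add: S_def convergent_LIMSEQ_iff)
  obtain k where k: "\<And>t. cmod (g t) \<le> k" using bounded_borel_bound[OF g] by blast
  have S: "bounded_clinear S"
  proof (rule bounded_clinear_limit[OF Tc sequentially_bot lim])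
    have "norm (T n x) \<le> 2 * (1 + k) * norm x" for n x
    proof (rule calculus_norm_le[OF f])
      fix t
      have "1 / real (Suc n) \<le> 1" by simp
      then show "cmod (f n t) \<le> 1 + k"
        using norm_triangle_ineq[of "f n t - g t" "g t"] le[of n t] k[of t]
        unfolding diff_add_cancel by linarith
    qed
    then show "\<forall>\<^sub>F n in sequentially. norm (T n x) \<le> 2 * (1 + k) * norm x" for x
      by (intro always_eventually allI)
  qed
  have "calculus g S" by (rule calculus_limit[OF f g le e S lim])
  then show thesis using lim by (rule that)
qed

text \<open>
  The induction for \<open>calculus_mult\<close> runs over the second factor and starts from an indicator function;
  this initial case is itself an induction over the first factor.
\<close>

lemma calculus_mult_indicator:
  assumes f: "bounded_borel f" and B: "B \<in> sets borel"
  shows "\<exists>T. calculus f T \<and> calculus (\<lambda>t. f t * of_real (indicator B t)) (\<lambda>x. T (E B x))"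
  using f
proof (induction f rule: bounded_borel_induct)
  case (indicator A)
  have "calculus (\<lambda>t. of_real (indicator (A \<inter> B) t)) (E (A \<inter> B))"
    using indicator B by (intro calculus_indicator) auto
  moreover have "E (A \<inter> B) = (\<lambda>x. E A (E B x))" using indicator B by (simp add: E_Int)
  ultimately show ?case
    using calculus_indicator[OF indicator] by (auto simp: indicator_inter_arith)
next
  case (add f g)
  then obtain T S where "calculus f T" "calculus (\<lambda>t. f t * of_real (indicator B t)) (\<lambda>x. T (E B x))"
    "calculus g S" "calculus (\<lambda>t. g t * of_real (indicator B t)) (\<lambda>x. S (E B x))" by blast
  then show ?case
    using calculus_add by (intro exI[of _ "\<lambda>x. T x + S x"]) (simp add: distrib_right)
next
  case (scale c f)
  then obtain T where "calculus f T" "calculus (\<lambda>t. f t * of_real (indicator B t)) (\<lambda>x. T (E B x))"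
    by blast
  then show ?case
    using calculus_scale by (intro exI[of _ "\<lambda>x. c *\<^sub>C T x"]) (simp add: mult.assoc)
next
  case (limit f g)
  from limit(1) obtain T where T: "\<And>n. calculus (f n) (T n)"
    "\<And>n. calculus (\<lambda>t. f n t * of_real (indicator B t)) (\<lambda>x. T n (E B x))" by metis
  obtain S where S: "calculus g S" "\<And>x. (\<lambda>n. T n x) \<longlonglongrightarrow> S x"
    using calculus_uniform_limit[OF T(1) limit(2,3)] by blast
  have "calculus (\<lambda>t. g t * of_real (indicator B t)) (\<lambda>x. S (E B x))"
  proof (rule calculus_limit[OF T(2)])
    show "bounded_borel (\<lambda>t. g t * of_real (indicator B t))"
      by (intro bounded_borel_mult limit bounded_borel_indicator B)
    show "cmod (f n t * of_real (indicator B t) - g t * of_real (indicator B t)) \<le> 1 / real (Suc n)" for n t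
      using limit(3)[of n t] by (auto simp: indicator_def)
    show "(\<lambda>n. 1 / real (Suc n)) \<longlonglongrightarrow> 0"
      using LIMSEQ_inverse_real_of_nat by (simp add: inverse_eq_divide)
    show "bounded_clinear (\<lambda>x. S (E B x))"
      by (rule bounded_clinear_comp[OF calculus_clinear[OF S(1)] E_clinear[OF B]])
  qed (rule S(2))
  with S(1) show ?case by blast
qed

lemma calculus_exists: "bounded_borel f \<Longrightarrow> \<exists>T. calculus f T"
  using calculus_mult_indicator[of f UNIV] by auto

lemma calculus_mult:
  assumes T: "calculus f T" and S: "calculus g S"
  shows "calculus (\<lambda>t. f t * g t) (\<lambda>x. T (S x))"
proof -
  have "\<exists>S. calculus g S \<and> calculus (\<lambda>t. f t * g t) (\<lambda>x. T (S x))"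
    using calculus_borel[OF S]
  proof (induction g rule: bounded_borel_induct)
    case (indicator B)
    then show ?case
      using calculus_mult_indicator[OF calculus_borel[OF T] indicator] calculus_unique[OF T]
        calculus_indicator by blast
  next
    case (add g h)
    then obtain S S' where "calculus g S" "calculus (\<lambda>t. f t * g t) (\<lambda>x. T (S x))"
      "calculus h S'" "calculus (\<lambda>t. f t * h t) (\<lambda>x. T (S' x))" by blast
    then show ?case
      using calculus_add[of "\<lambda>t. f t * g t" "\<lambda>x. T (S x)" "\<lambda>t. f t * h t" "\<lambda>x. T (S' x)"]
      by (intro exI[of _ "\<lambda>x. S x + S' x"])
        (simp add: calculus_add distrib_left bounded_clinear_add[OF calculus_clinear[OF T]])
  next
    case (scale c g)
    then obtain S where "calculus g S" "calculus (\<lambda>t. f t * g t) (\<lambda>x. T (S x))" by blast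
    then show ?case
      using calculus_scale[of "\<lambda>t. f t * g t" "\<lambda>x. T (S x)" c]
      by (intro exI[of _ "\<lambda>x. c *\<^sub>C S x"])
        (simp add: calculus_scale mult.left_commute bounded_clinear_scaleC[OF calculus_clinear[OF T]])
  next
    case (limit g h)
    from limit(1) obtain S where S: "\<And>n. calculus (g n) (S n)"
      "\<And>n. calculus (\<lambda>t. f t * g n t) (\<lambda>x. T (S n x))" by metis
    obtain S' where S': "calculus h S'" "\<And>x. (\<lambda>n. S n x) \<longlonglongrightarrow> S' x"
      using calculus_uniform_limit[OF S(1) limit(2,3)] by blast
    obtain k where k: "k > 0" "\<And>t. cmod (f t) \<le> k" using bounded_borel_bound[OF calculus_borel[OF T]] by blast
    have "calculus (\<lambda>t. f t * h t) (\<lambda>x. T (S' x))"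
    proof (rule calculus_limit[OF S(2)])
      show "bounded_borel (\<lambda>t. f t * h t)"
        by (intro bounded_borel_mult limit calculus_borel[OF T])
      show "cmod (f t * g n t - f t * h t) \<le> k * (1 / real (Suc n))" for n t
      proof -
        have "cmod (f t * g n t - f t * h t) = cmod (f t) * cmod (g n t - h t)"
          by (simp add: right_diff_distrib[symmetric] norm_mult)
        also have "\<dots> \<le> k * (1 / real (Suc n))"
          using k by (intro mult_mono limit(3)) auto
        finally show ?thesis .
      qed
      show "(\<lambda>n. k * (1 / real (Suc n))) \<longlonglongrightarrow> 0"
        using LIMSEQ_inverse_real_of_nat
        by (intro tendsto_mult_right_zero) (simp add: inverse_eq_divide)
      show "bounded_clinear (\<lambda>x. T (S' x))"
        by (rule bounded_clinear_comp[OF calculus_clinear[OF T] calculus_clinear[OF S'(1)]])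
      show "(\<lambda>n. T (S n x)) \<longlonglongrightarrow> T (S' x)" for x
        by (rule bounded_clinear_tendsto[OF calculus_clinear[OF T] S'(2)])
    qed
    with S'(1) show ?case by blast
  qed
  then show ?thesis using calculus_unique[OF S] by blast
qed

lemma calculus_commute:
  assumes T: "calculus f T" and S: "calculus g S"
  shows "T (S x) = S (T x)"
proof -
  have "calculus (\<lambda>t. f t * g t) (\<lambda>x. S (T x))"
    using calculus_mult[OF S T] by (simp add: mult.commute)
  from calculus_unique[OF calculus_mult[OF T S] this] show ?thesis by meson
qed

lemma calculus_adjoint_exists:
  assumes "bounded_borel f"
  shows "\<exists>T S. calculus f T \<and> calculus (\<lambda>t. cnj (f t)) S \<and> (\<forall>x y. cinner (T x) y = cinner x (S y))"
  using assms
proof (induction f rule: bounded_borel_induct)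
  case (indicator B)
  show ?case
    using calculus_indicator[OF indicator] orthogonal_projection_adj[OF E_proj[OF indicator]]
    by (intro exI[of _ "E B"]) simp
next
  case (add f g)
  then obtain T S T' S' where "calculus f T" "calculus (\<lambda>t. cnj (f t)) S"
    "\<And>x y. cinner (T x) y = cinner x (S y)" "calculus g T'" "calculus (\<lambda>t. cnj (g t)) S'"
    "\<And>x y. cinner (T' x) y = cinner x (S' y)" by blast
  then show ?case
    by (intro exI[of _ "\<lambda>x. T x + T' x"] exI[of _ "\<lambda>x. S x + S' x"])
      (simp add: calculus_add cinner_add_left cinner_add_right)
next
  case (scale c f)
  then obtain T S where "calculus f T" "calculus (\<lambda>t. cnj (f t)) S"
    "\<And>x y. cinner (T x) y = cinner x (S y)" by blast
  then show ?case
    by (intro exI[of _ "\<lambda>x. c *\<^sub>C T x"] exI[of _ "\<lambda>x. cnj c *\<^sub>C S x"])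
      (simp add: calculus_scale cinner_scaleC_left cinner_scaleC_right)
next
  case (limit f g)
  from limit(1) obtain T S where T: "\<And>n. calculus (f n) (T n)"
    and S: "\<And>n. calculus (\<lambda>t. cnj (f n t)) (S n)"
    and adj: "\<And>n x y. cinner (T n x) y = cinner x (S n y)" by metis
  obtain T' where T': "calculus g T'" "\<And>x. (\<lambda>n. T n x) \<longlonglongrightarrow> T' x"
    using calculus_uniform_limit[OF T limit(2,3)] by blast
  have le: "cmod (cnj (f n t) - cnj (g t)) \<le> 1 / real (Suc n)" for n t
    using limit(3)[of n t] by (metis complex_cnj_diff complex_mod_cnj)
  obtain S' where S': "calculus (\<lambda>t. cnj (g t)) S'" "\<And>x. (\<lambda>n. S n x) \<longlonglongrightarrow> S' x"
    using calculus_uniform_limit[OF S bounded_borel_cnj[OF limit(2)] le] by blast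
  have "cinner (T' x) y = cinner x (S' y)" for x y
  proof (rule LIMSEQ_unique)
    show "(\<lambda>n. cinner (T n x) y) \<longlonglongrightarrow> cinner (T' x) y" by (intro tendsto_intros T')
    show "(\<lambda>n. cinner (T n x) y) \<longlonglongrightarrow> cinner x (S' y)"
      unfolding adj by (intro tendsto_intros S')
  qed
  with T'(1) S'(1) show ?case by blast
qed

lemma calculus_adjoint:
  assumes T: "calculus f T" and S: "calculus (\<lambda>t. cnj (f t)) S"
  shows "cinner (T x) y = cinner x (S y)"
  using calculus_adjoint_exists[OF calculus_borel[OF T]] calculus_unique[OF T] calculus_unique[OF S]
  by metis

text \<open>This is \<open>\<parallel>Tx\<parallel>\<^sup>2 = \<langle>T\<^sup>*Tx, x\<rangle>\<close>, where \<open>T\<^sup>*T\<close> belongs to \<open>\<bar>f\<bar>\<^sup>2\<close>.\<close>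

lemma calculus_norm_sq:
  assumes T: "calculus f T"
  shows "(norm (T x))\<^sup>2 = (LINT t|\<mu> x. (cmod (f t))\<^sup>2)"
proof -
  obtain S where S: "calculus (\<lambda>t. cnj (f t)) S"
    using calculus_exists[OF bounded_borel_cnj[OF calculus_borel[OF T]]] by blast
  have "complex_of_real ((norm (T x))\<^sup>2) = cinner (T x) (T x)" by (simp add: cinner_self)
  also have "\<dots> = cinner (S (T x)) x"
    using calculus_adjoint[OF T S, of x "T x"] by (metis cinner_commute calculus_adjoint[OF T S])
  also have "\<dots> = (LINT t|\<mu> x. cnj (f t) * f t)"
    by (rule calculus_form[OF calculus_mult[OF S T]])
  also have "\<dots> = (LINT t|\<mu> x. complex_of_real ((cmod (f t))\<^sup>2))"
    by (simp add: complex_norm_square mult.commute del: of_real_power)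
  also have "\<dots> = complex_of_real (LINT t|\<mu> x. (cmod (f t))\<^sup>2)"
    by (rule integral_complex_of_real)
  finally show ?thesis by (simp only: of_real_eq_iff)
qed

text \<open>
  The scalar measures are finite, so a spectral integral of a bounded function is everywhere defined;
  polarization then shows that its quadratic form determines it.
\<close>

lemma calculus_spectral_integral:
  assumes T: "calculus f T"
  shows "is_spectral_integral E f S \<longleftrightarrow> S = (\<lambda>x. Some (T x))"
proof
  note Tc = calculus_clinear[OF T]
  have int: "integrable (\<mu> x) (\<lambda>t. (cmod (f t))\<^sup>2)" for x
  proof -
    have "(\<lambda>t. complex_of_real ((cmod (f t))\<^sup>2)) = (\<lambda>t. f t * cnj (f t))"
      by (simp add: complex_norm_square del: of_real_power)
    moreover have "integrable (\<mu> x) (\<lambda>t. f t * cnj (f t))"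
      by (intro bounded_borel_integrable bounded_borel_mult bounded_borel_cnj calculus_borel[OF T])
    ultimately have "integrable (\<mu> x) (\<lambda>t. complex_of_real ((cmod (f t))\<^sup>2))" by (simp only:)
    then show ?thesis by (simp only: complex_of_real_integrable_eq)
  qed
  show "is_spectral_integral E f S" if "S = (\<lambda>x. Some (T x))"
    unfolding that is_spectral_integral_def linear_operator_def csubspace_def dom_def
    using int by (simp add: bounded_clinear_add[OF Tc] bounded_clinear_scaleC[OF Tc] calculus_form[OF T])
  show "S = (\<lambda>x. Some (T x))" if S: "is_spectral_integral E f S"
  proof
    fix x
    have dom: "dom S = UNIV" using S int by (simp add: is_spectral_integral_def)
    have "cmod (cinner (the (S x) - T x) (the (S x) - T x)) \<le> 2 * 0 * norm x * norm (the (S x) - T x)"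
    proof (rule polarization_bound[of UNIV])
      show "the (S (x + y)) - T (x + y) = the (S x) - T x + (the (S y) - T y)" for x y
        using S dom by (simp add: is_spectral_integral_def linear_operator_def bounded_clinear_add[OF Tc])
      show "the (S (c *\<^sub>C x)) - T (c *\<^sub>C x) = c *\<^sub>C (the (S x) - T x)" for c x
        using S dom
        by (simp add: is_spectral_integral_def linear_operator_def bounded_clinear_scaleC[OF Tc] scaleC_diff_right)
      show "cmod (cinner (the (S x) - T x) x) \<le> 0 * (norm x)\<^sup>2" for x
        using S dom by (simp add: is_spectral_integral_def cinner_diff_left calculus_form[OF T])
    qed (auto simp: csubspace_def)
    then have "the (S x) = T x" by (simp add: cinner_self norm_power)
    then show "S x = Some (T x)" using dom by (metis UNIV_I domD option.sel)
  qed
qed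

end

section \<open>The spectral theorem\<close>

text \<open>Half-open, so that a window is a union of the spectral intervals \<open>]n-1, n]\<close> of the blocks.\<close>

abbreviation window :: "nat \<Rightarrow> real set" where
  "window N \<equiv> {- real N <.. real N}"

text \<open>The identity function, truncated to a window.\<close>

definition cut :: "nat \<Rightarrow> real \<Rightarrow> complex" where
  "cut N t = complex_of_real (indicator (window N) t * t)"

lemma cmod_cut: "cmod (cut N t) = indicator (window N) t * \<bar>t\<bar>"
  by (simp add: cut_def norm_mult)

lemma cmod_cut_sq: "(cmod (cut N t))\<^sup>2 = indicator (window N) t * t\<^sup>2"
  by (cases "t \<in> window N") (simp_all add: cmod_cut)

lemma eventually_window: "\<forall>\<^sub>F N in sequentially. t \<in> window N"
proof -
  obtain M :: nat where "\<bar>t\<bar> < real M" using reals_Archimedean2 by blast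
  then have "t \<in> window N" if "M \<le> N" for N using that by auto
  then show ?thesis unfolding eventually_sequentially by blast
qed

lemma bounded_borel_cut: "bounded_borel (cut N)"
proof (rule bounded_borelI)
  show "cut N \<in> borel_measurable borel" unfolding cut_def[abs_def] by measurable
  show "cmod (cut N t) \<le> real N" for t by (auto simp: cmod_cut indicator_def)
qed

context spectral_resolution
begin

lemma E_Un:
  assumes A: "A \<in> sets borel" and B: "B \<in> sets borel" and disj: "A \<inter> B = {}"
  shows "E (A \<union> B) x = E A x + E B x"
proof -
  note AB = sets.Un[OF A B]
  have "E (A \<union> B) = (\<lambda>x. E A x + E B x)"
  proof (rule bounded_clinear_eqI[OF E_clinear[OF AB] bounded_clinear_plus[OF E_clinear[OF A] E_clinear[OF B]]])
    fix x
    interpret finite_measure "\<mu> x" by (rule finite_\<mu>)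
    have "measure (\<mu> x) (A \<union> B) = measure (\<mu> x) A + measure (\<mu> x) B"
      by (rule finite_measure_Union) (use A B disj in auto)
    then have "(norm (E (A \<union> B) x))\<^sup>2 = (norm (E A x))\<^sup>2 + (norm (E B x))\<^sup>2"
      by (simp only: measure_\<mu> A B AB)
    then show "cinner (E (A \<union> B) x) x = cinner (E A x + E B x) x"
      by (simp only: cinner_add_left orthogonal_projection_cinner[OF E_proj] A B AB flip: of_real_add)
  qed
  then show ?thesis by simp
qed

lemma window_tendsto: "(\<lambda>N. E (window N) x) \<longlonglongrightarrow> x"
proof -
  interpret finite_measure "\<mu> x" by (rule finite_\<mu>)
  have "(\<lambda>N. measure (\<mu> x) (window N)) \<longlonglongrightarrow> measure (\<mu> x) (\<Union>N. window N)"
    by (rule finite_Lim_measure_incseq) (auto simp: incseq_def)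
  moreover have "(\<Union>N. window N) = UNIV"
    using eventually_window eventually_happens'[OF sequentially_bot] by blast
  ultimately have "(\<lambda>N. (norm (E (window N) x))\<^sup>2) \<longlonglongrightarrow> (norm x)\<^sup>2"
    by (simp add: measure_\<mu> E_UNIV)
  then have "(\<lambda>N. (norm x)\<^sup>2 - (norm (E (window N) x))\<^sup>2) \<longlonglongrightarrow> (norm x)\<^sup>2 - (norm x)\<^sup>2"
    by (intro tendsto_diff tendsto_const)
  moreover have "(norm x)\<^sup>2 - (norm (E (window N) x))\<^sup>2 = (norm (x - E (window N) x))\<^sup>2" for N
    using orthogonal_projection_pythagoras[OF E_proj, of "window N" x] by simp
  ultimately have "(\<lambda>N. (norm (E (window N) x - x))\<^sup>2) \<longlonglongrightarrow> 0"
    by (simp add: norm_minus_commute)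
  then show ?thesis by (rule tendsto_if_norm_sq)
qed

lemma integral_window_tendsto:
  fixes f :: "real \<Rightarrow> 'b::{banach, second_countable_topology}"
  assumes f: "integrable (\<mu> x) f"
  shows "(\<lambda>N. LINT t|\<mu> x. indicator (window N) t *\<^sub>R f t) \<longlonglongrightarrow> (LINT t|\<mu> x. f t)"
proof (rule integral_dominated_convergence)
  show "f \<in> borel_measurable (\<mu> x)" using f by simp
  then show "(\<lambda>t. indicator (window N) t *\<^sub>R f t) \<in> borel_measurable (\<mu> x)" for N by simp
  show "integrable (\<mu> x) (\<lambda>t. norm (f t))" using f by simp
  show "AE t in \<mu> x. (\<lambda>N. indicator (window N) t *\<^sub>R f t) \<longlonglongrightarrow> f t"
  proof (rule AE_I2)
    fix t
    have "\<forall>\<^sub>F N in sequentially. f t = indicator (window N) t *\<^sub>R f t"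
      using eventually_window[of t] by eventually_elim simp
    then show "(\<lambda>N. indicator (window N) t *\<^sub>R f t) \<longlonglongrightarrow> f t"
      by (rule Lim_transform_eventually[OF tendsto_const])
  qed
  show "AE t in \<mu> x. norm (indicator (window N) t *\<^sub>R f t) \<le> norm (f t)" for N
    by (rule AE_I2) (simp add: indicator_def)
qed

lemma integrable_if_square:
  assumes "integrable (\<mu> x) (\<lambda>t. t\<^sup>2)"
  shows "integrable (\<mu> x) (\<lambda>t. t)"
proof -
  interpret finite_measure "\<mu> x" by (rule finite_\<mu>)
  have "integrable (\<mu> x) (\<lambda>t. 1 + t\<^sup>2)" using assms by simp
  then show ?thesis
  proof (rule Bochner_Integration.integrable_bound)
    show "AE t in \<mu> x. norm t \<le> norm (1 + t\<^sup>2)"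
    proof (rule AE_I2)
      fix t :: real
      have "0 \<le> (\<bar>t\<bar> - 1)\<^sup>2" by simp
      then show "norm t \<le> norm (1 + t\<^sup>2)" by (simp add: power2_diff)
    qed
  qed simp
qed

end

context self_adjoint_operator
begin

sublocale spectral: spectral_resolution resolution.spectral_projection
  by unfold_locales (rule resolution.projection_valued_measure_spectral_projection)

text \<open>
  A partition of the window into short intervals gives step functions that approximate the truncated
  identity uniformly. By \<open>interval_app\<close> and orthogonality, the corresponding combinations of spectral
  projections approximate the truncation of \<open>D\<close> with the same error.
\<close>

lemma calculus_window:
  defines "F \<equiv> resolution.spectral_projection"
  shows "spectral.calculus (cut N) (\<lambda>x. app (F (window N) x))"
proof -
  define h where "h n = 2 * real N / real (Suc n)" for n
  define p where "p n k = - real N + real k * h n" for n k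
  define J where "J n k = {p n k <.. p n (Suc k)}" for n k
  define m where "m n k = (p n k + p n (Suc k)) / 2" for n k
  have h: "h n \<ge> 0" for n by (simp add: h_def)
  have p_step: "p n (Suc k) = p n k + h n" for n k by (simp add: p_def algebra_simps)
  have p_mono: "p n j \<le> p n k" if "j \<le> k" for n j k
    using that h[of n] by (simp add: p_def mult_right_mono)
  have p_ends: "p n 0 = - real N" "p n (Suc n) = real N" for n
    by (simp_all add: p_def h_def)
  have J_sets: "J n k \<in> sets borel" for n k by (simp add: J_def)
  have F: "F {s<..t} = (\<lambda>x. E t x - E s x)" if "s \<le> t" for s t
    unfolding F_def by (rule resolution.spectral_projection_Ioc[OF that])
  have FJ: "F (J n k) x = E (p n (Suc k)) x - E (p n k) x" for n k x
    unfolding J_def using F p_mono[of k "Suc k" n] by simp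
  have FW: "F (window N) x = E (real N) x - E (- real N) x" for x
    using F by simp
  have sum_F: "(\<Sum>k<Suc n. F (J n k) x) = F (window N) x" for n x
    unfolding FJ FW by (subst sum_lessThan_telescope) (simp only: p_ends)
  have sum_ind: "(\<Sum>k<M. indicator (J n k) t) = (indicator {p n 0 <.. p n M} t :: real)" for n M t
  proof (induction M)
    case (Suc M)
    then show ?case using p_mono[of 0 M n] p_mono[of M "Suc M" n]
      by (auto simp: J_def indicator_def)
  qed simp
  have proj: "orthogonal_projection (F (J n k))" for n k
    unfolding F_def by (rule spectral.E_proj[OF J_sets])
  note projc = orthogonal_projection_clinear[OF proj]
  have J_app: "F (J n k) x \<in> dom D"
      "norm (app (F (J n k) x) - m n k *\<^sub>R F (J n k) x) \<le> h n * norm (F (J n k) x)" for n k x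
  proof -
    have "F (J n k) (F (J n k) x) = F (J n k) x" by (rule orthogonal_projection_idem[OF proj])
    then have "E (p n (Suc k)) (F (J n k) x) - E (p n k) (F (J n k) x) = F (J n k) x"
      by (simp only: FJ)
    from interval_app[OF p_mono[of k "Suc k" n] this] show "F (J n k) x \<in> dom D"
      "norm (app (F (J n k) x) - m n k *\<^sub>R F (J n k) x) \<le> h n * norm (F (J n k) x)"
      by (simp_all add: m_def p_step)
  qed
  have F_app: "F (J n k) (app x) = app (F (J n k) x)" if "x \<in> dom D" for n k x
    unfolding FJ using that by (simp add: app_E app_diff E_dom)
  have dom_sum: "(\<Sum>k\<in>K. v k) \<in> dom D \<and> app (\<Sum>k\<in>K. v k) = (\<Sum>k\<in>K. app (v k))"
    if "finite K" "\<And>k. v k \<in> dom D" for K :: "nat set" and v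
    using that by (induction K rule: finite_induct) (auto simp: dom_zero app_zero dom_add app_add)
  define T where "T n x = (\<Sum>k<Suc n. complex_of_real (m n k) *\<^sub>C F (J n k) x)" for n x
  have T: "spectral.calculus (\<lambda>t. \<Sum>k<Suc n. complex_of_real (m n k) * of_real (indicator (J n k) t)) (T n)" for n
    unfolding T_def[abs_def] F_def
    by (intro spectral.calculus_sum spectral.calculus_scale spectral.calculus_indicator J_sets) auto
  let ?S = "\<lambda>x. app (F (window N) x)"
  have W: "orthogonal_projection (F (window N))"
    unfolding F_def by (rule spectral.E_proj) simp
  have W_dom: "F (window N) x \<in> dom D" and W_le: "norm (?S x) \<le> 2 * real N * norm x" for x
  proof -
    have "E (real N) (F (window N) x) - E (- real N) (F (window N) x) = F (window N) x"
      using orthogonal_projection_idem[OF W, of x] by (simp only: FW)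
    from interval_app[OF _ this] show "F (window N) x \<in> dom D"
      and "norm (?S x) \<le> 2 * real N * norm x"
      using mult_left_mono[OF orthogonal_projection_norm_le[OF W, of x], of "2 * real N"] by simp_all
  qed
  have Sc: "bounded_clinear ?S"
    by (rule bounded_clinear_intro[OF _ _ W_le])
      (simp_all add: bounded_clinear_add[OF orthogonal_projection_clinear[OF W]]
        bounded_clinear_scaleC[OF orthogonal_projection_clinear[OF W]] app_add app_scaleC W_dom)
  have close: "norm (T n x - ?S x) \<le> h n * norm x" for n x
  proof -
    let ?y = "\<lambda>k. F (J n k) x"
    define z where "z k = app (?y k) - m n k *\<^sub>R ?y k" for k
    have "?S x = (\<Sum>k<Suc n. app (?y k))"
      unfolding sum_F[of n, symmetric] using dom_sum[of "{..<Suc n}" ?y] J_app(1) by blast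
    then have diff: "?S x - T n x = (\<Sum>k<Suc n. z k)"
      unfolding T_def z_def by (simp add: sum_subtractf scaleR_scaleC del: sum.lessThan_Suc)
    have Fz: "F (J n k) (z k) = z k" for k
      unfolding z_def
      by (simp add: bounded_clinear_diff[OF projc] bounded_clinear_scaleR[OF projc] F_app J_app(1)
          orthogonal_projection_idem[OF proj])
    have FF: "F (J n i) (F (J n j) y) = 0" if "i \<noteq> j" for i j y
    proof -
      have "J n i \<inter> J n j = {}"
      proof (cases "i < j")
        case True
        then show ?thesis using p_mono[of "Suc i" j n] by (auto simp: J_def)
      next
        case False
        then show ?thesis using p_mono[of "Suc j" i n] that by (auto simp: J_def)
      qed
      then show ?thesis unfolding F_def using J_sets by (simp add: spectral.E_Int spectral.E_empty)
    qed
    have orth_y: "cinner (F (J n i) u) (F (J n j) v) = 0" if "i \<noteq> j" for i j u v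
      using FF[OF that, of v] by (simp add: orthogonal_projection_adj[OF proj])
    then have orth: "cinner (z i) (z j) = 0" if "i \<noteq> j" for i j
      using that by (metis Fz)
    have "(norm (?S x - T n x))\<^sup>2 = (\<Sum>k<Suc n. (norm (z k))\<^sup>2)"
      unfolding diff by (rule norm_sq_sum_orthogonal) (use orth in auto)
    also have "\<dots> \<le> (\<Sum>k<Suc n. (h n)\<^sup>2 * (norm (?y k))\<^sup>2)"
      unfolding z_def power_mult_distrib[symmetric]
      by (intro sum_mono power_mono J_app(2)) auto
    also have "\<dots> = (h n)\<^sup>2 * (norm (F (window N) x))\<^sup>2"
      unfolding sum_F[of n, symmetric] sum_distrib_left[symmetric]
      by (subst norm_sq_sum_orthogonal) (use orth_y in auto)
    also have "\<dots> \<le> (h n)\<^sup>2 * (norm x)\<^sup>2"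
      by (intro mult_left_mono power_mono orthogonal_projection_norm_le[OF W]) auto
    finally have "(norm (T n x - ?S x))\<^sup>2 \<le> (h n * norm x)\<^sup>2"
      by (simp add: power_mult_distrib norm_minus_commute)
    then show ?thesis by (rule power2_le_imp_le) (use h in simp)
  qed
  have h0: "h \<longlonglongrightarrow> 0"
  proof -
    have "(\<lambda>n. 2 * real N * (1 / real (Suc n))) \<longlonglongrightarrow> 0"
      using LIMSEQ_inverse_real_of_nat by (intro tendsto_mult_right_zero) (simp add: inverse_eq_divide)
    then show ?thesis by (simp add: h_def[abs_def])
  qed
  show ?thesis
  proof (rule spectral.calculus_limit[OF T bounded_borel_cut _ h0 Sc])
    show "cmod ((\<Sum>k<Suc n. complex_of_real (m n k) * of_real (indicator (J n k) t)) - cut N t) \<le> h n" for n t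
    proof -
      have "(\<Sum>k<Suc n. (m n k - t) * indicator (J n k) t)
          = (\<Sum>k<Suc n. m n k * indicator (J n k) t) - t * (\<Sum>k<Suc n. indicator (J n k) t)"
        by (simp only: left_diff_distrib sum_subtractf sum_distrib_left)
      also have "\<dots> = (\<Sum>k<Suc n. m n k * indicator (J n k) t) - indicator (window N) t * t"
        unfolding sum_ind p_ends by (simp only: mult.commute)
      finally have "(\<Sum>k<Suc n. complex_of_real (m n k) * of_real (indicator (J n k) t)) - cut N t
          = complex_of_real (\<Sum>k<Suc n. (m n k - t) * indicator (J n k) t)"
        by (simp only: cut_def of_real_diff of_real_sum of_real_mult)
      then have "cmod ((\<Sum>k<Suc n. complex_of_real (m n k) * of_real (indicator (J n k) t)) - cut N t)
          = \<bar>\<Sum>k<Suc n. (m n k - t) * indicator (J n k) t\<bar>" by (simp only: norm_of_real)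
      also have "\<dots> \<le> (\<Sum>k<Suc n. \<bar>(m n k - t) * indicator (J n k) t\<bar>)" by (rule sum_abs)
      also have "\<dots> \<le> (\<Sum>k<Suc n. h n * indicator (J n k) t)"
      proof (rule sum_mono)
        fix k
        show "\<bar>(m n k - t) * indicator (J n k) t\<bar> \<le> h n * indicator (J n k) t"
          using h[of n] by (auto simp: indicator_def J_def m_def p_step abs_le_iff field_simps)
      qed
      also have "\<dots> = h n * indicator (window N) t"
        using sum_ind[where M = "Suc n" and n = n and t = t]
        by (simp only: sum_distrib_left[symmetric] p_ends)
      also have "\<dots> \<le> h n" using h[of n] by (simp add: indicator_def)
      finally show ?thesis .
    qed
    show "(\<lambda>n. T n x) \<longlonglongrightarrow> ?S x" for x
    proof (rule Lim_transform)
      show "(\<lambda>n. ?S x) \<longlonglongrightarrow> ?S x" by simp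
      show "(\<lambda>n. T n x - ?S x) \<longlonglongrightarrow> 0"
        by (rule Lim_null_comparison[OF always_eventually[OF allI[OF close]] tendsto_mult_left_zero[OF h0]])
    qed
  qed
qed

text \<open>
  On windows \<open>D\<close> is known by \<open>calculus_window\<close>. For \<open>x\<close> in the domain, monotone convergence over the windows
  gives \<open>\<integral> t\<^sup>2 d\<mu>\<^sub>x = \<parallel>Dx\<parallel>\<^sup>2\<close>; conversely, if this integral is finite, the truncations of \<open>x\<close> converge in the graph
  norm, and closedness of \<open>D\<close> puts \<open>x\<close> into the domain.
\<close>

theorem spectral_theorem: "is_spectral_integral resolution.spectral_projection complex_of_real D"
proof -
  let ?F = "\<lambda>N. resolution.spectral_projection (window N)"
  note cw = calculus_window
  have lin: "linear_operator D" using self_adjoint by (simp add: self_adjoint_def)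
  have F_dom: "?F N x \<in> dom D" for N x
  proof -
    have W: "orthogonal_projection (?F N)" by (rule spectral.E_proj) simp
    have FW: "?F N = (\<lambda>x. E (real N) x - E (- real N) x)"
      by (rule resolution.spectral_projection_Ioc) simp
    show ?thesis
      by (rule interval_app(1)[of "- real N" "real N"])
        (use orthogonal_projection_idem[OF W, of x] in \<open>simp_all add: FW\<close>)
  qed
  have F_app: "app (?F N x) = ?F N (app x)" if "x \<in> dom D" for N x
    using that resolution.spectral_projection_Ioc[of "- real N" "real N"]
    by (simp add: app_diff E_dom app_E)
  have sq: "(norm (app (?F N x)))\<^sup>2 = (LINT t|spectral.\<mu> x. indicator (window N) t * t\<^sup>2)" for N x
    using spectral.calculus_norm_sq[OF cw, of N x]
    by (simp only: cmod_cut_sq)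
  have bb: "integrable (spectral.\<mu> x) (\<lambda>t. indicator (window N) t * t\<^sup>2)" for N x
  proof -
    interpret finite_measure "spectral.\<mu> x" by (rule spectral.finite_\<mu>)
    have le: "norm (indicator (window N) t * t\<^sup>2) \<le> (real N)\<^sup>2" for t
    proof (cases "t \<in> window N")
      case True
      then have "\<bar>t\<bar> \<le> \<bar>real N\<bar>" by auto
      then have "t\<^sup>2 \<le> (real N)\<^sup>2" by (simp only: abs_le_square_iff)
      then show ?thesis using True by simp
    qed simp
    show ?thesis by (rule integrable_const_bound[of _ "(real N)\<^sup>2"]) (use le in auto)
  qed
  have to_dom: "integrable (spectral.\<mu> x) (\<lambda>t. t\<^sup>2)" if x: "x \<in> dom D" for x
  proof (rule integrable_monotone_convergence[OF bb])
    show "AE t in spectral.\<mu> x. mono (\<lambda>N. indicator (window N) t * t\<^sup>2)"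
      by (rule AE_I2) (auto simp: mono_def indicator_def)
    show "AE t in spectral.\<mu> x. (\<lambda>N. indicator (window N) t * t\<^sup>2) \<longlonglongrightarrow> t\<^sup>2"
    proof (rule AE_I2)
      fix t
      have "\<forall>\<^sub>F N in sequentially. t\<^sup>2 = indicator (window N) t * t\<^sup>2"
        using eventually_window[of t] by eventually_elim simp
      then show "(\<lambda>N. indicator (window N) t * t\<^sup>2) \<longlonglongrightarrow> t\<^sup>2"
        by (rule Lim_transform_eventually[OF tendsto_const])
    qed
    show "(\<lambda>N. LINT t|spectral.\<mu> x. indicator (window N) t * t\<^sup>2) \<longlonglongrightarrow> (norm (app x))\<^sup>2"
      unfolding sq[symmetric] F_app[OF x] by (intro tendsto_intros spectral.window_tendsto)
  qed simp
  have from_dom: "x \<in> dom D" if int: "integrable (spectral.\<mu> x) (\<lambda>t. t\<^sup>2)" for x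
  proof -
    have "convergent (\<lambda>N. LINT t|spectral.\<mu> x. indicator (window N) t * t\<^sup>2)"
      using spectral.integral_window_tendsto[OF int] by (auto simp: convergent_def)
    then have "Cauchy (\<lambda>N. app (?F N x))"
    proof (rule Cauchy_if_norm_sq_diff)
      fix M N :: nat assume MN: "M \<le> N"
      have "(norm (app (?F N x) - app (?F M x)))\<^sup>2 = (LINT t|spectral.\<mu> x. (cmod (cut N t - cut M t))\<^sup>2)"
        by (rule spectral.calculus_norm_sq[OF spectral.calculus_diff[OF cw cw]])
      also have "(\<lambda>t. (cmod (cut N t - cut M t))\<^sup>2)
          = (\<lambda>t. indicator (window N) t * t\<^sup>2 - indicator (window M) t * t\<^sup>2)"
        using MN by (auto simp: cut_def indicator_def fun_eq_iff power2_eq_square norm_mult)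
      also have "(LINT t|spectral.\<mu> x. indicator (window N) t * t\<^sup>2 - indicator (window M) t * t\<^sup>2)
          = (LINT t|spectral.\<mu> x. indicator (window N) t * t\<^sup>2)
            - (LINT t|spectral.\<mu> x. indicator (window M) t * t\<^sup>2)"
        by (rule Bochner_Integration.integral_diff[OF bb bb])
      finally show "(norm (app (?F N x) - app (?F M x)))\<^sup>2
          \<le> \<bar>(LINT t|spectral.\<mu> x. indicator (window N) t * t\<^sup>2)
            - (LINT t|spectral.\<mu> x. indicator (window M) t * t\<^sup>2)\<bar>" by simp
    qed
    then obtain z where "(\<lambda>N. app (?F N x)) \<longlonglongrightarrow> z"
      unfolding Cauchy_convergent_iff convergent_def by blast
    from closed_graph(1)[OF F_dom spectral.window_tendsto this] show ?thesis .
  qed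
  have form: "cinner (app x) x = (LINT t|spectral.\<mu> x. complex_of_real t)" if x: "x \<in> dom D" for x
  proof (rule LIMSEQ_unique)
    have "(\<lambda>N. cinner (?F N (app x)) x) \<longlonglongrightarrow> cinner (app x) x"
      by (intro tendsto_intros spectral.window_tendsto)
    then show "(\<lambda>N. LINT t|spectral.\<mu> x. indicator (window N) t *\<^sub>R complex_of_real t) \<longlonglongrightarrow> cinner (app x) x"
      using spectral.calculus_form[OF cw, of _ x]
      by (simp add: F_app[OF x] cut_def scaleR_conv_of_real)
    show "(\<lambda>N. LINT t|spectral.\<mu> x. indicator (window N) t *\<^sub>R complex_of_real t)
        \<longlonglongrightarrow> (LINT t|spectral.\<mu> x. complex_of_real t)"
      by (rule spectral.integral_window_tendsto)
        (simp add: complex_of_real_integrable_eq spectral.integrable_if_square to_dom[OF x])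
  qed
  have "dom D = {x. integrable (spectral.\<mu> x) (\<lambda>t. (cmod (complex_of_real t))\<^sup>2)}"
    using to_dom from_dom by auto
  then show ?thesis
    unfolding is_spectral_integral_def using lin form by blast
qed

end

lemma spectral_measure_represents:
  assumes "self_adjoint D"
  shows "projection_valued_measure (spectral_measure D)"
    and "is_spectral_integral (spectral_measure D) complex_of_real D"
proof -
  interpret self_adjoint_operator D by unfold_locales (rule assms)
  have "\<exists>E. projection_valued_measure E \<and> is_spectral_integral E complex_of_real D"
    using resolution.projection_valued_measure_spectral_projection spectral_theorem by blast
  from someI_ex[OF this]
  show "projection_valued_measure (spectral_measure D)"
    and "is_spectral_integral (spectral_measure D) complex_of_real D"
    unfolding spectral_measure_def by blast+
qed

section \<open>The unitary group generated by a self-adjoint operator\<close>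

text \<open>
  The facts about \<open>e\<^sup>i\<^sup>t\<^sup>D\<close> are derived for an arbitrary spectral measure \<open>E\<close> of \<open>D\<close>; the defining
  properties of \<open>E\<close> determine how \<open>D\<close> acts on the range of the projection for a bounded window.
\<close>

locale spectral_representation = spectral_resolution E + sa: self_adjoint_operator D
  for E :: "real set \<Rightarrow> 'h::chilbert_space \<Rightarrow> 'h" and D :: "'h \<rightharpoonup> 'h" +
  assumes represents: "is_spectral_integral E complex_of_real D"
begin

abbreviation (input) Q :: "nat \<Rightarrow> 'h \<Rightarrow> 'h" where "Q N \<equiv> E (window N)"

lemma dom_iff: "x \<in> dom D \<longleftrightarrow> integrable (\<mu> x) (\<lambda>t. t\<^sup>2)"
proof -
  have "dom D = {x. integrable (\<mu> x) (\<lambda>t. (cmod (complex_of_real t))\<^sup>2)}"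
    using represents by (simp only: is_spectral_integral_def)
  then show ?thesis by simp
qed

lemma form: "x \<in> dom D \<Longrightarrow> cinner (sa.app x) x = (LINT t|\<mu> x. complex_of_real t)"
  using represents by (simp only: is_spectral_integral_def)

lemma Q_proj: "orthogonal_projection (Q N)"
  by (rule E_proj) simp

lemma Q_clinear: "bounded_clinear (Q N)"
  by (rule orthogonal_projection_clinear[OF Q_proj])

lemma bounded_set_dom:
  assumes B: "B \<in> sets borel" "B \<subseteq> window N"
  shows "E B x \<in> dom D"
  unfolding dom_iff
proof (subst integrable_restrict[OF B(1)])
  interpret finite_measure "\<mu> x" by (rule finite_\<mu>)
  have le: "norm (indicator B t *\<^sub>R t\<^sup>2) \<le> (real N)\<^sup>2" for t :: real
  proof (cases "t \<in> B")
    case True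
    then have "t \<in> window N" using B by blast
    then have "\<bar>t\<bar> \<le> \<bar>real N\<bar>" by auto
    then have "t\<^sup>2 \<le> (real N)\<^sup>2" by (simp only: abs_le_square_iff)
    then show ?thesis using True by simp
  qed simp
  show "integrable (\<mu> x) (\<lambda>t. indicator B t *\<^sub>R t\<^sup>2)"
    by (rule integrable_const_bound[of _ "(real N)\<^sup>2"]) (use le B in auto)
qed simp

lemma Q_dom: "Q N x \<in> dom D"
  by (rule bounded_set_dom) auto

text \<open>
  Orthogonality of \<open>D(Q x)\<close> to the complement of the window: the quadratic form of \<open>D\<close> at a sum
  \<open>u + v\<close> of vectors with spectral support inside and outside the window is the sum of its values at
  \<open>u\<close> and at \<open>v\<close>, so the mixed terms vanish.
\<close>

lemma window_orthogonal:
  assumes u: "Q N u = u" and v: "v \<in> dom D" "Q N v = 0"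
  shows "cinner (sa.app u) v = 0"
proof -
  let ?W = "window N" and ?C = "- window N"
  have sets: "?W \<in> sets borel" "?C \<in> sets borel" by auto
  have u_dom: "u \<in> dom D" using Q_dom[of N u] u by simp
  have comp: "E ?C x = x - Q N x" for x
  proof -
    have "x = Q N x + E ?C x" using E_Un[OF sets, of x] by (simp add: Compl_partition E_UNIV)
    then show ?thesis by (metis add_diff_cancel_left')
  qed
  have zero: "cnj c * cinner (sa.app u) v + c * cinner (sa.app v) u = 0" for c
  proof -
    let ?w = "u + c *\<^sub>C v"
    have cv: "c *\<^sub>C v \<in> dom D" using v by (intro sa.dom_scaleC)
    have w: "?w \<in> dom D" using u_dom cv by (rule sa.dom_add)
    have Qw: "E ?W ?w = u"
      by (simp add: bounded_clinear_add[OF Q_clinear] bounded_clinear_scaleC[OF Q_clinear] u v)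
    have Cw: "E ?C ?w = c *\<^sub>C v" by (simp only: comp Qw) simp
    have int: "integrable (\<mu> ?w) (\<lambda>t. complex_of_real t)"
      unfolding complex_of_real_integrable_eq by (rule integrable_if_square) (use w dom_iff in blast)
    have split: "(LINT t|\<mu> ?w. complex_of_real t)
        = (LINT t|\<mu> u. complex_of_real t) + (LINT t|\<mu> (c *\<^sub>C v). complex_of_real t)"
    proof -
      have restrict: "(LINT t|\<mu> (E B ?w). complex_of_real t)
          = (LINT t|\<mu> ?w. indicator B t *\<^sub>R complex_of_real t)" if "B \<in> sets borel" for B
        by (rule integral_restrict[OF that]) simp
      have "(LINT t|\<mu> ?w. complex_of_real t)
          = (LINT t|\<mu> ?w. indicator ?W t *\<^sub>R complex_of_real t + indicator ?C t *\<^sub>R complex_of_real t)"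
        by (rule Bochner_Integration.integral_cong) (auto simp: indicator_def)
      also have "\<dots> = (LINT t|\<mu> ?w. indicator ?W t *\<^sub>R complex_of_real t)
          + (LINT t|\<mu> ?w. indicator ?C t *\<^sub>R complex_of_real t)"
        using sets by (intro Bochner_Integration.integral_add integrable_mult_indicator int) auto
      also have "\<dots> = (LINT t|\<mu> (E ?W ?w). complex_of_real t) + (LINT t|\<mu> (E ?C ?w). complex_of_real t)"
        by (simp only: restrict[OF sets(1)] restrict[OF sets(2)])
      finally show ?thesis by (simp only: Qw Cw)
    qed
    have "cinner (sa.app ?w) ?w = cinner (sa.app u) u + cinner (sa.app (c *\<^sub>C v)) (c *\<^sub>C v)"
      unfolding form[OF w] form[OF u_dom] form[OF cv] by (rule split)
    then show ?thesis
      using u_dom v cv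
      by (simp add: sa.app_add sa.app_scaleC cinner_add_left cinner_add_right cinner_scaleC_left
          cinner_scaleC_right algebra_simps)
  qed
  let ?p = "cinner (sa.app u) v" and ?q = "cinner (sa.app v) u"
  have "?p + ?q = 0" using zero[of 1] by simp
  moreover have "\<i> * (?q - ?p) = 0" using zero[of \<i>] by (simp add: algebra_simps)
  then have "?q = ?p" by simp
  ultimately show ?thesis by simp
qed

text \<open>The bounded operator \<open>DQ\<^sub>N\<close>, taken from the functional calculus of \<open>E\<close>.\<close>

definition T :: "nat \<Rightarrow> 'h \<Rightarrow> 'h" where
  "T N = (SOME T. calculus (cut N) T)"

lemma T_calculus: "calculus (cut N) (T N)"
  unfolding T_def by (rule someI_ex[OF calculus_exists[OF bounded_borel_cut]])

lemma T_clinear: "bounded_clinear (T N)"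
  by (rule calculus_clinear[OF T_calculus])

lemma T_adj: "cinner (T N x) y = cinner x (T N y)"
proof (rule calculus_adjoint[OF T_calculus])
  have "(\<lambda>t. cnj (cut N t)) = cut N" by (auto simp: cut_def)
  then show "calculus (\<lambda>t. cnj (cut N t)) (T N)" using T_calculus by simp
qed

text \<open>
  Both sides have the same quadratic form \<open>\<integral> t d\<mu>\<close> over the window, and by \<open>window_orthogonal\<close> the vector
  \<open>D(Qx)\<close> has no component outside the range of \<open>Q\<close>.
\<close>

lemma app_Q: "sa.app (Q N x) = T N x"
proof (rule eq_if_dense[OF sa.dense_dom])
  fix y assume y: "y \<in> dom D"
  let ?A = "\<lambda>x. Q N (sa.app (Q N x)) - T N x"
  have A0: "?A x = 0"
  proof -
    have "cmod (cinner (?A x) (?A x)) \<le> 2 * 0 * norm x * norm (?A x)"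
    proof (rule polarization_bound[of UNIV])
      show "?A (x + y) = ?A x + ?A y" for x y
        by (simp add: bounded_clinear_add[OF Q_clinear] bounded_clinear_add[OF T_clinear] sa.app_add Q_dom)
      show "?A (c *\<^sub>C x) = c *\<^sub>C ?A x" for c x
        by (simp add: bounded_clinear_scaleC[OF Q_clinear] bounded_clinear_scaleC[OF T_clinear]
            sa.app_scaleC Q_dom scaleC_diff_right)
      show "cmod (cinner (?A x) x) \<le> 0 * (norm x)\<^sup>2" for x
      proof -
        have "cinner (Q N (sa.app (Q N x))) x = (LINT t|\<mu> (Q N x). complex_of_real t)"
          by (simp only: orthogonal_projection_adj[OF Q_proj] form[OF Q_dom])
        also have "\<dots> = (LINT t|\<mu> x. indicator (window N) t *\<^sub>R complex_of_real t)"
          by (rule integral_restrict) auto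
        also have "\<dots> = cinner (T N x) x"
          unfolding calculus_form[OF T_calculus] cut_def by (simp add: scaleR_conv_of_real)
        finally show ?thesis by (simp add: cinner_diff_left)
      qed
    qed (auto simp: csubspace_def)
    then show ?thesis by (simp add: cinner_self)
  qed
  have "cinner (sa.app (Q N x)) (y - Q N y) = 0"
    by (rule window_orthogonal[of N])
      (auto simp: orthogonal_projection_idem[OF Q_proj] bounded_clinear_diff[OF Q_clinear]
        intro: sa.dom_diff y Q_dom)
  then have "cinner (sa.app (Q N x)) y = cinner (sa.app (Q N x)) (Q N y)"
    by (simp add: cinner_diff_right)
  also have "\<dots> = cinner (T N x) y"
    using A0 by (simp add: orthogonal_projection_adj[OF Q_proj, symmetric])
  finally show "cinner (sa.app (Q N x)) y = cinner (T N x) y" .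
qed

lemma Q_app: "x \<in> dom D \<Longrightarrow> Q N (sa.app x) = T N x"
proof (rule eq_if_cinner_eq)
  fix y assume x: "x \<in> dom D"
  have "cinner (Q N (sa.app x)) y = cinner (sa.app x) (Q N y)"
    by (rule orthogonal_projection_adj[OF Q_proj])
  also have "\<dots> = cinner x (T N y)" by (simp only: sa.app_adj[OF x Q_dom] app_Q)
  finally show "cinner (Q N (sa.app x)) y = cinner (T N x) y" by (simp only: T_adj)
qed

lemma T_tendsto: "x \<in> dom D \<Longrightarrow> (\<lambda>N. T N x) \<longlonglongrightarrow> sa.app x"
  using window_tendsto[of "sa.app x"] by (simp add: Q_app)

text \<open>The truncations of \<open>Cx\<close> to windows converge in the graph norm, so closedness of \<open>D\<close> applies.\<close>

lemma commute_app:
  assumes C: "bounded_clinear C" and Q: "\<And>N x. C (Q N x) = Q N (C x)"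
    and T: "\<And>N x. C (T N x) = T N (C x)" and x: "x \<in> dom D"
  shows "C x \<in> dom D" and "sa.app (C x) = C (sa.app x)"
proof -
  have "(\<lambda>N. sa.app (Q N (C x))) \<longlonglongrightarrow> C (sa.app x)"
    unfolding app_Q T[symmetric] by (rule bounded_clinear_tendsto[OF C T_tendsto[OF x]])
  from sa.closed_graph[OF Q_dom window_tendsto this]
  show "C x \<in> dom D" and "sa.app (C x) = C (sa.app x)" by blast+
qed

lemma E_app:
  assumes B: "B \<in> sets borel" and x: "x \<in> dom D"
  shows "E B x \<in> dom D" and "sa.app (E B x) = E B (sa.app x)"
proof -
  have Q: "E B (Q N x) = Q N (E B x)" for N x
    using B by (simp add: E_Int Int_commute)
  have T: "E B (T N x) = T N (E B x)" for N x
    by (rule calculus_commute[OF calculus_indicator[OF B] T_calculus])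
  show "E B x \<in> dom D" and "sa.app (E B x) = E B (sa.app x)"
    by (rule commute_app[OF E_clinear[OF B] Q T x])+
qed

definition expi :: "real \<Rightarrow> real \<Rightarrow> complex" where
  "expi t s = exp (\<i> * complex_of_real t * complex_of_real s)"

definition U :: "real \<Rightarrow> 'h \<Rightarrow> 'h" where
  "U t = (SOME T. calculus (expi t) T)"

lemma cmod_expi: "cmod (expi t s) = 1"
proof -
  have "expi t s = exp (\<i> * complex_of_real (t * s))" by (simp add: expi_def mult.assoc)
  then show ?thesis by (simp only: norm_exp_i_times)
qed

lemma expi_borel [measurable]: "expi t \<in> borel_measurable borel"
proof -
  have "continuous_on UNIV (expi t)" unfolding expi_def by (intro continuous_intros)
  then show ?thesis by (rule borel_measurable_continuous_onI)
qed

lemma bounded_borel_expi: "bounded_borel (expi t)"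
  by (rule bounded_borelI[OF expi_borel, of _ 1]) (simp add: cmod_expi)

lemma U_calculus: "calculus (expi t) (U t)"
  unfolding U_def by (rule someI_ex[OF calculus_exists[OF bounded_borel_expi]])

lemma U_clinear: "bounded_clinear (U t)"
  by (rule calculus_clinear[OF U_calculus])

lemma id_calculus: "calculus (\<lambda>s. 1) (\<lambda>x. x)"
  using calculus_indicator[of UNIV] E_UNIV by (simp add: calculus_def bounded_clinear_id)

lemma U_add: "U s (U t x) = U (s + t) x"
proof -
  have "(\<lambda>r. expi s r * expi t r) = expi (s + t)"
    by (auto simp: expi_def fun_eq_iff exp_add[symmetric] algebra_simps)
  then have "calculus (expi (s + t)) (\<lambda>x. U s (U t x))"
    using calculus_mult[OF U_calculus U_calculus, of s t] by simp
  from calculus_unique[OF U_calculus this] show ?thesis by metis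
qed

lemma U_0: "U 0 x = x"
proof -
  have "expi 0 = (\<lambda>s. 1)" by (auto simp: expi_def)
  then have "calculus (\<lambda>s. 1) (U 0)" using U_calculus[of 0] by simp
  from calculus_unique[OF this id_calculus] show ?thesis by simp
qed

lemma U_adj: "cinner (U t x) y = cinner x (U (- t) y)"
proof (rule calculus_adjoint[OF U_calculus])
  have "(\<lambda>s. cnj (expi t s)) = expi (- t)" by (auto simp: expi_def exp_cnj)
  then show "calculus (\<lambda>s. cnj (expi t s)) (U (- t))" using U_calculus by simp
qed

lemma U_norm: "norm (U t x) = norm x"
proof -
  have "cinner (U t x) (U t x) = cinner x x" by (simp add: U_adj U_add U_0)
  then have "(norm (U t x))\<^sup>2 = (norm x)\<^sup>2" by (simp add: norm_sq_cinner)
  then show ?thesis by (simp add: power2_eq_iff_nonneg)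
qed

lemma U_app:
  assumes x: "x \<in> dom D"
  shows "U t x \<in> dom D" and "sa.app (U t x) = U t (sa.app x)"
proof -
  have Q: "U t (Q N x) = Q N (U t x)" for N x
    by (rule calculus_commute[OF U_calculus calculus_indicator]) simp
  have T: "U t (T N x) = T N (U t x)" for N x
    by (rule calculus_commute[OF U_calculus T_calculus])
  show "U t x \<in> dom D" and "sa.app (U t x) = U t (sa.app x)"
    by (rule commute_app[OF U_clinear Q T x])+
qed

lemma expi_diff_le: "cmod (expi t s - 1) \<le> \<bar>t * s\<bar>"
proof -
  have "expi t s = exp (\<i> * complex_of_real (t * s))" by (simp add: expi_def mult.assoc)
  then have "cmod (expi t s - 1) = 2 * \<bar>sin (t * s / 2)\<bar>" by (simp only: dist_exp_i_1)
  also have "\<dots> \<le> \<bar>t * s\<bar>" using abs_sin_x_le_abs_x[of "t * s / 2"] by simp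
  finally show ?thesis .
qed

lemma expi_deriv: "((\<lambda>t. (expi t s - 1) / complex_of_real t) \<longlongrightarrow> \<i> * complex_of_real s) (at 0)"
proof -
  have "((\<lambda>z. exp (z * (\<i> * complex_of_real s))) has_field_derivative \<i> * complex_of_real s) (at 0)"
    by (auto intro!: derivative_eq_intros)
  then have "((\<lambda>z. (exp (z * (\<i> * complex_of_real s)) - 1) / z) \<longlongrightarrow> \<i> * complex_of_real s) (at 0)"
    by (simp add: has_field_derivative_iff)
  moreover have "filterlim complex_of_real (at 0) (at (0::real))"
    by (rule filterlim_atI) (auto intro!: tendsto_eq_intros simp: eventually_at_filter)
  ultimately have "((\<lambda>t. (exp (complex_of_real t * (\<i> * complex_of_real s)) - 1) / complex_of_real t)
      \<longlongrightarrow> \<i> * complex_of_real s) (at 0)"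
    by (rule filterlim_compose)
  then show ?thesis by (simp add: expi_def mult_ac)
qed

lemma U_continuous: "((\<lambda>t. U t x) \<longlongrightarrow> x) (at 0)"
  unfolding tendsto_at_iff_sequentially
proof (intro allI impI)
  fix r :: "nat \<Rightarrow> real" assume r: "r \<longlonglongrightarrow> 0"
  have eq: "(norm (U (r n) x - x))\<^sup>2 = (LINT s|\<mu> x. (cmod (expi (r n) s - 1))\<^sup>2)" for n
    by (rule calculus_norm_sq[OF calculus_diff[OF U_calculus id_calculus]])
  interpret finite_measure "\<mu> x" by (rule finite_\<mu>)
  have "(\<lambda>n. LINT s|\<mu> x. (cmod (expi (r n) s - 1))\<^sup>2) \<longlonglongrightarrow> (LINT s|\<mu> x. 0)"
  proof (rule integral_dominated_convergence)
    show "(\<lambda>s. (cmod (expi (r n) s - 1))\<^sup>2) \<in> borel_measurable (\<mu> x)" for n by measurable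
    show "integrable (\<mu> x) (\<lambda>s. 4 :: real)" by simp
    show "AE s in \<mu> x. (\<lambda>n. (cmod (expi (r n) s - 1))\<^sup>2) \<longlonglongrightarrow> 0"
    proof (rule AE_I2)
      fix s
      have "(\<lambda>n. \<bar>r n * s\<bar>) \<longlonglongrightarrow> 0"
        using tendsto_rabs[OF tendsto_mult_left_zero[OF r, of s]] by simp
      then have "(\<lambda>n. expi (r n) s - 1) \<longlonglongrightarrow> 0"
        by (rule Lim_null_comparison[rotated]) (simp add: expi_diff_le)
      then have "(\<lambda>n. (cmod (expi (r n) s - 1))\<^sup>2) \<longlonglongrightarrow> (norm (0::complex))\<^sup>2"
        by (intro tendsto_intros)
      then show "(\<lambda>n. (cmod (expi (r n) s - 1))\<^sup>2) \<longlonglongrightarrow> 0" by simp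
    qed
    show "AE s in \<mu> x. norm ((cmod (expi (r n) s - 1))\<^sup>2) \<le> 4" for n
    proof (rule AE_I2)
      fix s
      have "cmod (expi (r n) s - 1) \<le> 2"
        using norm_triangle_ineq4[of "expi (r n) s" 1] by (simp add: cmod_expi)
      from power_mono[OF this norm_ge_zero, of 2]
      show "norm ((cmod (expi (r n) s - 1))\<^sup>2) \<le> 4" by simp
    qed
  qed simp
  then have "(\<lambda>n. (norm (U (r n) x - x))\<^sup>2) \<longlonglongrightarrow> 0" unfolding eq by simp
  from tendsto_if_norm_sq[OF this] show "((\<lambda>t. U t x) \<circ> r) \<longlonglongrightarrow> x" by (simp add: comp_def)
qed

text \<open>
  This is the easy half of Stone's theorem. Dominated convergence applies with the bound
  \<open>\<bar>(e\<^sup>i\<^sup>t\<^sup>s - 1)/t - is\<bar> \<le> 2\<bar>s\<bar>\<close>, which is square integrable exactly because the vector is in the domain.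
\<close>

lemma U_deriv:
  assumes x: "x \<in> dom D"
  shows "((\<lambda>t. (U t x - x) /\<^sub>R t) \<longlongrightarrow> \<i> *\<^sub>C sa.app x) (at 0)"
proof -
  define k where "k t s = (expi t s - 1) / complex_of_real t - \<i> * complex_of_real s" for t s :: real
  have k_meas: "k t \<in> borel_measurable borel" for t unfolding k_def[abs_def] by measurable
  have k_le: "cmod (k t s) \<le> 2 * \<bar>s\<bar>" if "t \<noteq> 0" for t s
  proof -
    have "cmod ((expi t s - 1) / complex_of_real t) \<le> \<bar>s\<bar>"
      using expi_diff_le[of t s] that by (simp add: norm_divide abs_mult divide_le_eq mult.commute)
    then show ?thesis
      unfolding k_def using norm_triangle_ineq4[of "(expi t s - 1) / complex_of_real t" "\<i> * complex_of_real s"]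
      by (simp add: norm_mult)
  qed
  have k_sq_le: "(cmod (k t s))\<^sup>2 \<le> 4 * s\<^sup>2" if "t \<noteq> 0" for t s
    using power_mono[OF k_le[OF that] norm_ge_zero, of s 2] by (simp add: power_mult_distrib)
  have int_sq: "integrable (\<mu> x) (\<lambda>s. 4 * s\<^sup>2)" using x by (simp add: dom_iff)
  have k_int: "integrable (\<mu> x) (\<lambda>s. (cmod (k t s))\<^sup>2)" if "t \<noteq> 0" for t
    by (rule Bochner_Integration.integrable_bound[OF int_sq])
      (use k_meas k_sq_le[OF that] in auto)
  have le: "(norm ((U t x - x) /\<^sub>R t - \<i> *\<^sub>C sa.app x))\<^sup>2 \<le> (LINT s|\<mu> x. (cmod (k t s))\<^sup>2)"
    if t: "t \<noteq> 0" for t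
  proof (rule LIMSEQ_le_const2)
    let ?y = "(U t x - x) /\<^sub>R t - \<i> *\<^sub>C sa.app x"
    show "(\<lambda>N. (norm (Q N ?y))\<^sup>2) \<longlonglongrightarrow> (norm ?y)\<^sup>2"
      by (intro tendsto_intros window_tendsto)
    have "(norm (Q N ?y))\<^sup>2 \<le> (LINT s|\<mu> x. (cmod (k t s))\<^sup>2)" for N
    proof -
      let ?ind = "\<lambda>s. complex_of_real (indicator (window N) s)"
      have "calculus (\<lambda>s. (1 / complex_of_real t) * (?ind s * expi t s - ?ind s) - \<i> * cut N s)
          (\<lambda>x. (1 / complex_of_real t) *\<^sub>C (Q N (U t x) - Q N x) - \<i> *\<^sub>C T N x)"
        by (intro calculus_diff calculus_scale calculus_mult U_calculus T_calculus calculus_indicator) auto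
      from calculus_norm_sq[OF this, of x]
      have "(norm (Q N ?y))\<^sup>2
          = (LINT s|\<mu> x. (cmod ((1 / complex_of_real t) * (?ind s * expi t s - ?ind s) - \<i> * cut N s))\<^sup>2)"
        by (simp add: bounded_clinear_diff[OF Q_clinear] bounded_clinear_scaleR[OF Q_clinear]
            bounded_clinear_scaleC[OF Q_clinear] Q_app[OF x] scaleR_scaleC inverse_eq_divide)
      also have "\<dots> = (LINT s|\<mu> x. indicator (window N) s *\<^sub>R (cmod (k t s))\<^sup>2)"
        by (rule Bochner_Integration.integral_cong) (auto simp: k_def cut_def indicator_def)
      also have "\<dots> \<le> (LINT s|\<mu> x. (cmod (k t s))\<^sup>2)"
        by (intro integral_mono integrable_mult_indicator k_int t) (auto simp: indicator_def)
      finally show ?thesis .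
    qed
    then show "\<exists>M. \<forall>N\<ge>M. (norm (Q N ?y))\<^sup>2 \<le> (LINT s|\<mu> x. (cmod (k t s))\<^sup>2)" by blast
  qed
  show ?thesis
    unfolding tendsto_at_iff_sequentially
  proof (intro allI impI)
    fix r :: "nat \<Rightarrow> real" assume nz: "\<forall>n. r n \<in> UNIV - {0}" and r: "r \<longlonglongrightarrow> 0"
    have "(\<lambda>n. LINT s|\<mu> x. (cmod (k (r n) s))\<^sup>2) \<longlonglongrightarrow> (LINT s|\<mu> x. 0)"
    proof (rule integral_dominated_convergence[OF _ _ int_sq])
      show "(\<lambda>s. (cmod (k (r n) s))\<^sup>2) \<in> borel_measurable (\<mu> x)" for n
        using k_meas by measurable
      show "AE s in \<mu> x. (\<lambda>n. (cmod (k (r n) s))\<^sup>2) \<longlonglongrightarrow> 0"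
      proof (rule AE_I2)
        fix s
        have "((\<lambda>t. (expi t s - 1) / complex_of_real t) \<circ> r) \<longlonglongrightarrow> \<i> * complex_of_real s"
          using expi_deriv[of s] nz r unfolding tendsto_at_iff_sequentially by blast
        then have "(\<lambda>n. k (r n) s) \<longlonglongrightarrow> 0" by (simp add: k_def comp_def LIM_zero_iff)
        then have "(\<lambda>n. (cmod (k (r n) s))\<^sup>2) \<longlonglongrightarrow> (norm (0::complex))\<^sup>2"
          by (intro tendsto_intros)
        then show "(\<lambda>n. (cmod (k (r n) s))\<^sup>2) \<longlonglongrightarrow> 0" by simp
      qed
      show "AE s in \<mu> x. norm ((cmod (k (r n) s))\<^sup>2) \<le> 4 * s\<^sup>2" for n
        using k_sq_le nz by (intro AE_I2) simp
    qed simp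
    then have *: "(\<lambda>n. LINT s|\<mu> x. (cmod (k (r n) s))\<^sup>2) \<longlonglongrightarrow> 0" by simp
    have "(\<lambda>n. (norm ((U (r n) x - x) /\<^sub>R r n - \<i> *\<^sub>C sa.app x))\<^sup>2) \<longlonglongrightarrow> 0"
      by (rule Lim_null_comparison[OF _ *]) (use le nz in \<open>auto intro!: always_eventually\<close>)
    from tendsto_if_norm_sq[OF this]
    show "((\<lambda>t. (U t x - x) /\<^sub>R t) \<circ> r) \<longlonglongrightarrow> \<i> *\<^sub>C sa.app x" by (simp add: comp_def)
  qed
qed

end

section \<open>Strong limits of uniformly bounded operators\<close>

lemma frequently_lessD_Liminf:
  fixes f :: "'a \<Rightarrow> ereal"
  assumes "Liminf F f < \<infinity>"
  obtains C :: real where "0 \<le> C" "\<exists>\<^sub>F t in F. f t \<le> ereal C"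
proof -
  obtain n :: nat where n: "Liminf F f < ereal (real n)"
    using less_PInf_Ex_of_nat[of "Liminf F f"] assms by auto
  then obtain y where y: "y < ereal (real n)" "\<not> (\<forall>\<^sub>F t in F. y < f t)"
    unfolding not_le[symmetric] le_Liminf_iff by blast
  have "\<exists>\<^sub>F t in F. \<not> y < f t" using y(2) by (simp add: frequently_def)
  then have "\<exists>\<^sub>F t in F. f t \<le> ereal (real n)"
    by (rule frequently_elim1) (use y(1) in auto)
  then show thesis by (intro that[of "real n"]) auto
qed

text \<open>
  The limits at a sequence in \<open>V\<close> tending to \<open>x\<close> form a Cauchy sequence by the uniform
  bound, and their limit is the limit at \<open>x\<close>.
\<close>

lemma strong_limit_if_dense:
  fixes T :: "real \<Rightarrow> 'h::chilbert_space \<Rightarrow> 'h"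
  assumes T: "\<And>t. bounded_clinear (T t)" and k: "0 \<le> k"
    and le: "\<And>t x. t \<noteq> 0 \<Longrightarrow> norm (T t x) \<le> k * norm x"
    and V: "closure V = UNIV" "\<And>x. x \<in> V \<Longrightarrow> \<exists>z. ((\<lambda>t. T t x) \<longlongrightarrow> z) (at 0)"
  shows "\<exists>b. bounded_clinear b \<and> (\<forall>x. ((\<lambda>t. T t x) \<longlongrightarrow> b x) (at 0))"
proof -
  have nz: "\<forall>\<^sub>F t::real in at 0. t \<noteq> 0" by (simp add: eventually_at_filter)
  have "\<exists>z. ((\<lambda>t. T t x) \<longlongrightarrow> z) (at 0)" for x
  proof -
    have "x \<in> closure V" using V(1) by simp
    then obtain v where v: "\<And>n. v n \<in> V" "v \<longlonglongrightarrow> x" unfolding closure_sequential by blast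
    obtain z where z: "\<And>n. ((\<lambda>t. T t (v n)) \<longlongrightarrow> z n) (at 0)" using V(2)[OF v(1)] by metis
    have diff: "norm (z n - z m) \<le> k * norm (v n - v m)" for n m
    proof (rule tendsto_upperbound)
      show "((\<lambda>t. norm (T t (v n) - T t (v m))) \<longlongrightarrow> norm (z n - z m)) (at 0)"
        by (intro tendsto_intros z)
      show "\<forall>\<^sub>F t in at 0. norm (T t (v n) - T t (v m)) \<le> k * norm (v n - v m)"
        using nz by eventually_elim (metis le bounded_clinear_diff[OF T])
    qed simp
    have kv: "(\<lambda>n. k * norm (x - v n)) \<longlonglongrightarrow> 0"
      using tendsto_mult_right_zero[OF tendsto_norm_zero[OF LIM_zero[OF v(2)]], of k]
      by (simp add: norm_minus_commute)
    have "Cauchy z"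
      by (rule Cauchy_if_dist_le[OF LIMSEQ_imp_Cauchy[OF v(2)], of _ k]) (simp add: dist_norm diff)
    then obtain w where w: "z \<longlonglongrightarrow> w" unfolding Cauchy_convergent_iff convergent_def by blast
    have "((\<lambda>t. T t x) \<longlongrightarrow> w) (at 0)"
    proof (rule tendstoI)
      fix e :: real assume e: "e > 0"
      have "\<forall>\<^sub>F n in sequentially. k * norm (x - v n) < e / 3"
        using order_tendstoD(2)[OF kv, of "e / 3"] e by simp
      moreover have "\<forall>\<^sub>F n in sequentially. dist (z n) w < e / 3" using tendstoD[OF w, of "e / 3"] e by simp
      ultimately have "\<forall>\<^sub>F n in sequentially. k * norm (x - v n) < e / 3 \<and> dist (z n) w < e / 3"
        by (rule eventually_conj)
      then obtain n where n: "k * norm (x - v n) < e / 3" "dist (z n) w < e / 3"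
        using eventually_happens'[OF sequentially_bot] by blast
      have "\<forall>\<^sub>F t in at 0. dist (T t (v n)) (z n) < e / 3" using tendstoD[OF z, of "e / 3"] e by simp
      then show "\<forall>\<^sub>F t in at 0. dist (T t x) w < e"
        using nz
      proof eventually_elim
        case (elim t)
        have "dist (T t x) (T t (v n)) \<le> k * norm (x - v n)"
          using le[OF elim(2), of "x - v n"] by (simp add: dist_norm bounded_clinear_diff[OF T])
        then show ?case
          using n elim(1) dist_triangle[of "T t x" w "T t (v n)"] dist_triangle[of "T t (v n)" w "z n"]
          by linarith
      qed
    qed
    then show ?thesis by blast
  qed
  then obtain b where b: "\<And>x. ((\<lambda>t. T t x) \<longlongrightarrow> b x) (at 0)" by metis
  have "bounded_clinear b"
    by (rule bounded_clinear_limit[OF T at_neq_bot b, of k]) (use nz in eventually_elim, rule le)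
  with b show ?thesis by blast
qed


section \<open>Derivations implemented by a self-adjoint operator\<close>

locale derivation =
  fixes D :: "'h::chilbert_space \<rightharpoonup> 'h" and a :: "'h \<Rightarrow> 'h"
  assumes D: "self_adjoint D" and a: "bounded_clinear a"
begin

sublocale spectral_representation "spectral_measure D" D
  by unfold_locales (rule D spectral_measure_represents[OF D])+

abbreviation app :: "'h \<Rightarrow> 'h" where "app \<equiv> sa.app"

lemma exp_itD_eq: "exp_itD D t = U t"
proof
  fix x
  have "borel_calculus D (\<lambda>s. exp (\<i> * complex_of_real t * complex_of_real s)) = (\<lambda>x. Some (U t x))"
    unfolding borel_calculus_def calculus_spectral_integral[OF U_calculus, unfolded expi_def[abs_def]]
    by simp
  then show "exp_itD D t x = U t x" by (simp add: exp_itD_def)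
qed

lemma alpha_eq: "alpha D t a x = U t (a (U (- t) x))"
  by (simp add: alpha_def exp_itD_eq)

lemma alpha_clinear: "bounded_clinear (alpha D t a)"
proof -
  have "bounded_clinear (\<lambda>x. U t (a (U (- t) x)))"
    by (rule bounded_clinear_comp[OF U_clinear bounded_clinear_comp[OF a U_clinear]])
  then show ?thesis by (simp add: alpha_eq[abs_def])
qed

abbreviation quot :: "real \<Rightarrow> 'h \<Rightarrow> 'h" where "quot \<equiv> diff_quotient D a"

lemma quot_clinear: "bounded_clinear (quot t)"
proof -
  have "bounded_clinear (\<lambda>x. inverse t *\<^sub>R (alpha D t a x - a x))"
    using alpha_clinear a by (intro bounded_clinear_intros)
  then show ?thesis by (simp add: diff_quotient_def[abs_def])
qed

abbreviation S :: "'h \<Rightarrow> 'h \<Rightarrow> complex" where "S \<equiv> commutator_form D a"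

lemma at_0_minus: "filterlim uminus (at 0) (at (0::real))"
  by (rule filterlim_atI) (auto intro!: tendsto_eq_intros simp: eventually_at_filter)

lemma U_minus_deriv:
  assumes "x \<in> dom D"
  shows "((\<lambda>t. (U (- t) x - x) /\<^sub>R t) \<longlongrightarrow> - (\<i> *\<^sub>C app x)) (at 0)"
proof -
  have "((\<lambda>t. - ((U (- t) x - x) /\<^sub>R (- t))) \<longlongrightarrow> - (\<i> *\<^sub>C app x)) (at 0)"
    by (intro tendsto_minus filterlim_compose[OF U_deriv[OF assms] at_0_minus])
  then show ?thesis by simp
qed

lemma U_minus_continuous: "((\<lambda>t. U (- t) x) \<longlongrightarrow> x) (at 0)"
  by (rule filterlim_compose[OF U_continuous at_0_minus])

text \<open>By the product rule for \<open>\<langle>\<alpha>\<^sub>t(a)x, y\<rangle> = \<langle>a U\<^sub>-\<^sub>tx, U\<^sub>-\<^sub>ty\<rangle>\<close>, where both vectors are differentiable.\<close>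

lemma quot_form:
  assumes x: "x \<in> dom D" and y: "y \<in> dom D"
  shows "((\<lambda>t. cinner (quot t x) y) \<longlongrightarrow> S x y) (at 0)"
proof -
  have "cinner (quot t x) y = cinner (a ((U (- t) x - x) /\<^sub>R t)) (U (- t) y)
      + cinner (a x) ((U (- t) y - y) /\<^sub>R t)" for t
    by (simp add: diff_quotient_def alpha_eq cinner_scaleR_left cinner_scaleR_right cinner_diff_left
        cinner_diff_right U_adj bounded_clinear_scaleR[OF a] bounded_clinear_diff[OF a] algebra_simps)
  moreover have "((\<lambda>t. cinner (a ((U (- t) x - x) /\<^sub>R t)) (U (- t) y)
      + cinner (a x) ((U (- t) y - y) /\<^sub>R t))
    \<longlongrightarrow> cinner (a (- (\<i> *\<^sub>C app x))) y + cinner (a x) (- (\<i> *\<^sub>C app y))) (at 0)"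
    by (intro tendsto_add tendsto_cinner bounded_clinear_tendsto[OF a] U_minus_deriv x y
        U_minus_continuous tendsto_const)
  moreover have "cinner (a (- (\<i> *\<^sub>C app x))) y + cinner (a x) (- (\<i> *\<^sub>C app y)) = S x y"
    by (simp add: commutator_form_def bounded_clinear_minus[OF a] bounded_clinear_scaleC[OF a]
        cinner_minus_left cinner_minus_right cinner_scaleC_left cinner_scaleC_right)
  ultimately show ?thesis by simp
qed

text \<open>
  A bound on the form bounds the derivative of \<open>t \<mapsto> \<langle>\<alpha>\<^sub>t(a)x, y\<rangle>\<close> at all times, because
  \<open>\<alpha>\<^sub>s\<^sub>+\<^sub>h(a) = \<alpha>\<^sub>s(\<alpha>\<^sub>h(a))\<close> and the unitaries preserve both the domain and the norm.
\<close>

lemma alpha_Lipschitz: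
  assumes k: "0 \<le> k" and S: "\<And>x y. x \<in> dom D \<Longrightarrow> y \<in> dom D \<Longrightarrow> cmod (S x y) \<le> k * norm x * norm y"
  shows "norm (alpha D t a x - a x) \<le> k * \<bar>t\<bar> * norm x"
proof -
  have weak: "cmod (cinner (alpha D t a x - a x) y) \<le> k * norm x * norm y * \<bar>t\<bar>"
    if x: "x \<in> dom D" and y: "y \<in> dom D" for x y
  proof -
    let ?g = "\<lambda>s. cinner (alpha D s a x) y"
    have deriv: "(?g has_derivative (\<lambda>h. h *\<^sub>R S (U (- s) x) (U (- s) y))) (at s)" for s
    proof -
      let ?d = "S (U (- s) x) (U (- s) y)"
      have "cinner (quot h (U (- s) x)) (U (- s) y) = (?g (s + h) - ?g s) /\<^sub>R h" for h
      proof -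
        have "cinner (alpha D h a (U (- s) x)) (U (- s) y) = ?g (s + h)"
          using U_adj[of s "U h (a (U (- h) (U (- s) x)))" y]
          by (simp add: alpha_eq U_add add.commute)
        moreover have "cinner (a (U (- s) x)) (U (- s) y) = ?g s"
          by (simp add: alpha_eq U_adj)
        ultimately show ?thesis
          by (simp add: diff_quotient_def cinner_scaleR_left cinner_diff_left scaleR_conv_of_real)
      qed
      moreover have "((\<lambda>h. cinner (quot h (U (- s) x)) (U (- s) y)) \<longlongrightarrow> ?d) (at 0)"
        by (intro quot_form U_app x y)
      ultimately have "((\<lambda>h. norm ((?g (s + h) - ?g s) /\<^sub>R h - ?d)) \<longlongrightarrow> 0) (at 0)"
        by (simp add: tendsto_norm_zero LIM_zero)
      moreover have "\<forall>\<^sub>F h in at 0. norm ((?g (s + h) - ?g s) /\<^sub>R h - ?d)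
          = norm (?g (s + h) - ?g s - h *\<^sub>R ?d) / norm h"
      proof -
        have "norm (v /\<^sub>R h - d) = norm (v - h *\<^sub>R d) / norm h" if "h \<noteq> 0" for v d :: complex and h :: real
        proof -
          have "v /\<^sub>R h - d = (v - h *\<^sub>R d) /\<^sub>R h" using that by (simp add: scaleR_diff_right)
          then show ?thesis by (simp add: divide_inverse mult.commute)
        qed
        then show ?thesis by (simp add: eventually_at_filter)
      qed
      ultimately have "((\<lambda>h. norm (?g (s + h) - ?g s - h *\<^sub>R ?d) / norm h) \<longlongrightarrow> 0) (at 0)"
        by (rule Lim_transform_eventually)
      then show ?thesis unfolding has_derivative_at by (simp add: bounded_linear_scaleR_left)
    qed
    have "norm (?g t - ?g 0) \<le> k * norm x * norm y * norm (t - 0)"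
    proof (rule differentiable_bound[of UNIV])
      show "(?g has_derivative (\<lambda>h. h *\<^sub>R S (U (- s) x) (U (- s) y))) (at s within UNIV)" for s
        using deriv by simp
      show "onorm (\<lambda>h. h *\<^sub>R S (U (- s) x) (U (- s) y)) \<le> k * norm x * norm y" for s
      proof (rule onorm_bound)
        show "norm (h *\<^sub>R S (U (- s) x) (U (- s) y)) \<le> k * norm x * norm y * norm h" for h
          using S[OF U_app(1)[OF x] U_app(1)[OF y], of "- s" "- s"]
          by (simp add: U_norm mult.commute[of "\<bar>h\<bar>"] mult_right_mono)
      qed (use k in simp)
    qed auto
    then show ?thesis by (simp add: alpha_eq U_0 cinner_diff_left)
  qed
  have dom: "norm (alpha D t a x - a x) \<le> k * \<bar>t\<bar> * norm x" if "x \<in> dom D" for x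
    by (rule norm_le_if_dense[OF sa.dense_dom]) (use weak[OF that] k in \<open>auto simp: mult_ac\<close>)
  have "x \<in> closure (dom D)" using sa.dense_dom by simp
  then obtain v where v: "\<And>n. v n \<in> dom D" "v \<longlonglongrightarrow> x" unfolding closure_sequential by blast
  show ?thesis
  proof (rule LIMSEQ_le)
    show "(\<lambda>n. norm (alpha D t a (v n) - a (v n))) \<longlonglongrightarrow> norm (alpha D t a x - a x)"
      by (intro tendsto_intros bounded_clinear_tendsto[OF alpha_clinear] bounded_clinear_tendsto[OF a] v)
    show "(\<lambda>n. k * \<bar>t\<bar> * norm (v n)) \<longlonglongrightarrow> k * \<bar>t\<bar> * norm x" by (intro tendsto_intros v)
  qed (use dom[OF v(1)] in blast)
qed

text \<open>
  Once the functional \<open>S(x, -)\<close> is represented by a vector \<open>z\<close>, self-adjointness of \<open>D\<close> puts \<open>ax\<close> into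
  the domain, since \<open>\<langle>ax, Dy\<rangle> = \<langle>aDx - iz, y\<rangle>\<close> for all \<open>y\<close> in the domain.
\<close>

lemma commutator_dom:
  assumes x: "x \<in> dom D" and z: "\<And>y. y \<in> dom D \<Longrightarrow> S x y = cinner z y"
  shows "a x \<in> dom D" and "z = \<i> *\<^sub>C (app (a x) - a (app x))"
proof -
  have *: "cinner (app y) (a x) = cinner y (a (app x) - \<i> *\<^sub>C z)" if y: "y \<in> dom D" for y
  proof -
    have "cinner z y = \<i> * cinner (a x) (app y) - \<i> * cinner (a (app x)) y"
      using z[OF y] by (simp add: commutator_form_def)
    then have "\<i> * cinner z y = \<i> * (\<i> * cinner (a x) (app y) - \<i> * cinner (a (app x)) y)" by simp
    then have "cinner (a x) (app y) = cinner (a (app x) - \<i> *\<^sub>C z) y"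
      by (simp add: cinner_diff_left cinner_scaleC_left algebra_simps)
    then show ?thesis by (metis cinner_commute)
  qed
  show "a x \<in> dom D" by (rule sa.dom_adjoint[OF *])
  have "app (a x) = a (app x) - \<i> *\<^sub>C z" by (rule sa.dom_adjoint[OF *])
  then show "z = \<i> *\<^sub>C (app (a x) - a (app x))"
    by (simp add: scaleC_minus_right scaleC_scaleC scaleC_minus_left scaleC_one)
qed

lemma bounded_form_commutator:
  assumes k: "0 \<le> k" and S: "\<And>x y. x \<in> dom D \<Longrightarrow> y \<in> dom D \<Longrightarrow> cmod (S x y) \<le> k * norm x * norm y"
    and x: "x \<in> dom D"
  obtains z where "\<And>y. y \<in> dom D \<Longrightarrow> S x y = cinner z y"
proof -
  have "\<exists>z\<in>closure (dom D). \<forall>y\<in>dom D. cnj (S x y) = cinner y z"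
  proof (rule Riesz_subspace[OF sa.csubspace_dom])
    show "cnj (S x (y + y')) = cnj (S x y) + cnj (S x y')" if "y \<in> dom D" "y' \<in> dom D" for y y'
      using that by (simp add: commutator_form_def sa.app_add cinner_add_right algebra_simps)
    show "cnj (S x (c *\<^sub>C y)) = c * cnj (S x y)" if "y \<in> dom D" for c y
      using that by (simp add: commutator_form_def sa.app_scaleC cinner_scaleC_right algebra_simps)
    show "cmod (cnj (S x y)) \<le> (k * norm x) * norm y" if "y \<in> dom D" for y
      using S[OF x that] by simp
  qed
  then obtain z where "\<forall>y\<in>dom D. cnj (S x y) = cinner y z" by blast
  then have "S x y = cinner z y" if "y \<in> dom D" for y
    using that by (metis cinner_commute complex_cnj_cnj)
  then show thesis by (rule that)
qed

text \<open>
  The condition with which all others are compared. It differs from boundedness of the form in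
  providing the operator, which is the weak derivative.
\<close>

definition form_operator :: "('h \<Rightarrow> 'h) \<Rightarrow> bool" where
  "form_operator b \<longleftrightarrow> bounded_clinear b \<and> (\<forall>x\<in>dom D. \<forall>y\<in>dom D. S x y = cinner (b x) y)"

lemma form_operator_bound:
  assumes b: "form_operator b" and "x \<in> dom D" "y \<in> dom D"
  shows "cmod (S x y) \<le> onorm b * norm x * norm y"
proof -
  have "cmod (S x y) \<le> norm (b x) * norm y"
    using assms norm_cinner_le by (simp add: form_operator_def)
  also have "\<dots> \<le> (onorm b * norm x) * norm y"
    using b bounded_clinear_norm_le by (intro mult_right_mono) (auto simp: form_operator_def)
  finally show ?thesis .
qed

lemma onorm_nonneg: "bounded_clinear b \<Longrightarrow> 0 \<le> onorm b"
  by (rule onorm_pos_le[OF bounded_clinear_linear])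

lemma quot_bound:
  assumes "0 \<le> k" "\<And>x y. x \<in> dom D \<Longrightarrow> y \<in> dom D \<Longrightarrow> cmod (S x y) \<le> k * norm x * norm y" "t \<noteq> 0"
  shows "norm (quot t x) \<le> k * norm x"
proof -
  have "norm (quot t x) = norm (alpha D t a x - a x) / \<bar>t\<bar>"
    by (simp only: diff_quotient_def norm_scaleR abs_inverse divide_inverse mult.commute)
  then show ?thesis
    using alpha_Lipschitz[OF assms(1,2), of t x] assms(3) by (simp add: pos_divide_le_eq mult_ac)
qed

text \<open>
  On \<open>dom D\<close>, the quotient is \<open>U\<^sub>t a((U\<^sub>-\<^sub>tx - x)/t) + (U\<^sub>t - 1)(ax)/t\<close>. Both terms converge, the second one because
  \<open>ax\<close> is in \<open>dom D\<close>.
\<close>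

lemma strongly_differentiable_if_bounded_form:
  assumes k: "0 \<le> k" and S: "\<And>x y. x \<in> dom D \<Longrightarrow> y \<in> dom D \<Longrightarrow> cmod (S x y) \<le> k * norm x * norm y"
  shows "\<exists>b. bounded_clinear b \<and> (\<forall>x. ((\<lambda>t. quot t x) \<longlongrightarrow> b x) (at 0))"
proof (rule strong_limit_if_dense[OF quot_clinear k quot_bound[OF k S] sa.dense_dom])
  fix x assume x: "x \<in> dom D"
  obtain z where "\<And>y. y \<in> dom D \<Longrightarrow> S x y = cinner z y"
    using bounded_form_commutator[OF k S x] by blast
  from commutator_dom(1)[OF x this] have ax: "a x \<in> dom D" .
  let ?v = "\<lambda>t. a ((U (- t) x - x) /\<^sub>R t)"
  let ?w = "a (- (\<i> *\<^sub>C app x))"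
  have v: "((\<lambda>t. ?v t - ?w) \<longlongrightarrow> 0) (at 0)"
    by (rule LIM_zero[OF bounded_clinear_tendsto[OF a U_minus_deriv[OF x]]])
  have "((\<lambda>t. U t (?v t - ?w)) \<longlongrightarrow> 0) (at 0)"
    by (rule tendsto_norm_zero_cancel) (simp only: U_norm tendsto_norm_zero[OF v])
  from tendsto_add[OF tendsto_add[OF this U_continuous[of ?w]] U_deriv[OF ax]]
  have "((\<lambda>t. U t (?v t - ?w) + U t ?w + (U t (a x) - a x) /\<^sub>R t) \<longlongrightarrow> 0 + ?w + \<i> *\<^sub>C app (a x)) (at 0)" .
  moreover have "U t (?v t - ?w) + U t ?w + (U t (a x) - a x) /\<^sub>R t = quot t x" for t
  proof -
    have "U t (?v t - ?w) + U t ?w = U t (?v t)" by (simp add: bounded_clinear_diff[OF U_clinear])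
    also have "\<dots> = (U t (a (U (- t) x)) - U t (a x)) /\<^sub>R t"
      by (simp only: bounded_clinear_scaleR[OF a] bounded_clinear_diff[OF a]
          bounded_clinear_scaleR[OF U_clinear] bounded_clinear_diff[OF U_clinear])
    finally show ?thesis by (simp add: diff_quotient_def alpha_eq flip: scaleR_add_right)
  qed
  ultimately show "\<exists>z. ((\<lambda>t. quot t x) \<longlongrightarrow> z) (at 0)" by auto
qed

lemma has_weak_D_derivative_form_operator:
  assumes "has_weak_D_derivative D a b"
  shows "form_operator b"
  unfolding form_operator_def
proof (intro conjI ballI)
  show "bounded_clinear b" using assms by (simp add: has_weak_D_derivative_def)
  fix x y assume x: "x \<in> dom D" and y: "y \<in> dom D"
  have "((\<lambda>t. cmod (cinner (quot t x - b x) y)) \<longlongrightarrow> 0) (at 0)"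
    using assms by (simp add: has_weak_D_derivative_def)
  then have "((\<lambda>t. cinner (quot t x) y - cinner (b x) y) \<longlongrightarrow> 0) (at 0)"
    unfolding cinner_diff_left by (rule tendsto_norm_zero_cancel)
  then have "((\<lambda>t. cinner (quot t x) y) \<longlongrightarrow> cinner (b x) y) (at 0)" by (rule LIM_zero_cancel)
  from tendsto_unique[OF _ quot_form[OF x y] this] show "S x y = cinner (b x) y" by simp
qed

lemma form_operator_unique:
  assumes b: "form_operator b" and c: "form_operator c"
  shows "b = c"
proof
  fix x
  have dom: "b x = c x" if "x \<in> dom D" for x
    by (rule eq_if_dense[OF sa.dense_dom]) (use b c that in \<open>simp add: form_operator_def\<close>)
  have "x \<in> closure (dom D)" using sa.dense_dom by simp
  then obtain v where v: "\<And>n. v n \<in> dom D" "v \<longlonglongrightarrow> x" unfolding closure_sequential by blast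
  have "(\<lambda>n. b (v n)) \<longlonglongrightarrow> b x" "(\<lambda>n. c (v n)) \<longlonglongrightarrow> c x"
    using b c v(2) by (auto simp: form_operator_def intro: bounded_clinear_tendsto)
  then show "b x = c x" using dom[OF v(1)] LIMSEQ_unique by simp
qed

lemma weak_if_strong:
  assumes b: "bounded_clinear b" and lim: "\<And>x. ((\<lambda>t. quot t x) \<longlongrightarrow> b x) (at 0)"
  shows "has_weak_D_derivative D a b"
  unfolding has_weak_D_derivative_def
proof (intro conjI allI b)
  fix x y
  have "((\<lambda>t. cinner (quot t x - b x) y) \<longlongrightarrow> cinner (b x - b x) y) (at 0)"
    by (intro tendsto_intros lim)
  then show "((\<lambda>t. cmod (cinner (quot t x - b x) y)) \<longlongrightarrow> 0) (at 0)"
    using tendsto_norm_zero by simp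
qed

lemma form_operator_iff_bounded_form:
  "(\<exists>b. form_operator b) \<longleftrightarrow> bounded_form_on (dom D) S"
proof
  assume "\<exists>b. form_operator b"
  then show "bounded_form_on (dom D) S"
    unfolding bounded_form_on_def using form_operator_bound by blast
next
  assume "bounded_form_on (dom D) S"
  then obtain k where k: "\<And>x y. x \<in> dom D \<Longrightarrow> y \<in> dom D \<Longrightarrow> cmod (S x y) \<le> k * norm x * norm y"
    unfolding bounded_form_on_def by blast
  have "cmod (S x y) \<le> \<bar>k\<bar> * norm x * norm y" if "x \<in> dom D" "y \<in> dom D" for x y
    by (rule order_trans[OF k[OF that]]) (intro mult_right_mono, auto)
  then obtain b where "bounded_clinear b" "\<And>x. ((\<lambda>t. quot t x) \<longlongrightarrow> b x) (at 0)"
    using strongly_differentiable_if_bounded_form[of "\<bar>k\<bar>"] by auto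
  then show "\<exists>b. form_operator b"
    using has_weak_D_derivative_form_operator[OF weak_if_strong] by blast
qed

lemma strongly_iff: "strongly_D_differentiable D a \<longleftrightarrow> (\<exists>b. form_operator b)"
proof
  assume "strongly_D_differentiable D a"
  then obtain b where b: "bounded_clinear b" "\<And>x. ((\<lambda>t. norm (quot t x - b x)) \<longlongrightarrow> 0) (at 0)"
    unfolding strongly_D_differentiable_def by blast
  have "((\<lambda>t. quot t x) \<longlongrightarrow> b x) (at 0)" for x
    using b(2)[of x] by (simp add: tendsto_norm_zero_iff LIM_zero_iff)
  then show "\<exists>b. form_operator b"
    using has_weak_D_derivative_form_operator[OF weak_if_strong[OF b(1)]] by blast
next
  assume "\<exists>b. form_operator b"
  then obtain b where b: "form_operator b" by blast
  then obtain c where c: "bounded_clinear c" "\<And>x. ((\<lambda>t. quot t x) \<longlongrightarrow> c x) (at 0)"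
    using strongly_differentiable_if_bounded_form[OF onorm_nonneg form_operator_bound[OF b]]
    by (auto simp: form_operator_def)
  have "((\<lambda>t. norm (quot t x - c x)) \<longlongrightarrow> 0) (at 0)" for x
    by (intro tendsto_norm_zero LIM_zero c(2))
  then show "strongly_D_differentiable D a"
    unfolding strongly_D_differentiable_def using c(1) by blast
qed

lemma weakly_iff: "weakly_D_differentiable D a \<longleftrightarrow> (\<exists>b. form_operator b)"
proof
  assume "weakly_D_differentiable D a"
  then show "\<exists>b. form_operator b"
    unfolding weakly_D_differentiable_def using has_weak_D_derivative_form_operator by blast
next
  assume "\<exists>b. form_operator b"
  then obtain b where b: "form_operator b" by blast
  then show "weakly_D_differentiable D a"
    using strongly_differentiable_if_bounded_form[OF onorm_nonneg form_operator_bound[OF b]] weak_if_strong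
    unfolding weakly_D_differentiable_def form_operator_def by blast
qed

text \<open>
  A finite lower limit bounds the difference quotients only for recurring small \<open>t\<close>. This suffices,
  because their matrix coefficients on \<open>dom D\<close> have a limit as \<open>t\<close> tends to 0.
\<close>

lemma Lipschitz_iff: "D_Lipschitz D a \<longleftrightarrow> (\<exists>b. form_operator b)"
proof
  assume "D_Lipschitz D a"
  then obtain C where C: "0 \<le> C" "\<exists>\<^sub>F t in at 0. ereal (onorm (quot t)) \<le> ereal C"
    unfolding D_Lipschitz_def by (rule frequently_lessD_Liminf)
  have "cmod (S x y) \<le> C * norm x * norm y" if "x \<in> dom D" "y \<in> dom D" for x y
  proof (rule ccontr)
    assume "\<not> ?thesis"
    then have "\<forall>\<^sub>F t in at 0. C * norm x * norm y < cmod (cinner (quot t x) y)"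
      using order_tendstoD(1)[OF tendsto_norm[OF quot_form[OF that]]] by simp
    with C(2) have "\<exists>\<^sub>F t in at 0. C * norm x * norm y < cmod (cinner (quot t x) y)
        \<and> ereal (onorm (quot t)) \<le> ereal C"
      by (rule frequently_eventually_conj)
    then obtain t where t: "C * norm x * norm y < cmod (cinner (quot t x) y)" "onorm (quot t) \<le> C"
      by (auto dest: frequently_ex)
    have "cmod (cinner (quot t x) y) \<le> norm (quot t x) * norm y" by (rule norm_cinner_le)
    also have "\<dots> \<le> (onorm (quot t) * norm x) * norm y"
      by (intro mult_right_mono bounded_clinear_norm_le quot_clinear) simp
    also have "\<dots> \<le> (C * norm x) * norm y" using t(2) by (intro mult_right_mono) auto
    finally show False using t(1) by simp
  qed
  then have "bounded_form_on (dom D) S" unfolding bounded_form_on_def by blast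
  then show "\<exists>b. form_operator b" by (simp add: form_operator_iff_bounded_form)
next
  assume "\<exists>b. form_operator b"
  then obtain b where b: "form_operator b" by blast
  then have nn: "0 \<le> onorm b" by (simp add: form_operator_def onorm_nonneg)
  have "\<forall>\<^sub>F t in at 0. ereal (onorm (quot t)) \<le> ereal (onorm b)"
    unfolding eventually_at_filter
    by (intro always_eventually allI impI)
      (simp add: onorm_bound[OF nn quot_bound[OF nn form_operator_bound[OF b]]])
  then have "Liminf (at 0) (\<lambda>t. ereal (onorm (quot t))) \<le> Liminf (at (0::real)) (\<lambda>t. ereal (onorm b))"
    by (rule Liminf_mono)
  also have "\<dots> = ereal (onorm b)" by (rule Liminf_const) simp
  finally show "D_Lipschitz D a" unfolding D_Lipschitz_def by auto
qed

lemma form_operator_commutator: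
  assumes b: "form_operator b" and x: "x \<in> dom D"
  shows "a x \<in> dom D" and "b x = \<i> *\<^sub>C (app (a x) - a (app x))"
  using commutator_dom[OF x, of "b x"] b x by (auto simp: form_operator_def)

lemma dom_commutator_op: "dom (commutator_op D a) = {x \<in> dom D. a x \<in> dom D}"
  by (auto simp: commutator_op_def dom_def)

lemma commutator_op_bounded:
  assumes "\<exists>b. form_operator b"
  shows "bounded_operator (commutator_op D a) \<and> dom (commutator_op D a) = dom D"
proof -
  obtain b where b: "form_operator b" using assms by blast
  have dom: "dom (commutator_op D a) = dom D"
    unfolding dom_commutator_op using form_operator_commutator(1)[OF b] by blast
  have "norm (the (commutator_op D a x)) \<le> onorm b * norm x" if x: "x \<in> dom D" for x
  proof -
    have "the (commutator_op D a x) = app (a x) - a (app x)"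
      using x form_operator_commutator(1)[OF b x] by (simp add: commutator_op_def)
    then have "norm (the (commutator_op D a x)) = norm (b x)"
      using form_operator_commutator(2)[OF b x] by (simp add: norm_scaleC)
    then show ?thesis using b bounded_clinear_norm_le[of b x] by (simp add: form_operator_def)
  qed
  then show ?thesis unfolding bounded_operator_def dom by blast
qed

lemma is_core_dom: "is_core (dom D) D"
proof -
  have "D |` dom D = D" by (rule ext) (simp add: restrict_map_def domIff)
  moreover have "closed (Map.graph D)"
    unfolding closed_sequential_limits
  proof (intro allI impI)
    fix s l assume s: "(\<forall>n. s n \<in> Map.graph D) \<and> s \<longlonglongrightarrow> l"
    have "D (fst (s n)) = Some (snd (s n))" for n using s by (auto simp: Map.graph_def split_def)
    then have d: "fst (s n) \<in> dom D" "app (fst (s n)) = snd (s n)" for n by (auto intro: domI)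
    have 1: "(\<lambda>n. fst (s n)) \<longlonglongrightarrow> fst l" using s by (intro tendsto_fst) auto
    have 2: "(\<lambda>n. app (fst (s n))) \<longlonglongrightarrow> snd l" unfolding d(2) using s by (intro tendsto_snd) auto
    have "fst l \<in> dom D" "app (fst l) = snd l"
      by (rule sa.closed_graph[where s = "\<lambda>n. fst (s n)", OF d(1) 1 2])+
    then have "D (fst l) = Some (snd l)" by (auto dest: domD)
    then show "l \<in> Map.graph D" by (cases l) (simp add: Map.graph_def)
  qed
  ultimately show ?thesis by (simp add: is_core_def sa.csubspace_dom closure_closed)
qed

text \<open>
  If \<open>Da - aD\<close> is bounded on a core, the bound on the form passes from the core to the whole domain by
  approximation in the graph norm.
\<close>

lemma form_operator_if_core:
  assumes bd: "bounded_operator (commutator_op D a)" and core: "is_core (dom (commutator_op D a)) D"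
  shows "\<exists>b. form_operator b"
proof -
  let ?V = "dom (commutator_op D a)"
  obtain k where k: "\<And>x. x \<in> ?V \<Longrightarrow> norm (the (commutator_op D a x)) \<le> k * norm x"
    using bd unfolding bounded_operator_def by blast
  have V: "cmod (S x y) \<le> k * norm x * norm y" if x: "x \<in> ?V" and y: "y \<in> dom D" for x y
  proof -
    have x': "x \<in> dom D" "a x \<in> dom D" using x by (auto simp: dom_commutator_op)
    have "S x y = \<i> * cinner (the (commutator_op D a x)) y"
      using x' by (simp add: commutator_form_def commutator_op_def sa.app_adj[OF x'(2) y, symmetric]
          cinner_diff_left algebra_simps)
    then have "cmod (S x y) \<le> norm (the (commutator_op D a x)) * norm y"
      by (simp add: norm_mult norm_cinner_le)
    also have "\<dots> \<le> (k * norm x) * norm y" using k[OF x] by (intro mult_right_mono) auto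
    finally show ?thesis .
  qed
  have "cmod (S x y) \<le> k * norm x * norm y" if x: "x \<in> dom D" and y: "y \<in> dom D" for x y
  proof -
    have "(x, app x) \<in> Map.graph D" using x by (auto simp: Map.graph_def dest: domD)
    then have "(x, app x) \<in> closure (Map.graph (D |` ?V))" using core by (simp add: is_core_def)
    then obtain s where s: "\<And>n. s n \<in> Map.graph (D |` ?V)" "s \<longlonglongrightarrow> (x, app x)"
      unfolding closure_sequential by blast
    have sn: "fst (s n) \<in> ?V" "app (fst (s n)) = snd (s n)" for n
      using s(1)[of n] by (auto simp: Map.graph_def restrict_map_def split: if_splits)
    have 1: "(\<lambda>n. fst (s n)) \<longlonglongrightarrow> x" using tendsto_fst[OF s(2)] by simp
    have 2: "(\<lambda>n. app (fst (s n))) \<longlonglongrightarrow> app x" unfolding sn(2) using tendsto_snd[OF s(2)] by simp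
    have "(\<lambda>n. S (fst (s n)) y) \<longlonglongrightarrow> S x y"
      unfolding commutator_form_def
      by (intro tendsto_intros bounded_clinear_tendsto[OF a] 1 2)
    then show ?thesis
      by (intro LIMSEQ_le[OF tendsto_norm _, of _ _ "\<lambda>n. k * norm (fst (s n)) * norm y"])
        (auto intro!: tendsto_intros 1 V[OF sn(1) y])
  qed
  then have "bounded_form_on (dom D) S" unfolding bounded_form_on_def by blast
  then show ?thesis by (simp add: form_operator_iff_bounded_form)
qed

abbreviation e :: "int \<Rightarrow> 'h \<Rightarrow> 'h" where "e \<equiv> spec_proj D"

lemma e_proj: "orthogonal_projection (e n)"
  unfolding spec_proj_def by (rule E_proj) simp

lemma e_dom: "e n x \<in> dom D"
  unfolding spec_proj_def
proof (rule bounded_set_dom)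
  show "{real_of_int n - 1 <.. real_of_int n} \<subseteq> window (nat (\<bar>n\<bar> + 1))" by auto
qed simp

lemma app_e: "x \<in> dom D \<Longrightarrow> app (e n x) = e n (app x)"
  unfolding spec_proj_def by (rule E_app(2)) simp_all

text \<open>The block \<open>De\<^sub>n\<close> is symmetric on all of the space, since it equals \<open>e\<^sub>nDe\<^sub>n\<close>.\<close>

lemma app_e_adj: "cinner (app (e n x)) y = cinner x (app (e n y))"
proof -
  have 1: "e n (app (e n z)) = app (e n z)" for z
    using app_e[OF e_dom, of n n z] by (simp add: orthogonal_projection_idem[OF e_proj])
  have "cinner (app (e n x)) y = cinner (app (e n x)) (e n y)"
    using orthogonal_projection_adj[OF e_proj, of n "app (e n x)" y] by (simp add: 1)
  also have "\<dots> = cinner (e n x) (app (e n y))" by (rule sa.app_adj[OF e_dom e_dom])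
  also have "\<dots> = cinner x (app (e n y))"
    by (simp add: orthogonal_projection_adj[OF e_proj] 1)
  finally show ?thesis .
qed

text \<open>By \<open>app_e_adj\<close> the block \<open>De\<^sub>r\<close> moves to the other side of the inner product.\<close>

lemma commutator_matrix_form: "cinner (commutator_matrix D a r c x) y = S (e c x) (e r y)"
  by (simp add: commutator_matrix_def spec_block_def commutator_form_def cinner_scaleC_left
      cinner_diff_left app_e_adj orthogonal_projection_adj[OF e_proj] right_diff_distrib)

lemma window_sum: "Q N x = (\<Sum>n\<in>{1 - int N..int N}. e n x)"
proof (induction N)
  case 0
  show ?case by (simp add: E_empty)
next
  case (Suc N)
  let ?L = "{real_of_int (- int N) - 1 <.. real_of_int (- int N)}"
  let ?R = "{real_of_int (int N + 1) - 1 <.. real_of_int (int N + 1)}"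
  have "window (Suc N) = (window N \<union> ?L) \<union> ?R" by auto
  then have "Q (Suc N) x = (Q N x + e (- int N) x) + e (int N + 1) x"
    unfolding spec_proj_def by (simp only:) (subst E_Un, simp, simp, force, subst E_Un, auto)
  moreover have "{1 - int (Suc N)..int (Suc N)} = insert (- int N) (insert (int N + 1) {1 - int N..int N})"
    by auto
  ultimately show ?case using Suc by simp
qed

lemma matrix_iff: "represents_bounded_operator D (commutator_matrix D a) \<longleftrightarrow> (\<exists>b. form_operator b)"
proof
  assume "\<exists>b. form_operator b"
  then obtain b where b: "form_operator b" by blast
  have "commutator_matrix D a r c = e r \<circ> b \<circ> e c" for r c
  proof
    fix x
    show "commutator_matrix D a r c x = (e r \<circ> b \<circ> e c) x"
    proof (rule eq_if_cinner_eq)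
      fix y
      show "cinner (commutator_matrix D a r c x) y = cinner ((e r \<circ> b \<circ> e c) x) y"
        using b e_dom by (simp add: commutator_matrix_form form_operator_def orthogonal_projection_adj[OF e_proj])
    qed
  qed
  then show "represents_bounded_operator D (commutator_matrix D a)"
    unfolding represents_bounded_operator_def using b by (auto simp: form_operator_def)
next
  assume "represents_bounded_operator D (commutator_matrix D a)"
  then obtain b where b: "bounded_clinear b" and
    m: "\<And>r c. commutator_matrix D a r c = e r \<circ> b \<circ> e c"
    unfolding represents_bounded_operator_def by blast
  have block: "S (e c x) (e r y) = cinner (b (e c x)) (e r y)" for r c x y
    unfolding commutator_matrix_form[symmetric] m by (simp add: orthogonal_projection_adj[OF e_proj])
  have dom_sum: "(\<Sum>n\<in>I. e n x) \<in> dom D" "app (\<Sum>n\<in>I. e n x) = (\<Sum>n\<in>I. app (e n x))"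
    if "finite I" for I x
    using that by (induction I rule: finite_induct)
      (simp_all add: sa.dom_zero sa.app_zero sa.dom_add sa.app_add e_dom)
  have window: "S (Q N x) (Q N y) = cinner (b (Q N x)) (Q N y)" for N x y
  proof -
    let ?I = "{1 - int N..int N}"
    have double: "cinner (\<Sum>c\<in>?I. u c) (\<Sum>r\<in>?I. v r) = (\<Sum>c\<in>?I. \<Sum>r\<in>?I. cinner (u c) (v r))"
      for u v :: "int \<Rightarrow> 'h"
      by (subst cinner_sum_left) (simp only: cinner_sum_right)
    have "S (Q N x) (Q N y) = (\<Sum>c\<in>?I. \<Sum>r\<in>?I. S (e c x) (e r y))"
      unfolding window_sum commutator_form_def dom_sum(2)[OF finite_atLeastAtMost_int]
      by (simp only: bounded_clinear_sum[OF a] double sum_distrib_left sum_subtractf)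
    also have "\<dots> = cinner (b (Q N x)) (Q N y)"
      unfolding window_sum block by (simp only: bounded_clinear_sum[OF b] double)
    finally show ?thesis .
  qed
  have "S x y = cinner (b x) y" if x: "x \<in> dom D" and y: "y \<in> dom D" for x y
  proof (rule LIMSEQ_unique)
    show "(\<lambda>N. S (Q N x) (Q N y)) \<longlonglongrightarrow> S x y"
      unfolding commutator_form_def app_Q
      by (intro tendsto_intros bounded_clinear_tendsto[OF a] window_tendsto T_tendsto x y)
    show "(\<lambda>N. S (Q N x) (Q N y)) \<longlonglongrightarrow> cinner (b x) y"
      unfolding window by (intro tendsto_intros bounded_clinear_tendsto[OF b] window_tendsto)
  qed
  then show "\<exists>b. form_operator b" unfolding form_operator_def using b by blast
qed

lemma core_iff:
  "bounded_operator (commutator_op D a) \<and> is_core (dom (commutator_op D a)) D \<longleftrightarrow> (\<exists>b. form_operator b)"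
  using form_operator_if_core commutator_op_bounded is_core_dom by metis

lemma full_domain_iff:
  "bounded_operator (commutator_op D a) \<and> dom (commutator_op D a) = dom D \<longleftrightarrow> (\<exists>b. form_operator b)"
  using form_operator_if_core commutator_op_bounded is_core_dom by metis

lemma weak_derivative:
  assumes "weakly_D_differentiable D a"
  shows "has_weak_D_derivative D a (weak_D_derivative D a)"
proof -
  obtain b where b: "has_weak_D_derivative D a b"
    using assms unfolding weakly_D_differentiable_def by blast
  have "c = b" if "has_weak_D_derivative D a c" for c
    using that b by (intro form_operator_unique has_weak_D_derivative_form_operator)
  with b have "weak_D_derivative D a = b"
    unfolding weak_D_derivative_def by (intro the_equality)
  with b show ?thesis by simp
qed

lemma weak_derivative_limit:
  assumes b: "has_weak_D_derivative D a b"
  shows "((\<lambda>t. cinner (alpha D t a x - a x) y / complex_of_real t) \<longlongrightarrow> cinner (b x) y) (at 0)"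
proof -
  have "((\<lambda>t. cinner (quot t x - b x) y) \<longlongrightarrow> 0) (at 0)"
    using b unfolding has_weak_D_derivative_def by (blast intro: tendsto_norm_zero_cancel)
  then have "((\<lambda>t. cinner (quot t x) y) \<longlongrightarrow> cinner (b x) y) (at 0)"
    unfolding cinner_diff_left by (rule LIM_zero_cancel)
  then show ?thesis
    by (simp add: diff_quotient_def cinner_scaleR_left divide_inverse mult.commute)
qed

lemma weak_derivative_commutator:
  assumes b: "form_operator b"
  shows "(Some \<circ> b) |` dom D = map_option (scaleC \<i>) \<circ> commutator_op D a"
proof
  fix x
  show "((Some \<circ> b) |` dom D) x = (map_option (scaleC \<i>) \<circ> commutator_op D a) x"
    using form_operator_commutator[OF b, of x]
    by (cases "x \<in> dom D") (auto simp: restrict_map_def commutator_op_def)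
qed

lemma weak_derivative_Lipschitz:
  assumes b: "form_operator b"
  shows "onorm (\<lambda>x. alpha D t a x - a x) \<le> onorm b * \<bar>t\<bar>"
proof (rule onorm_bound)
  have nn: "0 \<le> onorm b" using b by (simp add: form_operator_def onorm_nonneg)
  then show "0 \<le> onorm b * \<bar>t\<bar>" by simp
  show "norm (alpha D t a x - a x) \<le> onorm b * \<bar>t\<bar> * norm x" for x
    by (rule alpha_Lipschitz[OF nn form_operator_bound[OF b]])
qed

end

theorem theorem3p8:
  fixes D :: "'h::chilbert_space \<rightharpoonup> 'h" and a :: "'h \<Rightarrow> 'h"
  assumes "self_adjoint D" and "bounded_clinear a"
  shows
    "(strongly_D_differentiable D a \<longleftrightarrow> weakly_D_differentiable D a)
     \<and> (weakly_D_differentiable D a \<longleftrightarrow> D_Lipschitz D a)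
     \<and> (D_Lipschitz D a \<longleftrightarrow> bounded_form_on (dom D) (commutator_form D a))
     \<and> (bounded_form_on (dom D) (commutator_form D a)
         \<longleftrightarrow> represents_bounded_operator D (commutator_matrix D a))
     \<and> (represents_bounded_operator D (commutator_matrix D a)
         \<longleftrightarrow> bounded_operator (commutator_op D a) \<and> is_core (dom (commutator_op D a)) D)
     \<and> (bounded_operator (commutator_op D a) \<and> is_core (dom (commutator_op D a)) D
         \<longleftrightarrow> bounded_operator (commutator_op D a) \<and> dom (commutator_op D a) = dom D)
     \<and> (weakly_D_differentiable D a \<longrightarrow>
          (\<forall>\<xi> \<eta>. ((\<lambda>t::real. cinner (alpha D t a \<xi> - a \<xi>) \<eta> / complex_of_real t)
                     \<longlongrightarrow> cinner (weak_D_derivative D a \<xi>) \<eta>) (at 0))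
        \<and> a ` dom D \<subseteq> dom D
        \<and> (Some \<circ> weak_D_derivative D a) |` dom D = map_option (scaleC \<i>) \<circ> commutator_op D a
        \<and> (\<forall>t::real. onorm (\<lambda>\<xi>. alpha D t a \<xi> - a \<xi>) \<le> onorm (weak_D_derivative D a) * \<bar>t\<bar>))"
proof -
  interpret derivation D a by unfold_locales (fact assms)+
  have deriv: "(\<forall>\<xi> \<eta>. ((\<lambda>t::real. cinner (alpha D t a \<xi> - a \<xi>) \<eta> / complex_of_real t)
                     \<longlongrightarrow> cinner (weak_D_derivative D a \<xi>) \<eta>) (at 0))
        \<and> a ` dom D \<subseteq> dom D
        \<and> (Some \<circ> weak_D_derivative D a) |` dom D = map_option (scaleC \<i>) \<circ> commutator_op D a
        \<and> (\<forall>t::real. onorm (\<lambda>\<xi>. alpha D t a \<xi> - a \<xi>) \<le> onorm (weak_D_derivative D a) * \<bar>t\<bar>)"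
    if "weakly_D_differentiable D a"
  proof -
    note w = weak_derivative[OF that]
    note f = has_weak_D_derivative_form_operator[OF w]
    show ?thesis
      using weak_derivative_limit[OF w] form_operator_commutator(1)[OF f]
        weak_derivative_commutator[OF f] weak_derivative_Lipschitz[OF f]
      by blast
  qed
  show ?thesis
    unfolding core_iff full_domain_iff strongly_iff Lipschitz_iff matrix_iff
      form_operator_iff_bounded_form[symmetric]
    using deriv by (simp add: weakly_iff)
qed

end
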